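(* Let $\Sigma\subset\mathbb{R}^3$ be an immersed rotationally symmetric self-shrinking torus. Let $F(\Sigma)$ denote the entropy of $\Sigma$, let $r$ be the distance from the axis of rotation, let $r_{\min}$ and $r_{\max}$ be the minimum and maximum of $r$ on $\Sigma$, and let $\sigma=\frac12re^{-|x|^2/4}$. Let $i(\Sigma)$ be the index of $\Sigma$, with the convention that the translation and dilation variations are excluded from the count. Then $$i(\Sigma)\le2\left\lceil\frac{F(\Sigma)}{2\pi}\max_\Sigma\sigma^{-1}\sqrt{1+\frac1{r^2}}\right\rceil-5+\sum_{1\le k<\sqrt{1+r_{\max}^2}}\left(4\left\lceil\frac{F(\Sigma)}{2\pi}\max_\Sigma\sigma^{-1}\sqrt{1+\frac{1-k^2}{r^2}}\right\rceil-2\right),$$ and $$i(\Sigma)\ge2\left\lfloor\frac{F(\Sigma)}{2\pi}\min_\Sigma\sigma^{-1}\sqrt{1+\frac1{r^2}}\right\rfloor-3+\sum_{1\le k\le\sqrt{1+r_{\min}^2}}\left(4\left\lfloor\frac{F(\Sigma)}{2\pi}\min_\Sigma\sigma^{-1}\sqrt{1+\frac{1-k^2}{r^2}}\right\rfloor+2\right),$$ where the sums are over integers $k$ and each $\max_\Sigma$ is taken over all points of $\Sigma$ where the expression is defined; except that, if for some nonnegative integer $k$ the function $\frac{F(\Sigma)}{2\pi}\sigma^{-1}\sqrt{1+\frac{1-k^2}{r^2}}$ is constant on $\Sigma$ and equal to an integer, then the lower bound is modified as follows: if this value of $k$ is zero, the term $-3$ in the lower bound must be replaced with $-5$; if this value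 of $k$ is positive, the term $-3$ must be replaced with $-7$.
   Context: Let $x$ denote the position vector in $\mathbb{R}^3$, with cylindrical coordinates $(r,\theta,z)$; the axis of rotation is $\{r=0\}$ and $|x|^2=r^2+z^2$. For an immersed oriented surface $\Sigma\subset\mathbb{R}^3$ with unit normal $\mathbf{n}$, write $v^\perp=\langle v,\mathbf{n}\rangle$, let $A_\Sigma(v,w)=(\nabla_v w)^\perp$ be the second fundamental form and $H_\Sigma=-\operatorname{tr}A_\Sigma$ the mean curvature. Mean curvature flow is $\dot x=-H_\Sigma\mathbf{n}$. $\Sigma$ is a self-shrinker if $\Sigma_t=\sqrt{-t}\,\Sigma$, $t<0$, is a mean curvature flow; equivalently $H_\Sigma=\frac12x^\perp$. A rotationally symmetric torus is one invariant under rotations about $\{r=0\}$, generated by rotating its cross-section $\Gamma$, an immersed closed curve in the open half-plane $\{(r,z):r>0\}$ (so it stays away from the axis). The $F$-functional is $F(\Sigma)=\frac{1}{4\pi}\int_\Sigma e^{-|x|^2/4}$. The entropy of $\Sigma$ is $\sup_{x_0\in\mathbb{R}^3,\,t_0>0}F(x_0+\sqrt{t_0}\,\Sigma)$; for a self-shrinker the entropy equals $F(\Sigma)$. The stability operator acting on functions $f\colon\Sigma\to\mathbb{R}$ is $L_\Sigma f=\mathcal{L}_\Sigma f+|A_\Sigma|^2f+\frac12f$, where $\mathcal{L}_\Sigma f=e^{|x|^2/4}\operatorname{div}_\Sigma(e^{-|x|^2/4}\operatorname{grad}_\Sigma f)$. Sign convention: $f\neq0$ is an eigenfunction of $L$ with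 eigenvalue $\lambda$ if $-Lf=\lambda f$. The index $i(\Sigma)$ is the number of negative eigenvalues of $L_\Sigma$ (counted with multiplicity), excluding those corresponding to translations (eigenfunctions $v^\perp$ for $v\in\mathbb{R}^3$, eigenvalue $-\frac12$) and dilation (eigenfunction $H_\Sigma$, eigenvalue $-1$). For a compact self-shrinker in $\mathbb{R}^3$ this is the number of negative eigenvalues minus $4$. $\lfloor a\rfloor$ and $\lceil a\rceil$ denote the largest integer $\le a$ and the smallest integer $\ge a$. *)

theory Defs
  imports
    "HOL-Analysis.Analysis"
    "HOL-Library.Function_Algebras"
    "HOL-Library.Extended_Real"
begin

section \<open>Parametrized surfaces in three-space\<close>

text \<open>
  An immersed torus is given by a doubly periodic immersion \<open>X\<close> of the plane, i.e. an
  immersion of the quotient of the plane by the lattice with periods \<open>P $ 1\<close> and \<open>P $ 2\<close>.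
  Functions on the immersed surface are doubly periodic functions of the parameters, so
  points of the surface visited several times are counted several times.
\<close>

definition pd :: "2 \<Rightarrow> (real^2 \<Rightarrow> 'a::real_normed_vector) \<Rightarrow> real^2 \<Rightarrow> 'a" where
  "pd i f p = vector_derivative (\<lambda>t. f (p + t *\<^sub>R axis i 1)) (at 0)"

text \<open>Class \<open>C\<^sup>\<infinity>\<close>: all iterated partial derivatives exist and are (Frechet) differentiable.\<close>

definition smooth :: "(real^2 \<Rightarrow> 'a::real_normed_vector) \<Rightarrow> bool" where
  "smooth f \<longleftrightarrow> (\<forall>is p. foldr pd is f differentiable (at p))"

definition doubly_periodic :: "real^2 \<Rightarrow> (real^2 \<Rightarrow> 'a) \<Rightarrow> bool" where
  "doubly_periodic P f \<longleftrightarrow> (\<forall>i p. f (p + P $ i *\<^sub>R axis i 1) = f p)"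

definition metric :: "(real^2 \<Rightarrow> real^3) \<Rightarrow> real^2 \<Rightarrow> real^2^2" where
  "metric X p = (\<chi> i j. pd i X p \<bullet> pd j X p)"

definition area_density :: "(real^2 \<Rightarrow> real^3) \<Rightarrow> real^2 \<Rightarrow> real" where
  "area_density X p = sqrt (det (metric X p))"

text \<open>
  The orientation is the one induced by the parametrization. Reversing it changes the sign of
  the normal part, the second fundamental form and the mean curvature, but affects neither the
  shrinker equation nor the stability operator nor the index.
\<close>

definition unit_normal :: "(real^2 \<Rightarrow> real^3) \<Rightarrow> real^2 \<Rightarrow> real^3" where
  "unit_normal X p = sgn (cross3 (pd 1 X p) (pd 2 X p))"

definition normal_part :: "(real^2 \<Rightarrow> real^3) \<Rightarrow> real^3 \<Rightarrow> real^2 \<Rightarrow> real" where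
  "normal_part X v p = v \<bullet> unit_normal X p"

definition second_form :: "(real^2 \<Rightarrow> real^3) \<Rightarrow> real^2 \<Rightarrow> real^2^2" where
  "second_form X p = (\<chi> i j. normal_part X (pd i (pd j X) p) p)"

text \<open>The second fundamental form with one index raised by the metric.\<close>

definition shape_operator :: "(real^2 \<Rightarrow> real^3) \<Rightarrow> real^2 \<Rightarrow> real^2^2" where
  "shape_operator X p = matrix_inv (metric X p) ** second_form X p"

definition mean_curvature :: "(real^2 \<Rightarrow> real^3) \<Rightarrow> real^2 \<Rightarrow> real" where
  "mean_curvature X p = - trace (shape_operator X p)"

text \<open>The squared norm with respect to the metric, \<open>g\<^sup>i\<^sup>k g\<^sup>j\<^sup>l A\<^sub>i\<^sub>j A\<^sub>k\<^sub>l\<close>.\<close>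

definition second_form_norm2 :: "(real^2 \<Rightarrow> real^3) \<Rightarrow> real^2 \<Rightarrow> real" where
  "second_form_norm2 X p = trace (shape_operator X p ** shape_operator X p)"

definition self_shrinker :: "(real^2 \<Rightarrow> real^3) \<Rightarrow> bool" where
  "self_shrinker X \<longleftrightarrow> (\<forall>p. mean_curvature X p = normal_part X (X p) p / 2)"

text \<open>Gradient and divergence, for tangent fields written in the coordinate frame.\<close>

definition surf_grad :: "(real^2 \<Rightarrow> real^3) \<Rightarrow> (real^2 \<Rightarrow> real) \<Rightarrow> real^2 \<Rightarrow> real^2" where
  "surf_grad X f p = matrix_inv (metric X p) *v (\<chi> j. pd j f p)"

definition surf_div :: "(real^2 \<Rightarrow> real^3) \<Rightarrow> (real^2 \<Rightarrow> real^2) \<Rightarrow> real^2 \<Rightarrow> real" where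
  "surf_div X V p = (\<Sum>i\<in>UNIV. pd i (\<lambda>q. area_density X q * V q $ i) p) / area_density X p"

definition drift_laplacian :: "(real^2 \<Rightarrow> real^3) \<Rightarrow> (real^2 \<Rightarrow> real) \<Rightarrow> real^2 \<Rightarrow> real" where
  "drift_laplacian X f p =
     exp ((norm (X p))\<^sup>2 / 4) *
     surf_div X (\<lambda>q. exp (- (norm (X q))\<^sup>2 / 4) *\<^sub>R surf_grad X f q) p"

definition stability_op :: "(real^2 \<Rightarrow> real^3) \<Rightarrow> (real^2 \<Rightarrow> real) \<Rightarrow> real^2 \<Rightarrow> real" where
  "stability_op X f p = drift_laplacian X f p + second_form_norm2 X p * f p + f p / 2"


section \<open>The F-functional and the entropy\<close>

definition F_functional :: "real^2 \<Rightarrow> (real^2 \<Rightarrow> real^3) \<Rightarrow> real" where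
  "F_functional P X =
     1 / (4 * pi) * integral (cbox 0 P) (\<lambda>p. exp (- (norm (X p))\<^sup>2 / 4) * area_density X p)"

definition surface_entropy :: "real^2 \<Rightarrow> (real^2 \<Rightarrow> real^3) \<Rightarrow> real" where
  "surface_entropy P X =
     (SUP (x0, t0) \<in> UNIV \<times> {0<..}. F_functional P (\<lambda>p. x0 + sqrt t0 *\<^sub>R X p))"


section \<open>The index\<close>

definition scale_fun :: "real \<Rightarrow> ('a \<Rightarrow> real) \<Rightarrow> 'a \<Rightarrow> real" where
  "scale_fun c f = (\<lambda>x. c * f x)"

interpretation fun_space: vector_space "scale_fun :: real \<Rightarrow> ('a \<Rightarrow> real) \<Rightarrow> 'a \<Rightarrow> real"
  by unfold_locales (auto simp: scale_fun_def algebra_simps)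

text \<open>Dimension with value \<open>\<infinity>\<close>, rather than \<open>0\<close>, for infinite-dimensional spaces.\<close>

definition edim :: "('a \<Rightarrow> real) set \<Rightarrow> enat" where
  "edim V = (if \<exists>B. finite B \<and> V \<subseteq> fun_space.span B then enat (fun_space.dim V) else \<infinity>)"

definition eigenspace :: "real^2 \<Rightarrow> (real^2 \<Rightarrow> real^3) \<Rightarrow> real \<Rightarrow> (real^2 \<Rightarrow> real) set" where
  "eigenspace P X \<mu> =
     {f. smooth f \<and> doubly_periodic P f \<and> (\<forall>p. - stability_op X f p = \<mu> * f p)}"

text \<open>
  The sum of the multiplicities of all negative eigenvalues, as the supremum of the finite
  partial sums; numbers that are not eigenvalues contribute \<open>0\<close>.
\<close>

definition num_negative_eigenvalues :: "real^2 \<Rightarrow> (real^2 \<Rightarrow> real^3) \<Rightarrow> enat" where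
  "num_negative_eigenvalues P X =
     (SUP S \<in> {S. finite S \<and> S \<subseteq> {..<0}}. \<Sum>\<mu>\<in>S. edim (eigenspace P X \<mu>))"

text \<open>
  For a self-shrinker, \<open>v\<^sup>\<bottom>\<close> has eigenvalue \<open>-1/2\<close> and the mean curvature has eigenvalue
  \<open>-1\<close>, so the two excluded spaces lie in different eigenspaces and their dimensions add up.
\<close>

definition translation_variations :: "(real^2 \<Rightarrow> real^3) \<Rightarrow> (real^2 \<Rightarrow> real) set" where
  "translation_variations X = range (normal_part X)"

definition dilation_variations :: "(real^2 \<Rightarrow> real^3) \<Rightarrow> (real^2 \<Rightarrow> real) set" where
  "dilation_variations X = fun_space.span {mean_curvature X}"

definition surface_index :: "real^2 \<Rightarrow> (real^2 \<Rightarrow> real^3) \<Rightarrow> ereal" where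
  "surface_index P X =
     ereal_of_enat (num_negative_eigenvalues P X) -
     ereal_of_enat (edim (translation_variations X) + edim (dilation_variations X))"


section \<open>Rotationally symmetric tori\<close>

text \<open>The cross-section is \<open>s \<mapsto> (r s, z s)\<close> with period \<open>T\<close>; it may have self-intersections.\<close>

definition closed_halfplane_curve :: "real \<Rightarrow> (real \<Rightarrow> real) \<Rightarrow> (real \<Rightarrow> real) \<Rightarrow> bool" where
  "closed_halfplane_curve T r z \<longleftrightarrow>
     T > 0 \<and>
     (\<forall>n s. (deriv ^^ n) r differentiable (at s) \<and> (deriv ^^ n) z differentiable (at s)) \<and>
     (\<forall>s. r (s + T) = r s \<and> z (s + T) = z s) \<and>
     (\<forall>s. deriv r s \<noteq> 0 \<or> deriv z s \<noteq> 0) \<and>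
     (\<forall>s. r s > 0)"

definition revolve :: "(real \<Rightarrow> real) \<Rightarrow> (real \<Rightarrow> real) \<Rightarrow> real^2 \<Rightarrow> real^3" where
  "revolve r z p = vector [r (p $ 1) * cos (p $ 2), r (p $ 1) * sin (p $ 2), z (p $ 1)]"

definition torus_periods :: "real \<Rightarrow> real^2" where
  "torus_periods T = vector [T, 2 * pi]"

definition axis_dist :: "real^3 \<Rightarrow> real" where
  "axis_dist x = sqrt ((x $ 1)\<^sup>2 + (x $ 2)\<^sup>2)"

definition weight :: "real^3 \<Rightarrow> real" where
  "weight x = 1 / 2 * axis_dist x * exp (- (norm x)\<^sup>2 / 4)"

text \<open>
  The function \<open>\<sigma>\<^sup>-\<^sup>1 sqrt (1 + (1 - k\<^sup>2) / r\<^sup>2)\<close>. It is defined only where the radicand is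
  nonnegative, whereas the total \<^const>\<open>sqrt\<close> is an odd function; the domain has to be
  imposed separately.
\<close>

definition radicand :: "nat \<Rightarrow> real^3 \<Rightarrow> real" where
  "radicand k x = 1 + (1 - (real k)\<^sup>2) / (axis_dist x)\<^sup>2"

definition mode_fun :: "nat \<Rightarrow> real^3 \<Rightarrow> real" where
  "mode_fun k x = inverse (weight x) * sqrt (radicand k x)"

text \<open>Extrema are attained, as they are only used for continuous functions on compact sets.\<close>

definition max_on :: "'a set \<Rightarrow> ('a \<Rightarrow> real) \<Rightarrow> real" where
  "max_on S f = (SUP x \<in> S. f x)"

definition min_on :: "'a set \<Rightarrow> ('a \<Rightarrow> real) \<Rightarrow> real" where
  "min_on S f = (INF x \<in> S. f x)"

definition max_mode :: "(real^3) set \<Rightarrow> nat \<Rightarrow> real" where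
  "max_mode S k = max_on {x \<in> S. radicand k x \<ge> 0} (mode_fun k)"

definition min_mode :: "(real^3) set \<Rightarrow> nat \<Rightarrow> real" where
  "min_mode S k = min_on {x \<in> S. radicand k x \<ge> 0} (mode_fun k)"

text \<open>The function \<open>F / (2 \<pi>) \<sigma>\<^sup>-\<^sup>1 sqrt (1 + (1 - k\<^sup>2) / r\<^sup>2)\<close> is defined on all of \<open>S\<close>,
  constant, and equal to an integer.\<close>

definition integer_constant_mode :: "(real^3) set \<Rightarrow> real \<Rightarrow> nat \<Rightarrow> bool" where
  "integer_constant_mode S F k \<longleftrightarrow>
     (\<forall>x\<in>S. radicand k x \<ge> 0) \<and>
     (\<exists>m::int. \<forall>x\<in>S. F / (2 * pi) * mode_fun k x = of_int m)"

definition index_upper :: "(real^3) set \<Rightarrow> real \<Rightarrow> int" where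
  "index_upper S F =
     2 * \<lceil>F / (2 * pi) * max_mode S 0\<rceil> - 5 +
     (\<Sum>k | 1 \<le> k \<and> real k < sqrt (1 + (max_on S axis_dist)\<^sup>2).
        4 * \<lceil>F / (2 * pi) * max_mode S k\<rceil> - 2)"

text \<open>The parameter \<open>c\<close> is the constant subtracted, generically \<open>3\<close>.\<close>

definition index_lower :: "int \<Rightarrow> (real^3) set \<Rightarrow> real \<Rightarrow> int" where
  "index_lower c S F =
     2 * \<lfloor>F / (2 * pi) * min_mode S 0\<rfloor> - c +
     (\<Sum>k | 1 \<le> k \<and> real k \<le> sqrt (1 + (min_on S axis_dist)\<^sup>2).
        4 * \<lfloor>F / (2 * pi) * min_mode S k\<rfloor> + 2)"

end

theory Submission
  imports Defs
begin


text \<open>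
  \<^bold>\<open>Reduction to ordinary differential equations.\<close> The stability operator commutes with the rotations
  about the axis, so its eigenfunctions are sums of products \<open>u s * cos (k * t)\<close> and
  \<open>u s * sin (k * t)\<close>, where \<open>s\<close> is the parameter of the profile and \<open>t\<close> the angle
  (\<open>fourier_complete\<close>, \<open>eigenspace_edim\<close>): frequency \<open>0\<close> counts once and every other frequency
  twice. For a self-shrinker the profile is a closed geodesic of the metric
  \<open>\<sigma>\<^sup>2 * (dr\<^sup>2 + dz\<^sup>2)\<close> on the half-plane. In terms of \<open>y = \<sigma> * u\<close> and of the arc length of this
  metric, the eigenvalue equation becomes
  \<open>y'' + (Q\<^sub>k + \<mu> / \<sigma>\<^sup>2) * y = 0\<close> with \<open>Q\<^sub>k = (1 + (1 - k\<^sup>2) / r\<^sup>2) / \<sigma>\<^sup>2\<close>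
  (\<open>mode_from_ode\<close>, \<open>ode_from_mode\<close>), and the period is the length of the profile. That length is the
  value of the \<open>F\<close>-functional. It is also the entropy: on suitable paths of Gaussians that start with
  centre \<open>0\<close> and scale \<open>1\<close>, the derivative of the Gaussian area is minus the integral of a square
  (\<open>heat_decreasing\<close>, \<open>entropy_eq_length\<close>).

  \<^bold>\<open>Counting by rotation.\<close> A solution \<open>(y, y')\<close> of such an equation winds around the origin. If the
  potential is \<open>M\<^sup>2\<close> at \<open>\<mu> = 0\<close>, it does so uniformly with velocity \<open>M\<close> in a suitable scale, and the
  negative eigenvalues correspond to the integers \<open>n\<close> with \<open>2 * \<pi> * \<bar>n\<bar> < M * F\<close>. For a variable
  potential, consider the greatest and the least angle by which a direction turns during one period.
  The monodromy map preserves area, and this implies that there are periodic solutions with \<open>n\<close>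
  whole turns exactly when one of the two extremal turns is \<open>2 * \<pi> * n\<close>; each of the two accounts for
  one dimension (\<open>periodic_solutions_basis\<close>). Both extremal turns increase strictly and continuously
  with \<open>\<mu>\<close>, and for very negative \<open>\<mu>\<close> there is hardly any rotation. So the number of negative
  eigenvalues is the number of multiples of \<open>2 * \<pi>\<close> that the extremal turns have passed when \<open>\<mu>\<close>
  reaches \<open>0\<close> (\<open>sum_mult_le\<close>, \<open>sum_mult_ge\<close>), and comparison with the uniform rotations for the
  maximum and the minimum of the potential bounds these turns (\<open>turn_le_integral\<close>,
  \<open>integral_le_turn\<close>).

  \<^bold>\<open>The borderline.\<close> When the uniform rotation for the minimum of the potential makes a whole number of
  turns, the comparison is still strict unless the potential is constant. This is why the lower bound
  counts the borderline integers \<open>n\<close> and \<open>- n\<close>, and why it drops by two, or by four for a positive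
  frequency, if the mode function is constant and an integer. At most one frequency can be of this kind
  (\<open>constant_mode_unique\<close>). The three translations and the dilation are independent within their
  eigenspaces, which subtracts four from all counts (\<open>surface_index_eq\<close>).
\<close>

section \<open>A scalar ordinary differential equation\<close>

definition antideriv0 :: "(real \<Rightarrow> real) \<Rightarrow> real \<Rightarrow> real" where
  "antideriv0 g t = (if 0 \<le> t then integral {0..t} g else - integral {t..0} g)"

lemma antideriv0_0 [simp]: "antideriv0 g 0 = 0"
  by (simp add: antideriv0_def)

lemma antideriv0_eq_shifted:
  assumes "continuous_on UNIV g" "0 < R" "-R \<le> t"
  shows "antideriv0 g t = integral {-R..t} g - integral {-R..0} g"
proof (cases "0 \<le> t")
  case True
  have "integral {-R..0} g + integral {0..t} g = integral {-R..t} g"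
    by (rule Henstock_Kurzweil_Integration.integral_combine)
      (use assms True in \<open>auto intro!: integrable_continuous_real continuous_on_subset[OF assms(1)]\<close>)
  then show ?thesis using True by (simp add: antideriv0_def)
next
  case False
  have "integral {-R..t} g + integral {t..0} g = integral {-R..0} g"
    by (rule Henstock_Kurzweil_Integration.integral_combine)
      (use assms False in \<open>auto intro!: integrable_continuous_real continuous_on_subset[OF assms(1)]\<close>)
  then show ?thesis using False by (simp add: antideriv0_def)
qed

lemma antideriv0_deriv:
  assumes "continuous_on UNIV g"
  shows "(antideriv0 g has_real_derivative g t) (at t)"
proof -
  define R where "R = \<bar>t\<bar> + 1"
  have R: "0 < R" "-R < t" "t < R" by (auto simp: R_def)
  have "((\<lambda>u. integral {-R..u} g) has_real_derivative g t) (at t within {-R..R})"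
    by (rule integral_has_real_derivative) (use R in \<open>auto intro: continuous_on_subset[OF assms]\<close>)
  then have "((\<lambda>u. integral {-R..u} g - integral {-R..0} g) has_real_derivative g t) (at t within {-R..R})"
    by (auto intro!: derivative_eq_intros)
  then have *: "((\<lambda>u. integral {-R..u} g - integral {-R..0} g) has_real_derivative g t) (at t)"
    using R by (simp add: at_within_Icc_at)
  show ?thesis
    by (rule has_field_derivative_transform_within_open[OF *, of "{-R<..<R}"])
      (use R antideriv0_eq_shifted[OF assms R(1)] in auto)
qed

text \<open>
  The exponential weight makes integration from \<open>0\<close> lose a factor \<open>K\<close> on the whole line, in both
  directions; a Lipschitz constant below \<open>K\<close> is then harmless.
\<close>

lemma antideriv_exp_bound:
  fixes G g :: "real \<Rightarrow> real"
  assumes d: "\<And>s. (G has_real_derivative g s) (at s)" and "G 0 = 0"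
    and b: "\<And>s. \<bar>g s\<bar> \<le> C * exp (K * \<bar>s\<bar>)" and K: "K > 0"
  shows "\<bar>G t\<bar> \<le> C / K * exp (K * \<bar>t\<bar>)"
proof -
  have C: "C \<ge> 0" using b[of 0] by simp
  have main: "H t \<le> C / K * exp (K * t)" if d: "\<And>s. (H has_real_derivative h s) (at s)" and "H 0 = 0"
    and b: "\<And>s. h s \<le> C * exp (K * \<bar>s\<bar>)" and t: "t \<ge> 0" for H h and t :: real
  proof -
    have "(C / K * exp (K * 0) - H 0) \<le> (C / K * exp (K * t) - H t)"
    proof (rule DERIV_nonneg_imp_nondecreasing[OF t])
      fix x assume "0 \<le> x" "x \<le> t"
      then show "\<exists>y. ((\<lambda>x. C / K * exp (K * x) - H x) has_real_derivative y) (at x) \<and> 0 \<le> y"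
        using b[of x] K by (intro exI[of _ "C * exp (K * x) - h x"]) (auto intro!: derivative_eq_intros d)
    qed
    then show ?thesis using divide_nonneg_pos[OF C K] \<open>H 0 = 0\<close> by simp
  qed
  have neg: "((\<lambda>s. - G s) has_real_derivative - g s) (at s)" for s
    by (auto intro!: derivative_eq_intros d)
  have refl: "((\<lambda>s. G (- s)) has_real_derivative - g (- s)) (at s)" for s
    using d[of "-s"] by (simp add: DERIV_mirror)
  have negrefl: "((\<lambda>s. - G (- s)) has_real_derivative g (- s)) (at s)" for s
    using DERIV_minus[OF refl[of s]] by simp
  have b': "g s \<le> C * exp (K * \<bar>s\<bar>)" "- g s \<le> C * exp (K * \<bar>s\<bar>)" for s
    using b[of s] by linarith+
  have b'': "g (- s) \<le> C * exp (K * \<bar>s\<bar>)" "- g (- s) \<le> C * exp (K * \<bar>s\<bar>)" for s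
    using b[of "- s"] by simp_all
  show ?thesis
  proof (cases "t \<ge> 0")
    case True
    then show ?thesis
      using main[of G g t, OF d] main[of "\<lambda>s. - G s" "\<lambda>s. - g s" t, OF neg] assms(2) b' by simp
  next
    case False
    then show ?thesis
      using main[of "\<lambda>s. G (- s)" "\<lambda>s. - g (- s)" "- t", OF refl]
        main[of "\<lambda>s. - G (- s)" "\<lambda>s. g (- s)" "- t", OF negrefl] assms(2) b'' by simp
  qed
qed

text \<open>
  Picard iteration with a weight: the unknown is written as \<open>\<alpha> + exp (K * \<bar>s\<bar>) * \<psi> s\<close> with a bounded
  continuous \<open>\<psi>\<close>. For \<open>K\<close> above the Lipschitz constant the integral equation is a contraction
  for \<open>\<psi>\<close>, so that a single fixed point gives the solution for all times.
\<close>

theorem bounded_lipschitz_ode_exists: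
  fixes G :: "real \<Rightarrow> real \<Rightarrow> real"
  assumes cont: "\<And>x. continuous_on UNIV x \<Longrightarrow> continuous_on UNIV (\<lambda>s. G s (x s))"
    and lip: "\<And>s x y. \<bar>G s x - G s y\<bar> \<le> L * \<bar>x - y\<bar>"
    and bnd: "\<And>s x. \<bar>G s x\<bar> \<le> C"
  obtains \<phi> where "\<phi> 0 = \<alpha>" "\<And>s. (\<phi> has_real_derivative G s (\<phi> s)) (at s)"
proof -
  have L: "L \<ge> 0" using lip[of 0 1 0] by simp
  define K where "K = L + 1"
  have K: "K > 0" using L by (simp add: K_def)
  have C: "C \<ge> 0" using bnd[of 0 0] by linarith
  define lift where "lift \<psi> s = \<alpha> + exp (K * \<bar>s\<bar>) * apply_bcontfun \<psi> s" for \<psi> and s :: real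
  define op where "op \<psi> t = exp (- K * \<bar>t\<bar>) * antideriv0 (\<lambda>s. G s (lift \<psi> s)) t" for \<psi> and t :: real
  have clift: "continuous_on UNIV (lift \<psi>)" for \<psi>
    unfolding lift_def[abs_def] by (intro continuous_intros) auto
  have cG: "continuous_on UNIV (\<lambda>s. G s (lift \<psi> s))" for \<psi>
    by (rule cont[OF clift])
  have dJ: "(antideriv0 (\<lambda>s. G s (lift \<psi> s)) has_real_derivative G s (lift \<psi> s)) (at s)" for \<psi> s
    by (rule antideriv0_deriv[OF cG])
  have op_bound: "\<bar>op \<psi> t\<bar> \<le> C / K" for \<psi> t
  proof -
    have "\<bar>antideriv0 (\<lambda>s. G s (lift \<psi> s)) t\<bar> \<le> C / K * exp (K * \<bar>t\<bar>)"
    proof (rule antideriv_exp_bound[OF dJ])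
      fix s
      have "C * 1 \<le> C * exp (K * \<bar>s\<bar>)" using C K by (intro mult_left_mono) auto
      then show "\<bar>G s (lift \<psi> s)\<bar> \<le> C * exp (K * \<bar>s\<bar>)" using bnd[of s "lift \<psi> s"] by simp
    qed (use K in auto)
    then have "\<bar>op \<psi> t\<bar> \<le> exp (- K * \<bar>t\<bar>) * (C / K * exp (K * \<bar>t\<bar>))"
      unfolding op_def abs_mult by (intro mult_mono) auto
    also have "\<dots> = C / K" by (simp add: exp_minus field_simps)
    finally show ?thesis .
  qed
  have op_cont: "continuous_on UNIV (op \<psi>)" for \<psi>
    unfolding op_def[abs_def]
    by (intro continuous_intros DERIV_continuous_on[where D="\<lambda>s. G s (lift \<psi> s)"]) (auto intro: dJ)
  have op_in: "op \<psi> \<in> bcontfun" for \<psi>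
    using op_cont op_bound by (auto simp: bcontfun_def bounded_iff)
  define opC where "opC \<psi> = Bcontfun (op \<psi>)" for \<psi>
  have opC: "apply_bcontfun (opC \<psi>) = op \<psi>" for \<psi>
    unfolding opC_def by (rule Bcontfun_inverse[OF op_in])
  have "\<exists>!\<psi>. opC \<psi> = \<psi>"
  proof (rule banach_fix_type[where c="L / K"])
    show "0 \<le> L / K" "L / K < 1" using L by (auto simp: K_def)
    show "\<forall>x y. dist (opC x) (opC y) \<le> L / K * dist x y"
    proof (intro allI dist_bound)
      fix x y t
      let ?D = "\<lambda>t. antideriv0 (\<lambda>s. G s (lift x s)) t - antideriv0 (\<lambda>s. G s (lift y s)) t"
      have "\<bar>?D t\<bar> \<le> (L * dist x y) / K * exp (K * \<bar>t\<bar>)"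
      proof (rule antideriv_exp_bound[OF DERIV_diff[OF dJ dJ]])
        fix s
        have "\<bar>G s (lift x s) - G s (lift y s)\<bar> \<le> L * \<bar>lift x s - lift y s\<bar>" by (rule lip)
        also have "\<bar>lift x s - lift y s\<bar> = exp (K * \<bar>s\<bar>) * dist (apply_bcontfun x s) (apply_bcontfun y s)"
          by (simp add: lift_def dist_real_def flip: right_diff_distrib abs_mult)
            (simp add: abs_mult)
        also have "L * (exp (K * \<bar>s\<bar>) * dist (apply_bcontfun x s) (apply_bcontfun y s)) \<le> L * (exp (K * \<bar>s\<bar>) * dist x y)"
          using L by (intro mult_left_mono dist_bounded) auto
        finally show "\<bar>G s (lift x s) - G s (lift y s)\<bar> \<le> L * dist x y * exp (K * \<bar>s\<bar>)" by (simp add: mult_ac)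
      qed (use K in auto)
      then have "\<bar>exp (- K * \<bar>t\<bar>) * ?D t\<bar> \<le> exp (- K * \<bar>t\<bar>) * ((L * dist x y) / K * exp (K * \<bar>t\<bar>))"
        unfolding abs_mult by (intro mult_mono) auto
      also have "\<dots> = L / K * dist x y" by (simp add: exp_minus field_simps)
      finally show "dist (apply_bcontfun (opC x) t) (apply_bcontfun (opC y) t) \<le> L / K * dist x y"
        by (simp add: opC op_def dist_real_def right_diff_distrib)
    qed
  qed
  then obtain \<psi> where "opC \<psi> = \<psi>" by blast
  then have fx: "op \<psi> = apply_bcontfun \<psi>" using opC by metis
  have eq: "lift \<psi> s = \<alpha> + antideriv0 (\<lambda>s. G s (lift \<psi> s)) s" for s
  proof -
    have "lift \<psi> s = \<alpha> + exp (K * \<bar>s\<bar>) * op \<psi> s" by (simp add: fx lift_def)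
    also have "\<dots> = \<alpha> + antideriv0 (\<lambda>s. G s (lift \<psi> s)) s"
      by (simp add: op_def exp_minus field_simps)
    finally show ?thesis .
  qed
  have "((\<lambda>s. \<alpha> + antideriv0 (\<lambda>s. G s (lift \<psi> s)) s) has_real_derivative G s (lift \<psi> s)) (at s)" for s
    using dJ[of \<psi> s] by (auto intro!: derivative_eq_intros)
  then have "(lift \<psi> has_real_derivative G s (lift \<psi> s)) (at s)" for s
    using eq by (metis (no_types, lifting) ext)
  moreover have "lift \<psi> 0 = \<alpha>" using eq[of 0] by simp
  ultimately show ?thesis using that by blast
qed

section \<open>Comparison for scalar linear equations\<close>

definition sinc :: "real \<Rightarrow> real" where
  "sinc x = (if x = 0 then 1 else sin x / x)"

lemma sin_eq_sinc: "sin x = sinc x * x"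
  by (simp add: sinc_def)

lemma continuous_on_sinc [continuous_intros]:
  assumes "continuous_on S f" shows "continuous_on S (\<lambda>x. sinc (f x))"
proof -
  have "isCont sinc x" for x
  proof (cases "x = 0")
    case True
    have "(\<lambda>h. (sin (0 + h) - sin 0) / h) \<midarrow>0\<rightarrow> cos (0::real)"
      using DERIV_sin[of "0::real"] by (simp only: DERIV_def)
    then have "(\<lambda>h. sin h / h) \<midarrow>0\<rightarrow> (1::real)" by simp
    then have "sinc \<midarrow>0\<rightarrow> 1"
      by (rule Lim_transform_eventually) (auto simp: eventually_at_filter sinc_def)
    then show ?thesis using True by (simp add: isCont_def sinc_def)
  next
    case False
    then have "isCont (\<lambda>x. sin x / x) x" by (intro continuous_intros) auto
    moreover have "\<forall>\<^sub>F y in nhds x. sinc y = sin y / y"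
      using t1_space_nhds[OF False] by eventually_elim (simp add: sinc_def)
    ultimately show ?thesis by (simp add: isCont_cong)
  qed
  then have "continuous_on UNIV sinc" by (simp add: continuous_on_eq_continuous_at)
  then show ?thesis using assms continuous_on_compose2 by (metis subset_UNIV)
qed

lemma periodic_shift_int:
  fixes f :: "real \<Rightarrow> 'a"
  assumes "\<And>s. f (s + T) = f s"
  shows "f (s + of_int n * T) = f s"
proof -
  have nat: "f (s + of_nat n * T) = f s" for n s
  proof (induction n arbitrary: s)
    case (Suc n)
    have "f (s + of_nat (Suc n) * T) = f ((s + of_nat n * T) + T)" by (simp add: algebra_simps)
    then show ?case using Suc assms by metis
  qed simp
  show ?thesis
  proof (cases n rule: int_cases2)
    case (nonneg m) then show ?thesis using nat[of s m] by simp
  next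
    case (nonpos m) then show ?thesis using nat[of "s - of_nat m * T" m] by simp
  qed
qed

lemma periodic_reduce:
  fixes f :: "real \<Rightarrow> 'a"
  assumes "\<And>s. f (s + T) = f s" "T > 0"
  obtains s' where "a \<le> s'" "s' < a + T" "f s' = f s"
proof -
  let ?n = "\<lfloor>(s - a) / T\<rfloor>"
  have "of_int ?n \<le> (s - a) / T" "(s - a) / T < of_int ?n + 1" by linarith+
  then have "of_int ?n * T \<le> s - a" "s - a < (of_int ?n + 1) * T"
    using pos_le_divide_eq[OF assms(2)] pos_divide_less_eq[OF assms(2)] by blast+
  then have *: "a \<le> s + of_int (- ?n) * T" "s + of_int (- ?n) * T < a + T" by (simp_all add: algebra_simps)
  show ?thesis by (rule that[OF * periodic_shift_int[of f T, OF assms(1)]])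
qed

lemma periodic_attains_sup:
  fixes f :: "real \<Rightarrow> real"
  assumes "continuous_on UNIV f" "\<And>s. f (s + T) = f s" "T > 0"
  obtains s where "0 \<le> s" "s < T" "\<And>x. f x \<le> f s"
proof -
  have "\<exists>s\<in>{0..T}. \<forall>x\<in>{0..T}. f x \<le> f s"
    using assms(3) by (intro continuous_attains_sup continuous_on_subset[OF assms(1)]) auto
  then obtain s where s: "\<forall>x\<in>{0..T}. f x \<le> f s" by blast
  have "f x \<le> f s" for x
    using periodic_reduce[of f T 0 x, OF assms(2,3)] s by (metis add_0 atLeastAtMost_iff less_imp_le)
  moreover obtain s' where "0 \<le> s'" "s' < 0 + T" "f s' = f s"
    using periodic_reduce[of f T 0 s, OF assms(2,3)] by metis
  ultimately show ?thesis using that[of s'] by simp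
qed

lemma periodic_attains_inf:
  fixes f :: "real \<Rightarrow> real"
  assumes "continuous_on UNIV f" "\<And>s. f (s + T) = f s" "T > 0"
  obtains s where "0 \<le> s" "s < T" "\<And>x. f s \<le> f x"
  using periodic_attains_sup[of "\<lambda>s. - f s" T] assms by (metis continuous_on_minus neg_le_iff_le)

lemma periodic_bounded:
  fixes f :: "real \<Rightarrow> real"
  assumes "continuous_on UNIV f" "\<And>s. f (s + T) = f s" "T > 0"
  obtains C where "C \<ge> 0" "\<And>s. \<bar>f s\<bar> \<le> C"
  using periodic_attains_sup[of "\<lambda>s. \<bar>f s\<bar>" T] assms
  by (metis abs_ge_zero continuous_on_rabs)

text \<open>
  After multiplication with the integrating factor, \<open>d\<close> is nondecreasing. The strict version is the
  source of every strict inequality between angles below.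
\<close>

lemma linear_ode_pos:
  fixes d h e :: "real \<Rightarrow> real"
  assumes d: "\<And>s. (d has_real_derivative h s * d s + e s) (at s)"
    and h: "continuous_on UNIV h" and e: "\<And>s. 0 \<le> s \<Longrightarrow> s \<le> t \<Longrightarrow> e s \<ge> 0"
    and d0: "d 0 \<ge> 0" and t: "t \<ge> 0"
  shows "d t \<ge> 0"
    and "d 0 > 0 \<or> t > 0 \<and> (\<exists>s. 0 \<le> s \<and> s \<le> t \<and> e s > 0) \<Longrightarrow> d t > 0"
proof -
  define k where "k s = d s * exp (- antideriv0 h s)" for s
  have k: "(k has_real_derivative e s * exp (- antideriv0 h s)) (at s)" for s
    unfolding k_def[abs_def]
    by (auto intro!: derivative_eq_intros d antideriv0_deriv[OF h] simp: algebra_simps)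
  have mono: "k a \<le> k b" if "0 \<le> a" "a \<le> b" "b \<le> t" for a b
    by (rule DERIV_nonneg_imp_nondecreasing[OF that(2)])
      (use that e in \<open>auto intro!: exI conjI k mult_nonneg_nonneg\<close>)
  have k0: "k 0 = d 0" by (simp add: k_def)
  have kt: "d t = k t * exp (antideriv0 h t)" by (simp add: k_def exp_minus)
  show "d t \<ge> 0" using mono[of 0 t] t d0 by (simp add: kt k0)
  assume "d 0 > 0 \<or> t > 0 \<and> (\<exists>s. 0 \<le> s \<and> s \<le> t \<and> e s > 0)"
  then have "k t > 0"
  proof
    assume "d 0 > 0" then show ?thesis using mono[of 0 t] t k0 by simp
  next
    assume *: "t > 0 \<and> (\<exists>s. 0 \<le> s \<and> s \<le> t \<and> e s > 0)"
    then obtain s where s: "0 \<le> s" "s \<le> t" "e s > 0" by blast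
    show ?thesis
    proof (rule ccontr)
      assume "\<not> k t > 0"
      then have const: "k x = 0" if "x \<in> {0..t}" for x
        using mono[of 0 x] mono[of x t] that k0 d0 by auto
      have "(k has_vector_derivative e s * exp (- antideriv0 h s)) (at s within {0..t})"
        using k[of s] by (simp add: has_real_derivative_iff_has_vector_derivative has_vector_derivative_at_within)
      moreover have "(k has_vector_derivative 0) (at s within {0..t})"
        by (rule has_vector_derivative_transform_within[of "\<lambda>_. 0" 0 s "{0..t}" 1]) (use s const in auto)
      ultimately have "e s * exp (- antideriv0 h s) = 0"
        using vector_derivative_unique_within_closed_interval[of 0 t s k] * s(1,2) by (metis atLeastAtMost_iff box_real(2))
      then show False using s by simp
    qed
  qed
  then show "d t > 0" by (simp add: kt)
qed

text \<open>
  The bound is the solution of the equation with the constant coefficients \<open>L\<close> and \<open>c * exp (L * s)\<close>,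
  which dominates both \<open>d\<close> and \<open>- d\<close>.
\<close>

lemma linear_ode_bound:
  fixes d h e :: "real \<Rightarrow> real"
  assumes d: "\<And>s. (d has_real_derivative h s * d s + e s) (at s)"
    and h: "continuous_on UNIV h" and hL: "\<And>s. \<bar>h s\<bar> \<le> L"
    and e: "\<And>s. \<bar>e s\<bar> \<le> c" and t: "t \<ge> 0"
  shows "\<bar>d t\<bar> \<le> (\<bar>d 0\<bar> + c * t) * exp (L * t)"
proof -
  have L: "L \<ge> 0" and c: "c \<ge> 0" using hL[of 0] e[of 0] by linarith+
  define W where "W s = (\<bar>d 0\<bar> + c * s) * exp (L * s)" for s
  have W: "(W has_real_derivative L * W s + c * exp (L * s)) (at s)" for s
    unfolding W_def[abs_def] by (auto intro!: derivative_eq_intros simp: algebra_simps)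
  have main: "W t - x t \<ge> 0" if x: "\<And>s. (x has_real_derivative h s * x s + y s) (at s)"
      and y: "\<And>s. \<bar>y s\<bar> \<le> c" and x0: "\<bar>x 0\<bar> = \<bar>d 0\<bar>" for x y
  proof (rule linear_ode_pos(1)[where d="\<lambda>s. W s - x s" and t=t and
        e="\<lambda>s. (L - h s) * W s + c * exp (L * s) - y s", OF _ h])
    show "((\<lambda>s. W s - x s) has_real_derivative
        h s * (W s - x s) + ((L - h s) * W s + c * exp (L * s) - y s)) (at s)" for s
      by (rule derivative_eq_intros W x refl)+ (simp add: algebra_simps)
    show "(L - h s) * W s + c * exp (L * s) - y s \<ge> 0" if "0 \<le> s" for s
    proof -
      have "(L - h s) * W s \<ge> 0" using hL[of s] that c by (auto simp: W_def)
      moreover have "c * 1 \<le> c * exp (L * s)" using c L that by (intro mult_left_mono) auto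
      ultimately show ?thesis using y[of s] by linarith
    qed
    show "W 0 - x 0 \<ge> 0" using x0 by (simp add: W_def)
  qed (use t in auto)
  have neg: "((\<lambda>s. - d s) has_real_derivative h s * (- d s) + (- e s)) (at s)" for s
    using DERIV_minus[OF d[of s]] by (simp add: algebra_simps)
  show ?thesis using main[OF d e] main[OF neg] e by (simp add: W_def)
qed

section \<open>Rotation in the phase plane\<close>

text \<open>
  The periodic coefficients of the system \<open>y' = A * p\<close>, \<open>p' = - B * y\<close>. In polar coordinates
  \<open>y = \<rho> * sin \<phi>\<close>, \<open>p = \<rho> * cos \<phi>\<close> the angle decouples from the radius, and \<open>spin\<close> is its
  angular velocity. Since \<open>A > 0\<close>, the multiples of \<open>\<pi>\<close> are only crossed upwards.
\<close>

locale periodic_system =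
  fixes T :: real and A B :: "real \<Rightarrow> real"
  assumes T_pos: "T > 0"
    and cont_A: "continuous_on UNIV A" and cont_B: "continuous_on UNIV B"
    and per_A: "A (s + T) = A s" and per_B: "B (s + T) = B s"
    and A_pos: "A s > 0"
begin

definition spin :: "real \<Rightarrow> real \<Rightarrow> real" where
  "spin s x = A s * (cos x)\<^sup>2 + B s * (sin x)\<^sup>2"

lemma spin_diff: "spin s x - spin s y = (B s - A s) * sin (x + y) * sinc (x - y) * (x - y)"
proof -
  have "sin (x + y) * sin (x - y) = (cos (2 * y) - cos (2 * x)) / 2"
    by (simp add: sin_times_sin)
  also have "\<dots> = (sin x)\<^sup>2 - (sin y)\<^sup>2"
    unfolding cos_double_sin by simp
  finally have "sin (x + y) * sin (x - y) = (sin x)\<^sup>2 - (sin y)\<^sup>2" .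
  moreover have "spin s x - spin s y = (B s - A s) * ((sin x)\<^sup>2 - (sin y)\<^sup>2)"
    by (simp add: spin_def cos_squared_eq algebra_simps)
  ultimately have "(B s - A s) * (sin (x + y) * sin (x - y)) = spin s x - spin s y" by simp
  then show ?thesis using sin_eq_sinc[of "x - y"] by (simp add: mult.assoc)
qed

lemma cont_spin: "continuous_on UNIV x \<Longrightarrow> continuous_on UNIV (\<lambda>s. spin s (x s))"
  unfolding spin_def by (intro continuous_intros cont_A cont_B) auto

text \<open>
  The difference of two solutions solves a scalar linear equation, because
  \<open>spin s x - spin s y\<close> is a continuous multiple of \<open>x - y\<close>.
\<close>

lemma angle_compare:
  assumes x: "\<And>s. (x has_real_derivative spin s (x s) + a s) (at s)"
    and y: "\<And>s. (y has_real_derivative spin s (y s) + b s) (at s)"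
    and ab: "\<And>s. 0 \<le> s \<Longrightarrow> s \<le> t \<Longrightarrow> b s \<le> a s" and yx: "y 0 \<le> x 0" and t: "t \<ge> 0"
  shows "y t \<le> x t"
    and "y 0 < x 0 \<or> t > 0 \<and> (\<exists>s. 0 \<le> s \<and> s \<le> t \<and> b s < a s) \<Longrightarrow> y t < x t"
proof -
  define h where "h s = (B s - A s) * sin (x s + y s) * sinc (x s - y s)" for s
  have cx: "continuous_on UNIV x" and cy: "continuous_on UNIV y"
    using x y by (meson DERIV_isCont continuous_at_imp_continuous_on)+
  have ch: "continuous_on UNIV h"
    unfolding h_def[abs_def] by (intro continuous_intros cont_A cont_B cx cy)
  have d: "((\<lambda>s. x s - y s) has_real_derivative h s * (x s - y s) + (a s - b s)) (at s)" for s
  proof -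
    have "spin s (x s) + a s - (spin s (y s) + b s) = h s * (x s - y s) + (a s - b s)"
      using spin_diff[of s "x s" "y s"] by (simp add: h_def)
    then show ?thesis using DERIV_diff[OF x y] by metis
  qed
  show "y t \<le> x t" using linear_ode_pos(1)[OF d ch] ab yx t by simp
  show "y t < x t" if "y 0 < x 0 \<or> t > 0 \<and> (\<exists>s. 0 \<le> s \<and> s \<le> t \<and> b s < a s)"
    using linear_ode_pos(2)[OF d ch] ab yx t that by simp
qed

definition angle :: "real \<Rightarrow> real \<Rightarrow> real" where
  "angle \<alpha> = (SOME \<phi>. \<phi> 0 = \<alpha> \<and> (\<forall>s. (\<phi> has_real_derivative spin s (\<phi> s)) (at s)))"

lemma coefficient_bound: obtains K where "K \<ge> 0" "\<And>s. \<bar>A s\<bar> + \<bar>B s\<bar> \<le> K"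
proof (rule periodic_bounded[of "\<lambda>s. \<bar>A s\<bar> + \<bar>B s\<bar>" T])
  show "continuous_on UNIV (\<lambda>s. \<bar>A s\<bar> + \<bar>B s\<bar>)" by (intro continuous_intros cont_A cont_B)
qed (auto simp: per_A per_B T_pos)

lemma abs_sinc_le_1: "\<bar>sinc x\<bar> \<le> 1"
  using abs_sin_x_le_abs_x[of x] by (auto simp: sinc_def abs_divide divide_le_eq_1)

lemma spin_slope_le: "\<bar>A s\<bar> + \<bar>B s\<bar> \<le> K \<Longrightarrow> \<bar>(B s - A s) * sin u * sinc v\<bar> \<le> K"
proof -
  assume "\<bar>A s\<bar> + \<bar>B s\<bar> \<le> K"
  have "\<bar>(B s - A s) * sin u * sinc v\<bar> \<le> \<bar>B s - A s\<bar> * 1 * 1"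
    unfolding abs_mult by (intro mult_mono abs_sinc_le_1 abs_sin_le_one) auto
  also have "\<dots> \<le> K" using \<open>\<bar>A s\<bar> + \<bar>B s\<bar> \<le> K\<close> abs_triangle_ineq4[of "B s" "A s"] by simp
  finally show ?thesis .
qed

lemma angle: "angle \<alpha> 0 = \<alpha>" "(angle \<alpha> has_real_derivative spin s (angle \<alpha> s)) (at s)"
proof -
  obtain K where K: "\<And>s. \<bar>A s\<bar> + \<bar>B s\<bar> \<le> K" using coefficient_bound by blast
  have "\<exists>\<phi>. \<phi> 0 = \<alpha> \<and> (\<forall>s. (\<phi> has_real_derivative spin s (\<phi> s)) (at s))"
  proof (rule bounded_lipschitz_ode_exists[of spin K K \<alpha>])
    show "\<bar>spin s x - spin s y\<bar> \<le> K * \<bar>x - y\<bar>" for s x y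
      unfolding spin_diff abs_mult[of _ "x - y"] by (intro mult_right_mono spin_slope_le K) auto
    show "\<bar>spin s x\<bar> \<le> K" for s x
    proof -
      have "\<bar>spin s x\<bar> \<le> \<bar>A s\<bar> * (cos x)\<^sup>2 + \<bar>B s\<bar> * (sin x)\<^sup>2"
        unfolding spin_def by (rule order_trans[OF abs_triangle_ineq]) (simp add: abs_mult)
      also have "\<dots> \<le> \<bar>A s\<bar> * 1 + \<bar>B s\<bar> * 1"
        by (intro add_mono mult_left_mono) (auto simp: abs_square_le_1)
      finally show ?thesis using K[of s] by simp
    qed
  qed (auto intro: cont_spin)
  from someI_ex[OF this] show "angle \<alpha> 0 = \<alpha>" "(angle \<alpha> has_real_derivative spin s (angle \<alpha> s)) (at s)"
    by (simp_all add: angle_def)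
qed

lemma cont_angle: "continuous_on UNIV (angle \<alpha>)"
  by (meson angle(2) DERIV_isCont continuous_at_imp_continuous_on)

lemma angle_unique:
  assumes "\<And>s. (x has_real_derivative spin s (x s)) (at s)" "t \<ge> 0"
  shows "x t = angle (x 0) t"
proof (rule antisym)
  have z: "(x has_real_derivative spin s (x s) + 0) (at s)"
    "(angle (x 0) has_real_derivative spin s (angle (x 0) s) + 0) (at s)" for s
    using assms angle by simp_all
  show "x t \<le> angle (x 0) t" by (rule angle_compare(1)[OF z(2) z(1)]) (use assms angle in auto)
  show "angle (x 0) t \<le> x t" by (rule angle_compare(1)[OF z(1) z(2)]) (use assms angle in auto)
qed

definition final :: "real \<Rightarrow> real" where "final \<alpha> = angle \<alpha> T"

definition turn :: "real \<Rightarrow> real" where "turn \<alpha> = final \<alpha> - \<alpha>"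

lemma final_le_supersolution:
  assumes "\<And>s. (x has_real_derivative spin s (x s) + a s) (at s)" "\<And>s. 0 \<le> s \<Longrightarrow> s \<le> T \<Longrightarrow> a s \<ge> 0" "\<alpha> \<le> x 0"
  shows "final \<alpha> \<le> x T"
    and "\<alpha> < x 0 \<or> (\<exists>s. 0 \<le> s \<and> s \<le> T \<and> 0 < a s) \<Longrightarrow> final \<alpha> < x T"
proof -
  have z: "(angle \<alpha> has_real_derivative spin s (angle \<alpha> s) + 0) (at s)" for s
    using angle by simp
  show "final \<alpha> \<le> x T"
    unfolding final_def by (rule angle_compare(1)[OF assms(1) z]) (use assms angle T_pos in auto)
  show "final \<alpha> < x T" if "\<alpha> < x 0 \<or> (\<exists>s. 0 \<le> s \<and> s \<le> T \<and> 0 < a s)"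
    unfolding final_def by (rule angle_compare(2)[OF assms(1) z]) (use assms angle T_pos that in auto)
qed

lemma subsolution_le_final:
  assumes "\<And>s. (x has_real_derivative spin s (x s) - a s) (at s)" "\<And>s. 0 \<le> s \<Longrightarrow> s \<le> T \<Longrightarrow> a s \<ge> 0" "x 0 \<le> \<alpha>"
  shows "x T \<le> final \<alpha>"
    and "x 0 < \<alpha> \<or> (\<exists>s. 0 \<le> s \<and> s \<le> T \<and> 0 < a s) \<Longrightarrow> x T < final \<alpha>"
proof -
  have z: "(angle \<alpha> has_real_derivative spin s (angle \<alpha> s) + 0) (at s)"
    "(x has_real_derivative spin s (x s) + (- a s)) (at s)" for s
    using angle assms(1)[of s] by simp_all
  show "x T \<le> final \<alpha>"
    unfolding final_def by (rule angle_compare(1)[OF z]) (use assms angle T_pos in auto)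
  show "x T < final \<alpha>" if "x 0 < \<alpha> \<or> (\<exists>s. 0 \<le> s \<and> s \<le> T \<and> 0 < a s)"
    unfolding final_def by (rule angle_compare(2)[OF z]) (use assms angle T_pos that in auto)
qed

lemma final_strict_mono: "\<alpha> < \<beta> \<Longrightarrow> final \<alpha> < final \<beta>"
  using final_le_supersolution(2)[of "angle \<beta>" "\<lambda>_. 0" \<alpha>] angle by (simp add: final_def)

lemma final_shift: "final (\<alpha> + of_int n * pi) = final \<alpha> + of_int n * pi"
proof -
  have "((\<lambda>s. angle \<alpha> s + of_int n * pi) has_real_derivative spin s (angle \<alpha> s + of_int n * pi)) (at s)" for s
  proof -
    have "spin s (angle \<alpha> s + of_int n * pi) = spin s (angle \<alpha> s)"
      by (simp add: spin_def sin_add cos_add power_mult_distrib sin_zero_iff_int2 sin_npi_int cos_npi_int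
          power2_eq_square mult.commute[of "of_int n"])
    then show ?thesis using angle by (auto intro!: derivative_eq_intros)
  qed
  from angle_unique[OF this, of T] show ?thesis using T_pos angle by (simp add: final_def)
qed

lemma turn_shift: "turn (\<alpha> + of_int n * pi) = turn \<alpha>"
  by (simp add: turn_def final_shift)

lemma turn_periodic: "turn (\<alpha> + pi) = turn \<alpha>"
  using turn_shift[of \<alpha> 1] by simp

lemma final_lipschitz: obtains C where "\<And>\<alpha> \<beta>. \<bar>final \<alpha> - final \<beta>\<bar> \<le> C * \<bar>\<alpha> - \<beta>\<bar>"
proof -
  obtain K where K: "\<And>s. \<bar>A s\<bar> + \<bar>B s\<bar> \<le> K" using coefficient_bound by blast
  have "\<bar>final \<alpha> - final \<beta>\<bar> \<le> exp (K * T) * \<bar>\<alpha> - \<beta>\<bar>" for \<alpha> \<beta>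
  proof -
    define h where "h s = (B s - A s) * sin (angle \<alpha> s + angle \<beta> s) * sinc (angle \<alpha> s - angle \<beta> s)" for s
    have "\<bar>angle \<alpha> T - angle \<beta> T\<bar> \<le> (\<bar>angle \<alpha> 0 - angle \<beta> 0\<bar> + 0 * T) * exp (K * T)"
    proof (rule linear_ode_bound[where d="\<lambda>s. angle \<alpha> s - angle \<beta> s" and h=h and e="\<lambda>_. 0"])
      show "((\<lambda>s. angle \<alpha> s - angle \<beta> s) has_real_derivative h s * (angle \<alpha> s - angle \<beta> s) + 0) (at s)" for s
        using DERIV_diff[OF angle(2)[of \<alpha> s] angle(2)[of \<beta> s]] unfolding spin_diff h_def by simp
      show "continuous_on UNIV h"
        unfolding h_def[abs_def] by (intro continuous_intros cont_A cont_B cont_angle)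
      show "\<bar>h s\<bar> \<le> K" for s unfolding h_def by (rule spin_slope_le[OF K])
    qed (use T_pos in auto)
    then show ?thesis by (simp add: angle final_def mult.commute)
  qed
  then show ?thesis by (rule that)
qed

lemma cont_turn: "continuous_on UNIV turn"
proof -
  obtain C where C: "\<And>\<alpha> \<beta>. \<bar>final \<alpha> - final \<beta>\<bar> \<le> C * \<bar>\<alpha> - \<beta>\<bar>" using final_lipschitz by blast
  have "C \<ge> 0" using C[of 1 0] by simp
  then have "C-lipschitz_on UNIV final"
    using C by (intro lipschitz_onI) (auto simp: dist_real_def)
  then have "continuous_on UNIV final" by (rule lipschitz_on_continuous_on)
  then show ?thesis unfolding turn_def[abs_def] by (intro continuous_intros) auto
qed

definition max_turn :: real where "max_turn = (SUP \<alpha>. turn \<alpha>)"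
definition min_turn :: real where "min_turn = (INF \<alpha>. turn \<alpha>)"

lemma max_turn: obtains \<alpha> where "turn \<alpha> = max_turn" "\<And>x. turn x \<le> turn \<alpha>"
proof -
  obtain \<alpha> where *: "\<And>x. turn x \<le> turn \<alpha>"
    using periodic_attains_sup[OF cont_turn turn_periodic pi_gt_zero] by metis
  have "max_turn = turn \<alpha>" unfolding max_turn_def by (rule cSup_eq_maximum) (use * in auto)
  with * show ?thesis using that by metis
qed

lemma min_turn: obtains \<alpha> where "turn \<alpha> = min_turn" "\<And>x. turn \<alpha> \<le> turn x"
proof -
  obtain \<alpha> where *: "\<And>x. turn \<alpha> \<le> turn x"
    using periodic_attains_inf[OF cont_turn turn_periodic pi_gt_zero] by metis
  have "min_turn = turn \<alpha>" unfolding min_turn_def by (rule cInf_eq_minimum) (use * in auto)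
  with * show ?thesis using that by metis
qed

lemma turn_le_max: "turn \<alpha> \<le> max_turn" and min_le_turn: "min_turn \<le> turn \<alpha>"
  using max_turn min_turn by metis+

lemma final_pos: "\<alpha> \<ge> 0 \<Longrightarrow> final \<alpha> > 0"
proof -
  assume "\<alpha> \<ge> 0"
  moreover have "((\<lambda>_. 0) has_real_derivative spin s 0 - A s) (at s)" for s
    by (simp add: spin_def)
  moreover have "\<exists>s. 0 \<le> s \<and> s \<le> T \<and> 0 < A s" using A_pos[of 0] T_pos by (intro exI[of _ 0]) simp
  ultimately show ?thesis
    using subsolution_le_final(2)[of "\<lambda>_. 0" A \<alpha>] less_imp_le[OF A_pos] by blast
qed

lemma max_turn_pos: "max_turn > 0"
  using final_pos[of 0] turn_le_max[of 0] by (simp add: turn_def)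

lemma min_turn_gt: "min_turn > - pi"
proof -
  obtain \<alpha> where \<alpha>: "turn \<alpha> = min_turn" using min_turn by metis
  obtain \<beta> where "0 \<le> \<beta>" "\<beta> < 0 + pi" "turn \<beta> = turn \<alpha>"
    using periodic_reduce[of turn pi, OF turn_periodic pi_gt_zero, of 0 \<alpha>] by metis
  then show ?thesis using final_pos[of \<beta>] \<alpha> by (simp add: turn_def)
qed

text \<open>
  The final angle is strictly increasing in the initial one and commutes with the shift by \<open>\<pi>\<close>.
\<close>

lemma max_turn_minus_min_turn: "max_turn - min_turn < pi"
proof -
  obtain \<alpha> where \<alpha>: "turn \<alpha> = max_turn" using max_turn by metis
  obtain \<beta> where \<beta>: "turn \<beta> = min_turn" using min_turn by metis
  obtain \<gamma> where \<gamma>: "\<beta> \<le> \<gamma>" "\<gamma> < \<beta> + pi" "turn \<gamma> = turn \<alpha>"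
    using periodic_reduce[of turn pi, OF turn_periodic pi_gt_zero, of \<beta> \<alpha>] by metis
  have "final \<gamma> < final (\<beta> + pi)" by (rule final_strict_mono[OF \<gamma>(2)])
  then show ?thesis using \<alpha> \<beta> \<gamma> turn_periodic[of \<beta>] by (simp add: turn_def)
qed

text \<open>
  For \<open>B \<le> 0\<close> the angle \<open>\<pi> / 2\<close> cannot be crossed upwards.
\<close>

lemma turns_nonpositive_potential:
  assumes "\<And>s. 0 \<le> s \<Longrightarrow> s \<le> T \<Longrightarrow> B s \<le> 0"
  shows "max_turn < pi" and "min_turn \<le> 0"
    and "\<exists>s. 0 \<le> s \<and> s \<le> T \<and> B s < 0 \<Longrightarrow> min_turn < 0"
proof -
  have half: "((\<lambda>_. pi / 2) has_real_derivative spin s (pi / 2) + - B s) (at s)" for s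
    by (simp add: spin_def)
  have f: "final x \<le> pi / 2" if "x \<le> pi / 2" for x
    by (rule final_le_supersolution(1)[OF half]) (use assms that in auto)
  show "min_turn \<le> 0" using f[of "pi / 2"] min_le_turn[of "pi / 2"] by (simp add: turn_def)
  show "min_turn < 0" if "\<exists>s. 0 \<le> s \<and> s \<le> T \<and> B s < 0"
  proof -
    have "final (pi / 2) < pi / 2"
      by (rule final_le_supersolution(2)[OF half]) (use assms that in auto)
    then show ?thesis using min_le_turn[of "pi / 2"] by (simp add: turn_def)
  qed
  obtain \<alpha> where \<alpha>: "turn \<alpha> = max_turn" using max_turn by metis
  obtain \<beta> where b: "- (pi / 2) \<le> \<beta>" "\<beta> < - (pi / 2) + pi" "turn \<beta> = turn \<alpha>"
    using periodic_reduce[of turn pi, OF turn_periodic pi_gt_zero, of "- (pi/2)" \<alpha>] by metis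
  have "final \<beta> < final (pi / 2)" by (rule final_strict_mono) (use b in simp)
  then show "max_turn < pi" using f[of "pi / 2"] b \<alpha> by (simp add: turn_def)
qed

text \<open>
  A moving angle only passes through the multiples of \<open>\<pi>\<close>, where it turns at the rate \<open>A > 0\<close>;
  a perturbation of the form \<open>c * (sin x)\<^sup>2\<close> is therefore felt as soon as \<open>c\<close> is.
\<close>

lemma perturbation_felt:
  assumes c: "continuous_on UNIV c" "\<And>s. c (s + T) = c s" "c s0 > 0"
    and x: "\<And>s. (x has_real_derivative x' s) (at s)" "\<And>s. sin (x s) = 0 \<Longrightarrow> x' s > 0"
  obtains s where "0 \<le> s" "s \<le> T" "c s * (sin (x s))\<^sup>2 > 0"
proof -
  obtain s1 where s1: "0 \<le> s1" "s1 < 0 + T" "c s1 = c s0"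
    using periodic_reduce[of c T 0 s0, OF c(2) T_pos] by metis
  have "open {s. c s > 0}" using open_Collect_less[OF continuous_on_const c(1)] .
  then have "\<exists>e>0. \<forall>y. dist y s1 < e \<longrightarrow> y \<in> {s. c s > 0}"
    using s1 c(3) by (simp add: open_dist)
  then obtain e where e: "e > 0" "\<And>s. \<bar>s - s1\<bar> < e \<Longrightarrow> c s > 0"
    by (auto simp: dist_real_def)
  define b where "b = min T (s1 + e)"
  define m where "m = (s1 + b) / 2"
  have b: "s1 < b" "b \<le> T" "b \<le> s1 + e" using s1 e by (auto simp: b_def)
  then have m: "s1 < m" "m < b" by (auto simp: m_def)
  note result = that
  show ?thesis
  proof (rule ccontr)
    assume no: "\<not> ?thesis"
    have zero: "sin (x s) = 0" if "s \<in> {s1<..<b}" for s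
    proof (rule ccontr)
      assume "sin (x s) \<noteq> 0"
      moreover have "c s > 0" using that b by (intro e(2)) auto
      ultimately have "c s * (sin (x s))\<^sup>2 > 0" by simp
      then show False using no result[of s] s1 b \<open>s \<in> _\<close> by auto
    qed
    have "((\<lambda>s. sin (x s)) has_real_derivative cos (x m) * x' m) (at m)"
      by (auto intro!: derivative_eq_intros x)
    moreover have "((\<lambda>s. sin (x s)) has_real_derivative 0) (at m)"
      by (rule has_field_derivative_transform_within_open[where f="\<lambda>_. 0" and S="{s1<..<b}"]) (use m zero in auto)
    ultimately have "cos (x m) * x' m = 0" by (rule DERIV_unique)
    moreover have "sin (x m) = 0" using m by (intro zero) auto
    ultimately show False using x(2)[of m] sin_cos_squared_add[of "x m"] by auto
  qed
qed

text \<open>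
  Rotation with the velocity \<open>A\<close> solves the equation when \<open>B = A\<close>; in general its defect has the sign
  of \<open>B - A\<close>, so that it is the comparison function for bounds on the turn.
\<close>

lemma uniform_rotation:
  "((\<lambda>s. \<alpha> + antideriv0 A s) has_real_derivative spin s (\<alpha> + antideriv0 A s)
      - (B s - A s) * (sin (\<alpha> + antideriv0 A s))\<^sup>2) (at s)"
proof -
  have "((\<lambda>s. \<alpha> + antideriv0 A s) has_real_derivative A s) (at s)"
    by (auto intro!: derivative_eq_intros antideriv0_deriv cont_A)
  then show ?thesis by (simp add: spin_def cos_squared_eq algebra_simps)
qed

lemma antideriv0_period: "antideriv0 A T = integral {0..T} A"
  using T_pos by (simp add: antideriv0_def)

lemma integral_le_turn:
  assumes "\<And>s. A s \<le> B s"
  shows "integral {0..T} A \<le> min_turn"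
    and "\<exists>s. A s < B s \<Longrightarrow> integral {0..T} A < min_turn"
proof -
  obtain \<alpha> where \<alpha>: "turn \<alpha> = min_turn" using min_turn by metis
  show "integral {0..T} A \<le> min_turn"
    using subsolution_le_final(1)[OF uniform_rotation, of \<alpha> \<alpha>] assms \<alpha>
    by (simp add: turn_def antideriv0_period)
  assume "\<exists>s. A s < B s"
  then obtain s0 where "B s0 - A s0 > 0" by auto
  then obtain s where "0 \<le> s" "s \<le> T" "(B s - A s) * (sin (\<alpha> + antideriv0 A s))\<^sup>2 > 0"
    by (rule perturbation_felt[of "\<lambda>s. B s - A s" s0 "\<lambda>s. \<alpha> + antideriv0 A s" A, rotated 2])
      (auto intro!: continuous_intros cont_A cont_B derivative_eq_intros antideriv0_deriv simp: per_A per_B A_pos)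
  then have "\<alpha> + antideriv0 A T < final \<alpha>"
    by (intro subsolution_le_final(2)[OF uniform_rotation]) (use assms in auto)
  then show "integral {0..T} A < min_turn"
    using \<alpha> by (simp add: turn_def antideriv0_period)
qed

lemma turn_le_integral:
  assumes "\<And>s. B s \<le> A s"
  shows "max_turn \<le> integral {0..T} A"
proof -
  obtain \<alpha> where \<alpha>: "turn \<alpha> = max_turn" using max_turn by metis
  have *: "((\<lambda>s. \<alpha> + antideriv0 A s) has_real_derivative spin s (\<alpha> + antideriv0 A s)
      + (A s - B s) * (sin (\<alpha> + antideriv0 A s))\<^sup>2) (at s)" for s
    using uniform_rotation[of \<alpha> s] by (simp add: algebra_simps)
  show ?thesis
    using final_le_supersolution(1)[OF *, of \<alpha>] assms \<alpha>
    by (simp add: turn_def antideriv0_period)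
qed

lemma min_turn_pos:
  assumes "\<And>s. B s \<ge> 0" "B s0 > 0"
  shows "min_turn > 0"
proof -
  obtain \<alpha> where \<alpha>: "turn \<alpha> = min_turn" using min_turn by metis
  obtain s1 where s1: "0 \<le> s1" "s1 < 0 + T" "B s1 = B s0"
    using periodic_reduce[of B T 0 s0, OF per_B T_pos] by metis
  have "spin s \<alpha> \<ge> 0" for s using assms(1)[of s] A_pos[of s] by (simp add: spin_def)
  moreover have "spin s1 \<alpha> > 0"
  proof (cases "sin \<alpha> = 0")
    case True
    then have "(cos \<alpha>)\<^sup>2 = 1" using sin_cos_squared_add[of \<alpha>] by simp
    then show ?thesis using True A_pos by (simp add: spin_def)
  next
    case False
    then have "B s1 * (sin \<alpha>)\<^sup>2 > 0" using s1 assms by simp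
    then show ?thesis using A_pos[of s1] by (simp add: spin_def add_nonneg_pos)
  qed
  moreover have "((\<lambda>_. \<alpha>) has_real_derivative spin s \<alpha> - spin s \<alpha>) (at s)" for s by simp
  ultimately have "\<alpha> < final \<alpha>"
    by (intro subsolution_le_final(2)[of "\<lambda>_. \<alpha>" "\<lambda>s. spin s \<alpha>"]) (use s1 in \<open>auto intro!: exI[of _ s1]\<close>)
  then show ?thesis using \<alpha> by (simp add: turn_def)
qed

end

section \<open>Periodic solutions of the linear system\<close>

definition solves :: "(real \<Rightarrow> real) \<Rightarrow> (real \<Rightarrow> real) \<Rightarrow> (real \<Rightarrow> real) \<Rightarrow> (real \<Rightarrow> real) \<Rightarrow> bool" where
  "solves A B y p \<longleftrightarrow> (\<forall>s. (y has_real_derivative A s * p s) (at s) \<and> (p has_real_derivative - B s * y s) (at s))"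

definition periodic_solutions :: "real \<Rightarrow> (real \<Rightarrow> real) \<Rightarrow> (real \<Rightarrow> real) \<Rightarrow> (real \<Rightarrow> real) set" where
  "periodic_solutions T A B = {y. \<exists>p. solves A B y p \<and> (\<forall>s. y (s + T) = y s) \<and> (\<forall>s. p (s + T) = p s)}"

lemma solves_linear:
  assumes "solves A B y p" "solves A B u q"
  shows "solves A B (\<lambda>s. a * y s + b * u s) (\<lambda>s. a * p s + b * q s)"
proof -
  have d: "(y has_real_derivative A s * p s) (at s)" "(p has_real_derivative - B s * y s) (at s)"
    "(u has_real_derivative A s * q s) (at s)" "(q has_real_derivative - B s * u s) (at s)" for s
    using assms by (auto simp: solves_def)
  show ?thesis
    unfolding solves_def
    using DERIV_add[OF DERIV_cmult[OF d(1), of a] DERIV_cmult[OF d(3), of b]]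
      DERIV_add[OF DERIV_cmult[OF d(2), of a] DERIV_cmult[OF d(4), of b]]
    by (simp add: algebra_simps)
qed

lemma wronskian_const:
  assumes "solves A B y p" "solves A B u q"
  shows "y s * q s - u s * p s = y 0 * q 0 - u 0 * p 0"
proof -
  have "((\<lambda>s. y s * q s - u s * p s) has_real_derivative 0) (at s)" for s
    using assms unfolding solves_def by (auto intro!: derivative_eq_intros)
  then show ?thesis using DERIV_isconst_all by blast
qed

definition whole_turns :: "real \<Rightarrow> bool" where
  "whole_turns x \<longleftrightarrow> (\<exists>n::int. x = 2 * pi * of_int n)"

context periodic_system begin

text \<open>
  The radius in polar coordinates; its logarithmic derivative depends on the angle only.
\<close>

definition amp :: "real \<Rightarrow> real \<Rightarrow> real" where
  "amp \<alpha> s = exp (antideriv0 (\<lambda>s. (A s - B s) * sin (angle \<alpha> s) * cos (angle \<alpha> s)) s)"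

definition sol_y :: "real \<Rightarrow> real \<Rightarrow> real" where "sol_y \<alpha> s = amp \<alpha> s * sin (angle \<alpha> s)"
definition sol_p :: "real \<Rightarrow> real \<Rightarrow> real" where "sol_p \<alpha> s = amp \<alpha> s * cos (angle \<alpha> s)"

lemma sol_0 [simp]: "sol_y \<alpha> 0 = sin \<alpha>" "sol_p \<alpha> 0 = cos \<alpha>"
  by (simp_all add: sol_y_def sol_p_def amp_def angle(1))

lemma amp_pos: "amp \<alpha> s > 0"
  by (simp add: amp_def)

lemma amp_deriv:
  "(amp \<alpha> has_real_derivative amp \<alpha> s * ((A s - B s) * sin (angle \<alpha> s) * cos (angle \<alpha> s))) (at s)"
proof -
  have "continuous_on UNIV (\<lambda>s. (A s - B s) * sin (angle \<alpha> s) * cos (angle \<alpha> s))"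
    by (intro continuous_intros cont_A cont_B cont_angle)
  from antideriv0_deriv[OF this] show ?thesis
    unfolding amp_def[abs_def] by (auto intro!: derivative_eq_intros)
qed

lemma sol: "solves A B (sol_y \<alpha>) (sol_p \<alpha>)"
proof -
  have "(sol_y \<alpha> has_real_derivative A s * sol_p \<alpha> s) (at s)" for s
  proof -
    let ?x = "angle \<alpha> s"
    have "amp \<alpha> s * ((A s - B s) * sin ?x * cos ?x) * sin ?x + cos ?x * spin s ?x * amp \<alpha> s
       = A s * (amp \<alpha> s * cos ?x) * ((sin ?x)\<^sup>2 + (cos ?x)\<^sup>2)"
      by (simp only: spin_def power2_eq_square) algebra
    then have "amp \<alpha> s * ((A s - B s) * sin ?x * cos ?x) * sin ?x + cos ?x * spin s ?x * amp \<alpha> s = A s * sol_p \<alpha> s"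
      by (simp add: sol_p_def)
    then show ?thesis
      unfolding sol_y_def[abs_def]
      using DERIV_mult[OF amp_deriv[of \<alpha> s] DERIV_chain2[OF DERIV_sin angle(2)[of \<alpha> s]]] by simp
  qed
  moreover have "(sol_p \<alpha> has_real_derivative - B s * sol_y \<alpha> s) (at s)" for s
  proof -
    let ?x = "angle \<alpha> s"
    have "amp \<alpha> s * ((A s - B s) * sin ?x * cos ?x) * cos ?x + - sin ?x * spin s ?x * amp \<alpha> s
       = - B s * (amp \<alpha> s * sin ?x) * ((sin ?x)\<^sup>2 + (cos ?x)\<^sup>2)"
      by (simp only: spin_def power2_eq_square) algebra
    then have "amp \<alpha> s * ((A s - B s) * sin ?x * cos ?x) * cos ?x + - sin ?x * spin s ?x * amp \<alpha> s = - B s * sol_y \<alpha> s"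
      by (simp add: sol_y_def)
    then show ?thesis
      unfolding sol_p_def[abs_def]
      using DERIV_mult[OF amp_deriv[of \<alpha> s] DERIV_chain2[OF DERIV_cos angle(2)[of \<alpha> s]]] by simp
  qed
  ultimately show ?thesis by (simp add: solves_def)
qed

lemma solves_unique:
  assumes "solves A B y p" "solves A B u q" "y 0 = u 0" "p 0 = q 0"
  shows "y = u" "p = q"
proof -
  have d: "solves A B (\<lambda>s. 1 * y s + (-1) * u s) (\<lambda>s. 1 * p s + (-1) * q s)"
    by (rule solves_linear[OF assms(1,2)])
  have w: "sol_y 0 s * sol_p (pi / 2) s - sol_y (pi / 2) s * sol_p 0 s = - 1" for s
    using wronskian_const[OF sol sol, of 0 s "pi / 2"] by simp
  have "y s = u s \<and> p s = q s" for s
  proof -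
    define a b where "a = y s - u s" and "b = p s - q s"
    have "a * sol_p 0 s = sol_y 0 s * b" "a * sol_p (pi / 2) s = sol_y (pi / 2) s * b"
      using wronskian_const[OF d sol, of s 0] wronskian_const[OF d sol, of s "pi / 2"] assms(3,4)
      by (simp_all add: a_def b_def)
    then have "a * (sol_y 0 s * sol_p (pi / 2) s - sol_y (pi / 2) s * sol_p 0 s) = 0"
      "b * (sol_y 0 s * sol_p (pi / 2) s - sol_y (pi / 2) s * sol_p 0 s) = 0"
      by algebra+
    then show ?thesis unfolding w by (simp add: a_def b_def)
  qed
  then show "y = u" "p = q" by auto
qed

lemma solves_shift:
  assumes "solves A B y p" shows "solves A B (\<lambda>s. y (s + T)) (\<lambda>s. p (s + T))"
  unfolding solves_def
  using assms[unfolded solves_def, rule_format, of "_ + T"]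
  by (simp add: per_A per_B DERIV_shift)

lemma periodic_solutions_iff:
  "y \<in> periodic_solutions T A B \<longleftrightarrow> (\<exists>p. solves A B y p \<and> y T = y 0 \<and> p T = p 0)"
proof
  assume "y \<in> periodic_solutions T A B"
  then show "\<exists>p. solves A B y p \<and> y T = y 0 \<and> p T = p 0"
    unfolding periodic_solutions_def by clarsimp (metis add_0)
next
  assume "\<exists>p. solves A B y p \<and> y T = y 0 \<and> p T = p 0"
  then obtain p where p: "solves A B y p" "y T = y 0" "p T = p 0" by blast
  have "(\<lambda>s. y (s + T)) = y" "(\<lambda>s. p (s + T)) = p"
    using solves_unique[OF solves_shift[OF p(1)] p(1)] p by simp_all
  then show "y \<in> periodic_solutions T A B"
    unfolding periodic_solutions_def using p(1) by (auto dest: fun_cong)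
qed

lemma sol_rotate:
  "sol_y (\<alpha> + t) s = cos t * sol_y \<alpha> s + sin t * sol_y (\<alpha> + pi / 2) s"
  "sol_p (\<alpha> + t) s = cos t * sol_p \<alpha> s + sin t * sol_p (\<alpha> + pi / 2) s"
proof -
  note eq = solves_unique[OF sol solves_linear[OF sol sol], of "\<alpha> + t" "cos t" \<alpha> "sin t" "\<alpha> + pi / 2"]
  show "sol_y (\<alpha> + t) s = cos t * sol_y \<alpha> s + sin t * sol_y (\<alpha> + pi / 2) s"
    "sol_p (\<alpha> + t) s = cos t * sol_p \<alpha> s + sin t * sol_p (\<alpha> + pi / 2) s"
    using eq by (simp_all add: sin_add cos_add fun_eq_iff algebra_simps)
qed

lemma solves_polar:
  assumes "solves A B y p"
  obtains c \<alpha> where "y = (\<lambda>s. c * sol_y \<alpha> s)" "p = (\<lambda>s. c * sol_p \<alpha> s)" "c \<ge> 0"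
proof -
  obtain c \<alpha> where c: "c \<ge> 0" "y 0 = c * sin \<alpha>" "p 0 = c * cos \<alpha>"
  proof -
    let ?c = "sqrt ((p 0)\<^sup>2 + (y 0)\<^sup>2)"
    show ?thesis
    proof (cases "?c = 0")
      case True then show ?thesis using that[of 0 0] by (simp add: sum_power2_eq_zero_iff)
    next
      case False
      have "(p 0 / ?c)\<^sup>2 + (y 0 / ?c)\<^sup>2 = 1"
        using False by (simp add: power_divide flip: add_divide_distrib)
      then obtain t where "p 0 / ?c = cos t" "y 0 / ?c = sin t" using sincos_total_2pi by metis
      then show ?thesis using that[of ?c t] False by (simp add: field_simps)
    qed
  qed
  have "solves A B (\<lambda>s. c * sol_y \<alpha> s + 0 * sol_y \<alpha> s) (\<lambda>s. c * sol_p \<alpha> s + 0 * sol_p \<alpha> s)"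
    by (rule solves_linear[OF sol sol])
  from solves_unique[OF assms this] show ?thesis using that[of c \<alpha>] c by simp
qed

lemma amp_sin_turn: "amp \<alpha> T * sin (turn \<alpha>) = sol_y \<alpha> T * cos \<alpha> - sol_p \<alpha> T * sin \<alpha>"
  by (simp add: turn_def final_def sol_y_def sol_p_def sin_diff algebra_simps)

text \<open>
  Let the direction \<open>\<alpha>\<close> be fixed by the monodromy map, stretched by the factor \<open>amp \<alpha> T\<close>.
  Since the map has determinant one, the turn of the direction at angle \<open>t\<close> from it is governed by
  a quadratic form in \<open>(cos t, sin t)\<close> with the entries below.
\<close>

lemma turn_near_fixed_direction:
  assumes "turn \<alpha> = 2 * pi * of_int n"
  obtains \<beta> where "\<And>t. amp (\<alpha> + t) T * sin (turn (\<alpha> + t)) =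
      sin t * ((1 / amp \<alpha> T - amp \<alpha> T) * cos t - \<beta> * sin t)"
    and "sol_y (\<alpha> + pi / 2) T = \<beta> * sin \<alpha> + cos \<alpha> / amp \<alpha> T"
    and "sol_p (\<alpha> + pi / 2) T = \<beta> * cos \<alpha> - sin \<alpha> / amp \<alpha> T"
proof -
  \<comment> \<open>The second column of the monodromy matrix in the frame of \<open>\<alpha>\<close> and the direction orthogonal to it
    has the entries \<open>\<beta>\<close> and \<open>1 / k\<close>.\<close>
  define k where "k = amp \<alpha> T"
  define Y where "Y = sol_y (\<alpha> + pi / 2) T"
  define P where "P = sol_p (\<alpha> + pi / 2) T"
  define \<beta> where "\<beta> = Y * sin \<alpha> + P * cos \<alpha>"
  have k: "k > 0" by (simp add: k_def amp_pos)
  have f: "angle \<alpha> T = \<alpha> + 2 * pi * of_int n" using assms by (simp add: turn_def final_def)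
  have sc: "sin (\<alpha> + 2 * pi * of_int n) = sin \<alpha>" "cos (\<alpha> + 2 * pi * of_int n) = cos \<alpha>"
    by (simp_all add: sin_add cos_add)
  have y: "sol_y \<alpha> T = k * sin \<alpha>" and p: "sol_p \<alpha> T = k * cos \<alpha>"
    by (simp_all add: sol_y_def sol_p_def k_def f sc)
  have "k * sin \<alpha> * P - Y * (k * cos \<alpha>) = - (sin \<alpha> * sin \<alpha>) - cos \<alpha> * cos \<alpha>"
    using wronskian_const[OF sol sol, of \<alpha> T "\<alpha> + pi / 2"] by (simp add: y p Y_def P_def sin_add cos_add)
  also have "\<dots> = - 1" using sin_cos_squared_add3[of \<alpha>] by linarith
  finally have "k * (Y * cos \<alpha> - P * sin \<alpha>) = 1" by (simp add: algebra_simps)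
  then have \<delta>: "Y * cos \<alpha> - P * sin \<alpha> = 1 / k" using k by (simp add: field_simps)
  have eqs: "Y = \<beta> * sin \<alpha> + (Y * cos \<alpha> - P * sin \<alpha>) * cos \<alpha>" "P = \<beta> * cos \<alpha> - (Y * cos \<alpha> - P * sin \<alpha>) * sin \<alpha>"
  proof -
    have "\<beta> * sin \<alpha> + (Y * cos \<alpha> - P * sin \<alpha>) * cos \<alpha> = Y * (sin \<alpha> * sin \<alpha> + cos \<alpha> * cos \<alpha>)"
      by (simp only: \<beta>_def) algebra
    then show "Y = \<beta> * sin \<alpha> + (Y * cos \<alpha> - P * sin \<alpha>) * cos \<alpha>" by (simp add: sin_cos_squared_add3 add.commute)
    have "\<beta> * cos \<alpha> - (Y * cos \<alpha> - P * sin \<alpha>) * sin \<alpha> = P * (sin \<alpha> * sin \<alpha> + cos \<alpha> * cos \<alpha>)"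
      by (simp only: \<beta>_def) algebra
    then show "P = \<beta> * cos \<alpha> - (Y * cos \<alpha> - P * sin \<alpha>) * sin \<alpha>" by (simp add: sin_cos_squared_add3 add.commute)
  qed
  show ?thesis
  proof (rule that[of \<beta>])
    fix t
    have t1: "sin \<alpha> * cos (\<alpha> + t) - cos \<alpha> * sin (\<alpha> + t) = - sin t"
      using sin_diff[of \<alpha> "\<alpha> + t"] by simp
    have t2: "cos \<alpha> * cos (\<alpha> + t) + sin \<alpha> * sin (\<alpha> + t) = cos t"
      using cos_diff[of \<alpha> "\<alpha> + t"] by simp
    have "amp (\<alpha> + t) T * sin (turn (\<alpha> + t)) =
        (cos t * (k * sin \<alpha>) + sin t * Y) * cos (\<alpha> + t) - (cos t * (k * cos \<alpha>) + sin t * P) * sin (\<alpha> + t)"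
      unfolding amp_sin_turn sol_rotate[of \<alpha> t] y p Y_def P_def ..
    also have "\<dots> = (cos t * (k * sin \<alpha>) + sin t * (\<beta> * sin \<alpha> + 1 / k * cos \<alpha>)) * cos (\<alpha> + t)
        - (cos t * (k * cos \<alpha>) + sin t * (\<beta> * cos \<alpha> - 1 / k * sin \<alpha>)) * sin (\<alpha> + t)"
      using eqs unfolding \<delta> by simp
    also have "\<dots> = (k * cos t + \<beta> * sin t) * (sin \<alpha> * cos (\<alpha> + t) - cos \<alpha> * sin (\<alpha> + t))
        + sin t * (1 / k) * (cos \<alpha> * cos (\<alpha> + t) + sin \<alpha> * sin (\<alpha> + t))"
      by (simp add: algebra_simps)
    also have "\<dots> = sin t * ((1 / k - k) * cos t - \<beta> * sin t)"
      unfolding t1 t2 by (simp add: algebra_simps)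
    finally show "amp (\<alpha> + t) T * sin (turn (\<alpha> + t)) = sin t * ((1 / amp \<alpha> T - amp \<alpha> T) * cos t - \<beta> * sin t)"
      by (simp add: k_def)
  qed (use eqs \<delta> in \<open>simp_all add: Y_def P_def k_def\<close>)
qed

text \<open>
  Where the turn is extremal, the quadratic form must not change sign, so that its mixed term
  vanishes and the stretching factor is one.
\<close>

lemma extremal_turn_periodic:
  assumes n: "turn \<alpha> = 2 * pi * of_int n" and \<epsilon>: "\<epsilon> = 1 \<or> \<epsilon> = -1"
    and ext: "\<And>x. \<epsilon> * (turn x - turn \<alpha>) \<le> 0"
  shows "sol_y \<alpha> \<in> periodic_solutions T A B"
proof -
  obtain \<beta> where \<beta>: "\<And>t. amp (\<alpha> + t) T * sin (turn (\<alpha> + t)) =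
      sin t * ((1 / amp \<alpha> T - amp \<alpha> T) * cos t - \<beta> * sin t)"
    using turn_near_fixed_direction[OF n] by metis
  define m where "m t = (1 / amp \<alpha> T - amp \<alpha> T) * cos t - \<beta> * sin t" for t
  define c where "c = \<epsilon> * m 0"
  have "c = 0"
  proof (rule ccontr)
    assume "c \<noteq> 0"
    have "continuous (at 0) (\<lambda>t. \<epsilon> * m t)" unfolding m_def by (intro continuous_intros)
    then obtain d1 where d1: "d1 > 0" "\<And>t. \<bar>t\<bar> < d1 \<Longrightarrow> \<bar>\<epsilon> * m t - c\<bar> < \<bar>c\<bar>"
      using \<open>c \<noteq> 0\<close> unfolding continuous_at_eps_delta c_def dist_real_def
      by (metis diff_zero zero_less_abs_iff)
    have "continuous_on UNIV (\<lambda>t. turn (\<alpha> + t))"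
      by (rule continuous_on_compose2[OF cont_turn]) (auto intro!: continuous_intros)
    then have "continuous (at 0) (\<lambda>t. turn (\<alpha> + t))" by (simp add: continuous_on_eq_continuous_at)
    then obtain d2 where d2: "d2 > 0" "\<And>t. \<bar>t\<bar> < d2 \<Longrightarrow> \<bar>turn (\<alpha> + t) - turn \<alpha>\<bar> < pi"
      unfolding continuous_at_eps_delta dist_real_def by (metis add.right_neutral diff_zero pi_gt_zero)
    \<comment> \<open>A small angle on the side where the mixed term would push the turn beyond its extremum.\<close>
    define t where "t = sgn c * (min 1 (min d1 d2) / 2)"
    have t: "\<bar>t\<bar> < d1" "\<bar>t\<bar> < d2" "\<bar>t\<bar> \<le> 1 / 2" "sgn t = sgn c"
      using \<open>c \<noteq> 0\<close> d1(1) d2(1) by (auto simp: t_def abs_mult sgn_mult)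
    have "sgn (\<epsilon> * m t) = sgn c"
      using d1(2)[OF t(1)] \<open>c \<noteq> 0\<close> by (auto simp: sgn_if split: if_splits)
    moreover have "sgn (sin t) = sgn c"
      using t(3,4) \<open>c \<noteq> 0\<close> pi_gt3 sin_gt_zero[of t] sin_gt_zero[of "- t"] by (auto simp: sgn_if split: if_splits)
    ultimately have "sgn (\<epsilon> * m t * sin t) = 1"
      using \<open>c \<noteq> 0\<close> by (simp only: sgn_mult[of "\<epsilon> * m t" "sin t"]) simp
    then have "\<epsilon> * m t * sin t > 0" by (simp only: sgn_1_pos)
    then have pos: "\<epsilon> * (amp (\<alpha> + t) T * sin (turn (\<alpha> + t))) > 0"
      by (simp add: \<beta> m_def mult_ac)
    define \<delta> where "\<delta> = turn (\<alpha> + t) - turn \<alpha>"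
    have \<delta>: "\<epsilon> * \<delta> \<le> 0" "\<bar>\<delta>\<bar> < pi" using ext[of "\<alpha> + t"] d2(2)[OF t(2)] by (auto simp: \<delta>_def)
    have "sin (turn (\<alpha> + t)) = sin \<delta>"
      using n by (simp add: \<delta>_def sin_diff)
    moreover have "\<epsilon> * sin \<delta> \<le> 0"
      using \<delta> \<epsilon> sin_ge_zero[of \<delta>] sin_ge_zero[of "- \<delta>"] by auto
    ultimately have "amp (\<alpha> + t) T * (\<epsilon> * sin (turn (\<alpha> + t))) \<le> 0"
      using amp_pos[of "\<alpha> + t" T] by (simp add: mult_le_0_iff)
    then show False using pos by (simp add: mult_ac)
  qed
  then have "m 0 = 0" using \<epsilon> by (auto simp: c_def)
  then have "1 / amp \<alpha> T = amp \<alpha> T" by (simp add: m_def)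
  then have "(amp \<alpha> T)\<^sup>2 = 1" using amp_pos[of \<alpha> T] by (simp add: field_simps power2_eq_square)
  then have k: "amp \<alpha> T = 1" using amp_pos[of \<alpha> T] by (simp add: power2_eq_1_iff)
  have f: "angle \<alpha> T = \<alpha> + 2 * pi * of_int n" using n by (simp add: turn_def final_def)
  have yp: "sol_y \<alpha> T = sin \<alpha>" "sol_p \<alpha> T = cos \<alpha>"
    by (simp_all add: sol_y_def sol_p_def k f sin_add cos_add)
  show ?thesis
    unfolding periodic_solutions_iff using sol[of \<alpha>] yp by (intro exI[of _ "sol_p \<alpha>"]) simp
qed

text \<open>
  Conversely, a periodic solution makes its stretching factor one and leaves of the quadratic form
  only the square \<open>- \<beta> * (sin t)\<^sup>2\<close>, whose sign is that of \<open>- \<beta>\<close>; by the intermediate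
  value theorem the turn then stays on one side of its value there.
\<close>

lemma turn_le_if_sin_le:
  assumes n: "turn \<alpha> = 2 * pi * of_int n" and \<epsilon>: "\<epsilon> = 1 \<or> \<epsilon> = -1"
    and s: "\<And>x. \<epsilon> * sin (turn x) \<le> 0"
  shows "\<epsilon> * (turn x - turn \<alpha>) \<le> 0"
proof (rule ccontr)
  assume c: "\<not> ?thesis"
  define v where "v = min (\<epsilon> * (turn x - turn \<alpha>)) (pi / 2)"
  have v: "0 < v" "v \<le> \<epsilon> * (turn x - turn \<alpha>)" "v \<le> pi / 2" using c by (auto simp: v_def)
  have cont: "continuous_on UNIV (\<lambda>x. \<epsilon> * (turn x - turn \<alpha>))"
    by (intro continuous_intros cont_turn)
  have "connected (range (\<lambda>x. \<epsilon> * (turn x - turn \<alpha>)))"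
    by (rule connected_continuous_image[OF cont connected_UNIV])
  then have "v \<in> range (\<lambda>x. \<epsilon> * (turn x - turn \<alpha>))"
  proof (rule connectedD_interval)
    show "0 \<in> range (\<lambda>x. \<epsilon> * (turn x - turn \<alpha>))" by (rule range_eqI[of _ _ \<alpha>]) simp
  qed (use v in auto)
  then obtain w where "v = \<epsilon> * (turn w - turn \<alpha>)" by blast
  then have "turn w = 2 * pi * of_int n + \<epsilon> * v" using \<epsilon> n by auto
  then have "sin (turn w) = sin (\<epsilon> * v)" by (simp add: sin_add)
  then have "\<epsilon> * sin (turn w) = sin v" using \<epsilon> by auto
  moreover have "sin v > 0" using v pi_gt_zero by (intro sin_gt_zero) linarith+
  ultimately show False using s[of w] by simp
qed

lemma periodic_solution_turns:
  assumes "sol_y \<alpha> \<in> periodic_solutions T A B"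
  shows "whole_turns (turn \<alpha>)" and "turn \<alpha> = max_turn \<or> turn \<alpha> = min_turn"
proof -
  obtain p where "solves A B (sol_y \<alpha>) p" and per: "\<And>s. sol_y \<alpha> (s + T) = sol_y \<alpha> s" "\<And>s. p (s + T) = p s"
    using assms unfolding periodic_solutions_def by blast
  then have "A s * p s = A s * sol_p \<alpha> s" for s
    using sol[of \<alpha>] unfolding solves_def by (metis DERIV_unique)
  then have p: "p = sol_p \<alpha>" using A_pos by (metis ext less_irrefl mult_left_cancel)
  have e: "amp \<alpha> T * sin (angle \<alpha> T) = sin \<alpha>" "amp \<alpha> T * cos (angle \<alpha> T) = cos \<alpha>"
    using per(1)[of 0] per(2)[of 0] sol_0[of \<alpha>] unfolding p by (simp_all add: sol_y_def sol_p_def)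
  have "(amp \<alpha> T)\<^sup>2 * ((sin (angle \<alpha> T))\<^sup>2 + (cos (angle \<alpha> T))\<^sup>2) = (sin \<alpha>)\<^sup>2 + (cos \<alpha>)\<^sup>2"
    using e by (simp only: flip: e) (simp only: power_mult_distrib distrib_left)
  then have k: "amp \<alpha> T = 1" using amp_pos[of \<alpha> T] by (simp add: power2_eq_1_iff)
  then have "sin (angle \<alpha> T) = sin \<alpha> \<and> cos (angle \<alpha> T) = cos \<alpha>" using e by simp
  then obtain n :: int where "angle \<alpha> T = \<alpha> + 2 * pi * of_int n"
    unfolding sin_cos_eq_iff by (auto simp: algebra_simps)
  then have n: "turn \<alpha> = 2 * pi * of_int n" by (simp add: turn_def final_def)
  then show "whole_turns (turn \<alpha>)" by (auto simp: whole_turns_def)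
  obtain \<beta> where \<beta>: "\<And>t. amp (\<alpha> + t) T * sin (turn (\<alpha> + t)) =
      sin t * ((1 / amp \<alpha> T - amp \<alpha> T) * cos t - \<beta> * sin t)"
    using turn_near_fixed_direction[OF n] by metis
  have q: "amp x T * sin (turn x) = - \<beta> * (sin (x - \<alpha>))\<^sup>2" for x
    using \<beta>[of "x - \<alpha>"] by (simp add: k power2_eq_square)
  show "turn \<alpha> = max_turn \<or> turn \<alpha> = min_turn"
  proof (cases "\<beta> \<ge> 0")
    case True
    then have "amp x T * sin (turn x) \<le> 0" for x unfolding q by (simp add: mult_nonneg_nonneg)
    then have "1 * sin (turn x) \<le> 0" for x using amp_pos[of x T] by (simp add: mult_le_0_iff) (metis less_not_sym not_le)
    from turn_le_if_sin_le[OF n _ this] have "turn x \<le> turn \<alpha>" for x by simp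
    then show ?thesis using max_turn turn_le_max by (metis order_antisym)
  next
    case False
    then have "amp x T * sin (turn x) \<ge> 0" for x unfolding q by (simp add: mult_nonpos_nonneg)
    then have "- 1 * sin (turn x) \<le> 0" for x using amp_pos[of x T] by (simp add: zero_le_mult_iff) (metis less_not_sym not_le)
    from turn_le_if_sin_le[OF n _ this] have "turn \<alpha> \<le> turn x" for x by simp
    then show ?thesis using min_turn min_le_turn by (metis order_antisym)
  qed
qed

lemma periodic_solutions_polar:
  assumes "y \<in> periodic_solutions T A B" "y \<noteq> (\<lambda>_. 0)"
  obtains c \<alpha> where "c \<noteq> 0" "y = (\<lambda>s. c * sol_y \<alpha> s)" "sol_y \<alpha> \<in> periodic_solutions T A B"
proof -
  obtain p where p: "solves A B y p" "y T = y 0" "p T = p 0" using assms(1) periodic_solutions_iff by blast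
  obtain c \<alpha> where c: "y = (\<lambda>s. c * sol_y \<alpha> s)" "p = (\<lambda>s. c * sol_p \<alpha> s)" using solves_polar[OF p(1)] by metis
  have "c \<noteq> 0" using c(1) assms(2) by auto
  moreover from this have "sol_y \<alpha> \<in> periodic_solutions T A B"
    unfolding periodic_solutions_iff using p(2,3) sol[of \<alpha>] unfolding c
    by (intro exI[of _ "sol_p \<alpha>"]) simp
  ultimately show ?thesis using that c(1) by blast
qed

text \<open>
  An extremal turn by a whole number of revolutions comes from a periodic solution.
\<close>

lemma max_turn_periodic:
  assumes "whole_turns max_turn" obtains \<alpha> where "turn \<alpha> = max_turn" "sol_y \<alpha> \<in> periodic_solutions T A B"
proof -
  obtain \<alpha> where \<alpha>: "turn \<alpha> = max_turn" "\<And>x. turn x \<le> turn \<alpha>" using max_turn by metis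
  with assms obtain n where "turn \<alpha> = 2 * pi * of_int n" by (auto simp: whole_turns_def)
  from extremal_turn_periodic[OF this, of 1] \<alpha> that show ?thesis by simp
qed

lemma min_turn_periodic:
  assumes "whole_turns min_turn" obtains \<alpha> where "turn \<alpha> = min_turn" "sol_y \<alpha> \<in> periodic_solutions T A B"
proof -
  obtain \<alpha> where \<alpha>: "turn \<alpha> = min_turn" "\<And>x. turn \<alpha> \<le> turn x" using min_turn by metis
  with assms obtain n where "turn \<alpha> = 2 * pi * of_int n" by (auto simp: whole_turns_def)
  from extremal_turn_periodic[OF this, of "-1"] \<alpha> that show ?thesis by simp
qed

end

lemma scale_fun_apply [simp]: "scale_fun c f x = c * f x"
  by (simp add: scale_fun_def)

context periodic_system begin

lemma periodic_solutions_subspace: "fun_space.subspace (periodic_solutions T A B)"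
proof (rule fun_space.subspaceI)
  have *: "(\<lambda>s. a * y s + b * u s) \<in> periodic_solutions T A B"
    if "y \<in> periodic_solutions T A B" "u \<in> periodic_solutions T A B" for a b y u
    using that unfolding periodic_solutions_def
    by clarsimp (metis (no_types, lifting) solves_linear)
  have "solves A B (\<lambda>_. 0) (\<lambda>_. 0)" by (simp add: solves_def)
  then show "0 \<in> periodic_solutions T A B"
    by (auto simp: periodic_solutions_def zero_fun_def)
  show "y + u \<in> periodic_solutions T A B"
    if "y \<in> periodic_solutions T A B" "u \<in> periodic_solutions T A B" for y u
    using *[OF that, of 1 1] by (simp add: plus_fun_def)
  show "scale_fun c y \<in> periodic_solutions T A B" if "y \<in> periodic_solutions T A B" for c y
    using *[OF that that, of c 0] by (simp add: scale_fun_def)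
qed

lemma sol_y_nonzero: "sol_y \<alpha> \<noteq> (\<lambda>_. 0)"
proof
  assume *: "sol_y \<alpha> = (\<lambda>_. 0)"
  have "(sol_y \<alpha> has_real_derivative A 0 * sol_p \<alpha> 0) (at 0)" using sol[of \<alpha>] unfolding solves_def by blast
  then have "A 0 * cos \<alpha> = 0" unfolding * using DERIV_unique[OF _ DERIV_const] by fastforce
  moreover have "sin \<alpha> = 0" using sol_0(1)[of \<alpha>] * by simp
  ultimately show False using A_pos[of 0] sin_cos_squared_add[of \<alpha>] by auto
qed

lemma sol_y_rotate_fun:
  "sol_y (\<alpha> + t) = scale_fun (cos t) (sol_y \<alpha>) + scale_fun (sin t) (sol_y (\<alpha> + pi / 2))"
  by (rule ext) (simp add: sol_rotate(1)[of \<alpha> t])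

text \<open>
  Two independent fixed directions force the monodromy map to be the identity.
\<close>

lemma all_periodic_if_two_directions:
  assumes "sol_y \<alpha> \<in> periodic_solutions T A B" "sol_y \<beta> \<in> periodic_solutions T A B" "sin (\<beta> - \<alpha>) \<noteq> 0"
  shows "whole_turns max_turn" "whole_turns min_turn"
proof -
  let ?E = "periodic_solutions T A B"
  let ?t = "\<beta> - \<alpha>"
  have "sol_y (\<alpha> + pi / 2) = scale_fun (1 / sin ?t) (sol_y \<beta>) + scale_fun (- (cos ?t / sin ?t)) (sol_y \<alpha>)"
    using sol_y_rotate_fun[of \<alpha> ?t] assms(3) by (simp add: fun_eq_iff field_simps)
  then have "sol_y (\<alpha> + pi / 2) \<in> ?E"
    using fun_space.subspace_add fun_space.subspace_scale periodic_solutions_subspace assms(1,2) by metis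
  then have all: "sol_y (\<alpha> + t) \<in> ?E" for t
    unfolding sol_y_rotate_fun[of \<alpha> t]
    using fun_space.subspace_add fun_space.subspace_scale periodic_solutions_subspace assms(1) by metis
  then have "whole_turns (turn \<gamma>)" for \<gamma> using periodic_solution_turns(1)[OF all[of "\<gamma> - \<alpha>"]] by simp
  then show "whole_turns max_turn" "whole_turns min_turn" using max_turn min_turn by metis+
qed

text \<open>
  Each extremal turn contributes one dimension if it consists of whole revolutions. If both do, they
  coincide, because they differ by less than \<open>\<pi>\<close>; then every direction is fixed. If exactly one
  does, a second independent periodic solution would make the other one whole as well.
\<close>

theorem periodic_solutions_basis:
  obtains X where "finite X" "X \<subseteq> periodic_solutions T A B" "fun_space.independent X"
    "periodic_solutions T A B \<subseteq> fun_space.span X"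
    "card X = of_bool (whole_turns min_turn) + of_bool (whole_turns max_turn)"
proof -
  note result = that
  let ?E = "periodic_solutions T A B"
  have indep: "fun_space.independent {sol_y \<alpha>}" for \<alpha>
  proof -
    have "sol_y \<alpha> \<noteq> 0" unfolding zero_fun_def by (rule sol_y_nonzero)
    then show ?thesis by (simp only: fun_space.dependent_single not_False_eq_True)
  qed
  have single: ?thesis if \<alpha>: "sol_y \<alpha> \<in> ?E" and one: "whole_turns min_turn \<noteq> whole_turns max_turn" for \<alpha>
  proof (rule result[of "{sol_y \<alpha>}"])
    show "?E \<subseteq> fun_space.span {sol_y \<alpha>}"
    proof
      fix y assume y: "y \<in> ?E"
      show "y \<in> fun_space.span {sol_y \<alpha>}"
      proof (cases "y = (\<lambda>_. 0)")
        case True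
        then have "y = 0" by (simp only: zero_fun_def)
        then show ?thesis by (simp only: fun_space.span_zero)
      next
        case False
        then obtain c \<beta> where c: "y = (\<lambda>s. c * sol_y \<beta> s)" "sol_y \<beta> \<in> ?E"
          using periodic_solutions_polar[OF y] by metis
        have "sin (\<beta> - \<alpha>) = 0"
          using all_periodic_if_two_directions[OF \<alpha> c(2)] one by blast
        then have "y = scale_fun (c * cos (\<beta> - \<alpha>)) (sol_y \<alpha>)"
          using sol_y_rotate_fun[of \<alpha> "\<beta> - \<alpha>"] by (simp add: c fun_eq_iff)
        then show ?thesis using fun_space.span_base fun_space.span_scale by (metis singletonI)
      qed
    qed
  qed (use \<alpha> one indep in auto)
  consider "whole_turns max_turn" "whole_turns min_turn" | "whole_turns max_turn" "\<not> whole_turns min_turn"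
    | "\<not> whole_turns max_turn" "whole_turns min_turn" | "\<not> whole_turns max_turn" "\<not> whole_turns min_turn" by blast
  then show ?thesis
  proof cases
    case 1
    then obtain m n :: int where "max_turn = 2 * pi * of_int m" "min_turn = 2 * pi * of_int n"
      by (auto simp: whole_turns_def)
    moreover have "m = n"
    proof -
      have d: "max_turn - min_turn = pi * (2 * (of_int m - of_int n))"
        using calculation by (simp add: algebra_simps)
      have "pi * (2 * (of_int m - of_int n)) < pi * 1" "pi * 0 \<le> pi * (2 * (of_int m - of_int n))"
        using max_turn_minus_min_turn turn_le_max[of 0] min_le_turn[of 0] unfolding d[symmetric] by simp_all
      then have "2 * (of_int m - of_int n) < (1::real)" "0 \<le> 2 * (of_int m - of_int n :: real)"
        by (simp_all only: mult_less_cancel_left_pos[OF pi_gt_zero] mult_le_cancel_left_pos[OF pi_gt_zero])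
      then have "of_int (2 * (m - n)) < (of_int 1 :: real)" "of_int 0 \<le> (of_int (2 * (m - n)) :: real)"
        by simp_all
      then show ?thesis unfolding of_int_less_iff of_int_le_iff by presburger
    qed
    ultimately have "turn \<alpha> = 2 * pi * of_int n" for \<alpha>
      using turn_le_max[of \<alpha>] min_le_turn[of \<alpha>] by simp
    then have all: "sol_y \<alpha> \<in> ?E" for \<alpha>
      using extremal_turn_periodic[of \<alpha> n 1] by simp
    let ?X = "{sol_y 0, sol_y (pi / 2)}"
    have nspan: "sol_y 0 \<notin> fun_space.span {sol_y (pi / 2)}"
    proof
      assume "sol_y 0 \<in> fun_space.span {sol_y (pi / 2)}"
      then obtain k where k: "sol_y 0 = scale_fun k (sol_y (pi / 2))"
        by (auto simp: fun_space.span_singleton)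
      then have "k = 0" using sol_0(1)[of 0] sol_0(1)[of "pi / 2"] by (metis mult.right_neutral scale_fun_apply sin_pi_half sin_zero)
      then show False using k sol_y_nonzero[of 0] by (simp add: fun_eq_iff)
    qed
    have neq: "sol_y 0 \<noteq> sol_y (pi / 2)" using nspan fun_space.span_base by (metis singletonI)
    show ?thesis
    proof (rule result[of ?X])
      show "fun_space.independent ?X" using nspan neq indep by (simp add: fun_space.independent_insert)
      show "?E \<subseteq> fun_space.span ?X"
      proof
        fix y assume "y \<in> ?E"
        then obtain p where "solves A B y p" by (auto simp: periodic_solutions_def)
        then obtain c \<alpha> where "y = (\<lambda>s. c * sol_y \<alpha> s)" using solves_polar by metis
        then have "y = scale_fun (c * cos \<alpha>) (sol_y 0) + scale_fun (c * sin \<alpha>) (sol_y (pi / 2))"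
          using sol_y_rotate_fun[of 0 \<alpha>] by (simp add: fun_eq_iff algebra_simps)
        moreover have "scale_fun a (sol_y 0) + scale_fun b (sol_y (pi / 2)) \<in> fun_space.span ?X" for a b
          by (intro fun_space.span_add fun_space.span_scale fun_space.span_base) auto
        ultimately show "y \<in> fun_space.span ?X" by simp
      qed
    qed (use 1 all neq in auto)
  next
    case 2 then show ?thesis using max_turn_periodic single by metis
  next
    case 3 then show ?thesis using min_turn_periodic single by metis
  next
    case 4
    have "?E \<subseteq> {0}"
    proof
      fix y assume y: "y \<in> ?E"
      show "y \<in> {0}"
      proof (rule ccontr)
        assume "y \<notin> {0}"
        then have "y \<noteq> (\<lambda>_. 0)" by (simp only: zero_fun_def singleton_iff not_False_eq_True)
        then obtain \<alpha> where "sol_y \<alpha> \<in> ?E"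
          by (rule periodic_solutions_polar[OF y])
        then show False using periodic_solution_turns[of \<alpha>] 4 by metis
      qed
    qed
    then show ?thesis using 4 by (intro result[of "{}"]) (auto simp: fun_space.independent_empty)
  qed
qed

end

section \<open>Families of periodic systems\<close>

text \<open>
  The parameter \<open>l\<close> in \<open>B + l * C\<close> plays the part of an eigenvalue: increasing it speeds up the
  rotation of every solution.
\<close>

locale periodic_family =
  fixes T :: real and A B C :: "real \<Rightarrow> real"
  assumes T_pos: "T > 0"
    and cont_A: "continuous_on UNIV A" and cont_B: "continuous_on UNIV B" and cont_C: "continuous_on UNIV C"
    and per_A: "A (s + T) = A s" and per_B: "B (s + T) = B s" and per_C: "C (s + T) = C s"
    and A_pos: "A s > 0" and C_pos: "C s > 0"
begin

abbreviation pot :: "real \<Rightarrow> real \<Rightarrow> real" where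
  "pot l s \<equiv> B s + l * C s"

lemma sys: "periodic_system T A (pot l)"
proof
  show "continuous_on UNIV (pot l)" by (intro continuous_intros cont_B cont_C)
  show "pot l (s + T) = pot l s" for s by (simp only: per_B per_C)
qed (rule T_pos cont_A per_A A_pos)+

definition greatest_turn :: "real \<Rightarrow> real" where "greatest_turn l = periodic_system.max_turn T A (pot l)"
definition least_turn :: "real \<Rightarrow> real" where "least_turn l = periodic_system.min_turn T A (pot l)"

lemma turn_strict_mono:
  assumes "l < m"
  shows "periodic_system.turn T A (pot l) \<alpha> < periodic_system.turn T A (pot m) \<alpha>"
proof -
  interpret L: periodic_system T A "pot l" by (rule sys)
  interpret M: periodic_system T A "pot m" by (rule sys)
  have d: "(M.angle \<alpha> has_real_derivative L.spin s (M.angle \<alpha> s) + (m - l) * C s * (sin (M.angle \<alpha> s))\<^sup>2) (at s)" for s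
  proof -
    have "M.spin s x = L.spin s x + (m - l) * C s * (sin x)\<^sup>2" for x
      unfolding L.spin_def M.spin_def by algebra
    from M.angle(2)[of \<alpha> s, unfolded this] show ?thesis .
  qed
  have nonneg: "(m - l) * C s * (sin (M.angle \<alpha> s))\<^sup>2 \<ge> 0" for s
    using assms C_pos[of s] by (simp add: mult_nonneg_nonneg)
  have "(m - l) * C 0 > 0" using assms C_pos by simp
  then obtain s where "0 \<le> s" "s \<le> T" "(m - l) * C s * (sin (M.angle \<alpha> s))\<^sup>2 > 0"
  proof (rule L.perturbation_felt[where c="\<lambda>s. (m - l) * C s" and x="M.angle \<alpha>"
        and x'="\<lambda>s. M.spin s (M.angle \<alpha> s)", rotated 2])
    show "(M.angle \<alpha> has_real_derivative M.spin s (M.angle \<alpha> s)) (at s)" for s by (rule M.angle)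
    show "0 < M.spin s (M.angle \<alpha> s)" if "sin (M.angle \<alpha> s) = 0" for s
      using that A_pos[of s] by (simp add: M.spin_def cos_squared_eq)
  qed (auto intro!: continuous_intros cont_C simp: per_C)
  then have "L.final \<alpha> < M.angle \<alpha> T"
    by (intro L.final_le_supersolution(2)[OF d]) (use nonneg M.angle in auto)
  then show ?thesis by (simp add: L.turn_def M.turn_def M.final_def)
qed

lemma greatest_turn_attained: obtains \<alpha> where "periodic_system.turn T A (pot l) \<alpha> = greatest_turn l"
  by (rule periodic_system.max_turn[OF sys, of l]) (simp add: greatest_turn_def that)

lemma least_turn_attained: obtains \<alpha> where "periodic_system.turn T A (pot l) \<alpha> = least_turn l"
  by (rule periodic_system.min_turn[OF sys, of l]) (simp add: least_turn_def that)

lemma turn_le_greatest: "periodic_system.turn T A (pot l) \<alpha> \<le> greatest_turn l"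
  and least_le_turn: "least_turn l \<le> periodic_system.turn T A (pot l) \<alpha>"
  unfolding greatest_turn_def least_turn_def by (rule periodic_system.turn_le_max[OF sys] periodic_system.min_le_turn[OF sys])+

lemma greatest_turn_strict_mono: assumes "l < m" shows "greatest_turn l < greatest_turn m"
proof -
  obtain \<alpha> where "periodic_system.turn T A (pot l) \<alpha> = greatest_turn l" by (rule greatest_turn_attained)
  then show ?thesis using turn_strict_mono[OF assms, of \<alpha>] turn_le_greatest[of m \<alpha>] by linarith
qed

lemma least_turn_strict_mono: assumes "l < m" shows "least_turn l < least_turn m"
proof -
  obtain \<alpha> where "periodic_system.turn T A (pot m) \<alpha> = least_turn m" by (rule least_turn_attained)
  then show ?thesis using turn_strict_mono[OF assms, of \<alpha>] least_le_turn[of l \<alpha>] by linarith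
qed

lemma least_le_greatest: "least_turn l \<le> greatest_turn l"
  by (rule order_trans[OF least_le_turn turn_le_greatest])

lemma turn_lipschitz:
  obtains K where "\<And>l m \<alpha>. \<bar>l\<bar> \<le> R \<Longrightarrow>
    \<bar>periodic_system.turn T A (pot l) \<alpha> - periodic_system.turn T A (pot m) \<alpha>\<bar> \<le> K * \<bar>l - m\<bar>"
proof -
  obtain a where a: "\<And>s. \<bar>A s\<bar> \<le> a" using periodic_bounded[of A T] cont_A per_A T_pos by metis
  obtain b where b: "\<And>s. \<bar>B s\<bar> \<le> b" using periodic_bounded[of B T] cont_B per_B T_pos by metis
  obtain c where c: "\<And>s. \<bar>C s\<bar> \<le> c" using periodic_bounded[of C T] cont_C per_C T_pos by metis
  define H where "H = a + b + R * c"
  have "\<bar>periodic_system.turn T A (pot l) \<alpha> - periodic_system.turn T A (pot m) \<alpha>\<bar> \<le> c * T * exp (H * T) * \<bar>l - m\<bar>"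
    if l: "\<bar>l\<bar> \<le> R" for l m \<alpha>
  proof -
    interpret L: periodic_system T A "pot l" by (rule sys)
    interpret M: periodic_system T A "pot m" by (rule sys)
    define x y where "x = L.angle \<alpha>" and "y = M.angle \<alpha>"
    define h where "h s = (pot l s - A s) * sin (x s + y s) * sinc (x s - y s)" for s
    have "\<bar>x T - y T\<bar> \<le> (\<bar>x 0 - y 0\<bar> + (\<bar>l - m\<bar> * c) * T) * exp (H * T)"
    proof (rule linear_ode_bound[where d="\<lambda>s. x s - y s" and h=h and e="\<lambda>s. (l - m) * (C s * (sin (y s))\<^sup>2)"])
      show "((\<lambda>s. x s - y s) has_real_derivative h s * (x s - y s) + (l - m) * (C s * (sin (y s))\<^sup>2)) (at s)" for s
      proof -
        have "L.spin s (x s) - M.spin s (y s) = (L.spin s (x s) - L.spin s (y s)) + (l - m) * (C s * (sin (y s))\<^sup>2)"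
          by (simp add: L.spin_def M.spin_def algebra_simps)
        then show ?thesis
          using DERIV_diff[OF L.angle(2)[of \<alpha> s] M.angle(2)[of \<alpha> s]]
          by (simp add: L.spin_diff h_def x_def y_def)
      qed
      show "continuous_on UNIV h"
        unfolding h_def[abs_def] x_def y_def
        by (intro continuous_intros cont_A cont_B cont_C L.cont_angle M.cont_angle)
      show "\<bar>h s\<bar> \<le> H" for s
        unfolding h_def
      proof (rule L.spin_slope_le)
        have "\<bar>l * C s\<bar> \<le> R * c" unfolding abs_mult using l c by (intro mult_mono) (auto intro: order_trans[OF abs_ge_zero])
        then show "\<bar>A s\<bar> + \<bar>pot l s\<bar> \<le> H"
          using a[of s] b[of s] abs_triangle_ineq[of "B s" "l * C s"] by (simp add: H_def)
      qed
      show "\<bar>(l - m) * (C s * (sin (y s))\<^sup>2)\<bar> \<le> \<bar>l - m\<bar> * c" for s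
      proof -
        have "\<bar>C s\<bar> * \<bar>(sin (y s))\<^sup>2\<bar> \<le> c * 1"
          by (intro mult_mono c) (auto simp: abs_square_le_1 intro: order_trans[OF abs_ge_zero c])
        then show ?thesis by (simp add: abs_mult mult_left_mono)
      qed
    qed (use T_pos in simp)
    then show ?thesis
      by (simp add: L.turn_def M.turn_def L.final_def M.final_def L.angle M.angle x_def y_def mult_ac)
  qed
  then show ?thesis by (rule that)
qed

lemma cont_extremal_turns: "continuous_on {-R..R} greatest_turn" "continuous_on {-R..R} least_turn"
proof -
  obtain K where K: "\<And>l m \<alpha>. \<bar>l\<bar> \<le> R \<Longrightarrow>
    \<bar>periodic_system.turn T A (pot l) \<alpha> - periodic_system.turn T A (pot m) \<alpha>\<bar> \<le> K * \<bar>l - m\<bar>"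
    using turn_lipschitz by blast
  have "greatest_turn l \<le> greatest_turn m + K * \<bar>l - m\<bar>" if l: "\<bar>l\<bar> \<le> R" for l m
  proof -
    obtain \<alpha> where "periodic_system.turn T A (pot l) \<alpha> = greatest_turn l" by (rule greatest_turn_attained)
    then show ?thesis using K[OF l, of \<alpha> m] turn_le_greatest[of m \<alpha>] by linarith
  qed
  then have "\<bar>greatest_turn l - greatest_turn m\<bar> \<le> K * \<bar>l - m\<bar>" if "\<bar>l\<bar> \<le> R" "\<bar>m\<bar> \<le> R" for l m
    using that by (smt (verit) abs_minus_commute)
  moreover have "least_turn m \<le> least_turn l + K * \<bar>l - m\<bar>" if l: "\<bar>l\<bar> \<le> R" for l m
  proof -
    obtain \<alpha> where "periodic_system.turn T A (pot l) \<alpha> = least_turn l" by (rule least_turn_attained)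
    then show ?thesis using K[OF l, of \<alpha> m] least_le_turn[of m \<alpha>] by linarith
  qed
  then have "\<bar>least_turn l - least_turn m\<bar> \<le> K * \<bar>l - m\<bar>" if "\<bar>l\<bar> \<le> R" "\<bar>m\<bar> \<le> R" for l m
    using that by (smt (verit) abs_minus_commute)
  ultimately have "\<bar>K\<bar>-lipschitz_on {-R..R} greatest_turn" "\<bar>K\<bar>-lipschitz_on {-R..R} least_turn"
    by (auto intro!: lipschitz_onI simp: dist_real_def abs_le_iff[symmetric])
      (smt (verit) abs_ge_self abs_ge_zero mult_right_mono)+
  then show "continuous_on {-R..R} greatest_turn" "continuous_on {-R..R} least_turn"
    by (auto intro: lipschitz_on_continuous_on)
qed

text \<open>
  The starting point for continuity arguments: once \<open>B + l * C\<close> is negative, the solutions hardly rotate.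
\<close>

lemma very_negative: obtains R where "R > 0" "least_turn (- R) < 0" "greatest_turn (- R) < pi"
proof -
  obtain s0 where s0: "\<And>s. C s0 \<le> C s" using periodic_attains_inf[OF cont_C per_C T_pos] by metis
  obtain b where b: "\<And>s. \<bar>B s\<bar> \<le> b" using periodic_bounded[of B T] cont_B per_B T_pos by metis
  define R where "R = (b + 1) / C s0"
  have b0: "b \<ge> 0" using b[of 0] by linarith
  have R: "R > 0" using b0 C_pos by (simp add: R_def)
  interpret L: periodic_system T A "pot (- R)" by (rule sys)
  have neg: "pot (- R) s < 0" for s
  proof -
    have "R * C s0 = b + 1" using C_pos[of s0] by (simp add: R_def)
    moreover have "R * C s0 \<le> R * C s" using R s0 by (intro mult_left_mono) auto
    ultimately show ?thesis using b[of s] by (simp add: abs_le_iff)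
  qed
  have ex: "\<exists>s. 0 \<le> s \<and> s \<le> T \<and> pot (- R) s < 0"
    using neg[of 0] T_pos by (intro exI[of _ 0]) simp
  have "least_turn (- R) < 0"
    unfolding least_turn_def by (rule L.turns_nonpositive_potential(3)[OF less_imp_le[OF neg] ex])
  moreover have "greatest_turn (- R) < pi"
    unfolding greatest_turn_def by (rule L.turns_nonpositive_potential(1)[OF less_imp_le[OF neg]])
  ultimately show ?thesis using R that by blast
qed

lemma least_turn_gt: "least_turn l > - pi" and greatest_turn_pos: "greatest_turn l > 0"
  by (simp_all add: least_turn_def greatest_turn_def periodic_system.min_turn_gt[OF sys] periodic_system.max_turn_pos[OF sys])

definition mult :: "real \<Rightarrow> nat" where
  "mult l = of_bool (whole_turns (least_turn l)) + of_bool (whole_turns (greatest_turn l))"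

theorem multiplicity_basis:
  obtains X where "finite X" "X \<subseteq> periodic_solutions T A (pot l)" "fun_space.independent X"
    "periodic_solutions T A (pot l) \<subseteq> fun_space.span X" "card X = mult l"
  by (rule periodic_system.periodic_solutions_basis[OF sys, of l])
    (simp add: mult_def least_turn_def greatest_turn_def that)

lemma sum_mult: "finite S \<Longrightarrow> (\<Sum>l\<in>S. mult l) = card {l \<in> S. whole_turns (least_turn l)} + card {l \<in> S. whole_turns (greatest_turn l)}"
  by (simp add: mult_def sum.distrib sum_of_bool_eq Int_def)

text \<open>
  A strictly increasing function passes each multiple of \<open>2 * pi\<close> at most once.
\<close>

lemma card_turns_le:
  fixes f :: "real \<Rightarrow> real"
  assumes "finite S" "\<And>l m. l < m \<Longrightarrow> f l < f m"
    and "\<And>l. l \<in> S \<Longrightarrow> 2 * pi * (of_int a - 1) < f l" "\<And>l. l \<in> S \<Longrightarrow> f l < 2 * pi * of_int b"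
  shows "card {l \<in> S. whole_turns (f l)} \<le> nat (b - a)"
proof -
  let ?g = "\<lambda>l. \<lfloor>f l / (2 * pi)\<rfloor>"
  have g: "f l = 2 * pi * of_int (?g l)" if "whole_turns (f l)" for l
    using that by (auto simp: whole_turns_def)
  have "inj_on ?g {l \<in> S. whole_turns (f l)}"
  proof (rule inj_onI)
    fix x y assume "x \<in> {l \<in> S. whole_turns (f l)}" "y \<in> {l \<in> S. whole_turns (f l)}" "?g x = ?g y"
    then have "f x = f y" using g by (metis (mono_tags) mem_Collect_eq)
    then show "x = y" using assms(2) by (metis less_irrefl linorder_neqE)
  qed
  moreover have "?g ` {l \<in> S. whole_turns (f l)} \<subseteq> {a..<b}"
  proof clarify
    fix l assume l: "l \<in> S" "whole_turns (f l)"
    have "2 * pi * (of_int a - 1) < 2 * pi * of_int (?g l)" "2 * pi * of_int (?g l) < 2 * pi * of_int b"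
      using g[OF l(2)] assms(3,4)[OF l(1)] by metis+
    then have "of_int a - 1 < (of_int (?g l) :: real)" "of_int (?g l) < (of_int b :: real)"
      by (simp_all only: mult_less_cancel_left_pos[of "2 * pi"] pi_gt_zero zero_less_mult_iff zero_less_numeral simp_thms)
    then show "?g l \<in> {a..<b}" by (simp only: atLeastLessThan_iff) linarith
  qed
  ultimately show ?thesis using card_inj_on_le[of ?g _ "{a..<b}"] by (simp add: card_atLeastLessThan_int)
qed

text \<open>
  The least turn exceeds \<open>- pi\<close> and the greatest one is positive. On negative parameters they can
  therefore only pass the multiples \<open>0, \<dots>, N - 1\<close> and \<open>1, \<dots>, N - 1\<close> of \<open>2 * pi\<close>, respectively.
\<close>

theorem sum_mult_le:
  assumes S: "finite S" "S \<subseteq> {..<0}" and N: "greatest_turn 0 \<le> 2 * pi * real N" "N \<ge> 1"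
  shows "(\<Sum>l\<in>S. mult l) \<le> 2 * N - 1"
proof -
  have greatest_turn: "greatest_turn l < 2 * pi * of_int (int N)" if "l \<in> S" for l using greatest_turn_strict_mono[of l 0] that S N by auto
  have "card {l \<in> S. whole_turns (least_turn l)} \<le> nat (int N - 0)"
  proof (rule card_turns_le[OF S(1) least_turn_strict_mono])
    show "2 * pi * (of_int 0 - 1) < least_turn l" for l
    proof -
      have "- (2 * pi) < least_turn l" using least_turn_gt[of l] pi_gt_zero by linarith
      then show ?thesis by simp
    qed
    show "least_turn l < 2 * pi * of_int (int N)" if "l \<in> S" for l using least_le_greatest[of l] greatest_turn[OF that] by linarith
  qed
  moreover have "card {l \<in> S. whole_turns (greatest_turn l)} \<le> nat (int N - 1)"
    by (rule card_turns_le[OF S(1) greatest_turn_strict_mono _ greatest_turn]) (use greatest_turn_pos in auto)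
  ultimately show ?thesis unfolding sum_mult[OF S(1)] using N(2) by linarith
qed

lemma no_negative_mult:
  assumes "greatest_turn 0 < 2 * pi" "least_turn 0 \<le> 0" "l < 0"
  shows "mult l = 0"
proof -
  have "\<not> whole_turns (least_turn l)"
  proof
    assume "whole_turns (least_turn l)"
    then obtain n :: int where n: "least_turn l = 2 * pi * of_int n" by (auto simp: whole_turns_def)
    have "least_turn l < 0" using least_turn_strict_mono[of l 0] assms by simp
    then have "n < 0" unfolding n by (simp add: mult_less_0_iff)
    then have "2 * pi * of_int n \<le> 2 * pi * (-1)" by (intro mult_left_mono) auto
    then show False using least_turn_gt[of l] n pi_gt_zero by linarith
  qed
  moreover have "\<not> whole_turns (greatest_turn l)"
  proof
    assume "whole_turns (greatest_turn l)"
    then obtain n :: int where n: "greatest_turn l = 2 * pi * of_int n" by (auto simp: whole_turns_def)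
    have "0 < greatest_turn l" "greatest_turn l < 2 * pi" using greatest_turn_strict_mono[of l 0] assms greatest_turn_pos by auto
    then have "0 < n" "of_int n < (1::real)" unfolding n by (simp_all add: zero_less_mult_iff)
    then show False by linarith
  qed
  ultimately show ?thesis by (simp add: mult_def)
qed

text \<open>
  By the intermediate value theorem, from a very negative parameter up to \<open>0\<close> the least turn passes the
  multiples \<open>0, \<dots>, n\<close> of \<open>2 * pi\<close> and the greatest turn passes \<open>1, \<dots>, n\<close>.
\<close>

theorem sum_mult_ge:
  assumes n: "2 * pi * real n < least_turn 0"
  obtains S where "finite S" "S \<subseteq> {..<0}" "2 * n + 1 \<le> (\<Sum>l\<in>S. mult l)"
proof -
  obtain R where R: "R > 0" "least_turn (- R) < 0" "greatest_turn (- R) < pi" using very_negative by metis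
  have "\<exists>l<0. least_turn l = 2 * pi * real j" if "j \<le> n" for j
  proof -
    have lt: "2 * pi * real j < least_turn 0" using n that by (smt (verit) mult_left_mono of_nat_mono pi_gt_zero)
    have "\<exists>x\<ge>-R. x \<le> 0 \<and> least_turn x = 2 * pi * real j"
      by (rule IVT') (use R lt cont_extremal_turns[of R] in \<open>auto intro: order_trans[OF less_imp_le[OF R(2)]] continuous_on_subset\<close>)
    then obtain x where "-R \<le> x" "x \<le> 0" "least_turn x = 2 * pi * real j" by blast
    then show ?thesis using lt by (intro exI[of _ x]) (auto simp: less_le)
  qed
  then obtain a where a: "\<And>j. j \<le> n \<Longrightarrow> a j < 0" "\<And>j. j \<le> n \<Longrightarrow> least_turn (a j) = 2 * pi * real j" by metis
  have "\<exists>l<0. greatest_turn l = 2 * pi * real j" if j: "j \<in> {1..n}" for j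
  proof -
    have lt: "2 * pi * real j < greatest_turn 0" using n j least_le_greatest[of 0] by (smt (verit) atLeastAtMost_iff mult_left_mono of_nat_mono pi_gt_zero)
    have "2 * pi * 1 \<le> 2 * pi * real j" using j by (intro mult_left_mono) auto
    then have gt: "greatest_turn (- R) \<le> 2 * pi * real j" using R(3) pi_gt_zero by linarith
    have "\<exists>x\<ge>-R. x \<le> 0 \<and> greatest_turn x = 2 * pi * real j"
      by (rule IVT') (use R lt gt cont_extremal_turns[of R] in \<open>auto intro: continuous_on_subset\<close>)
    then obtain x where "-R \<le> x" "x \<le> 0" "greatest_turn x = 2 * pi * real j" by blast
    then show ?thesis using lt by (intro exI[of _ x]) (auto simp: less_le)
  qed
  then obtain b where b: "\<And>j. j \<in> {1..n} \<Longrightarrow> b j < 0" "\<And>j. j \<in> {1..n} \<Longrightarrow> greatest_turn (b j) = 2 * pi * real j" by metis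
  define S where "S = a ` {..n} \<union> b ` {1..n}"
  have S: "finite S" "S \<subseteq> {..<0}" using a(1) b(1) by (auto simp: S_def)
  have "inj_on a {..n}" using a(2) by (intro inj_onI) (metis atMost_iff mult_left_cancel of_nat_eq_iff pi_neq_zero zero_neq_numeral mult_eq_0_iff)
  then have "n + 1 = card (a ` {..n})" by (simp add: card_image)
  also have "\<dots> \<le> card {l \<in> S. whole_turns (least_turn l)}"
  proof (rule card_mono)
    show "a ` {..n} \<subseteq> {l \<in> S. whole_turns (least_turn l)}"
      using a(2) unfolding whole_turns_def S_def by (auto intro: exI[of _ "int _"])
  qed (use S in simp)
  finally have 1: "n + 1 \<le> card {l \<in> S. whole_turns (least_turn l)}" .
  have "inj_on b {1..n}" using b(2) by (intro inj_onI) (metis mult_left_cancel of_nat_eq_iff pi_neq_zero zero_neq_numeral mult_eq_0_iff)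
  then have "n = card (b ` {1..n})" by (simp add: card_image)
  also have "\<dots> \<le> card {l \<in> S. whole_turns (greatest_turn l)}"
  proof (rule card_mono)
    show "b ` {1..n} \<subseteq> {l \<in> S. whole_turns (greatest_turn l)}"
      using b(2) unfolding whole_turns_def S_def by auto (metis atLeastAtMost_iff of_int_of_nat_eq One_nat_def)
  qed (use S in simp)
  finally have 2: "n \<le> card {l \<in> S. whole_turns (greatest_turn l)}" .
  show ?thesis using that[OF S] 1 2 unfolding sum_mult[OF S(1)] by simp
qed

end

section \<open>Fourier coefficients of continuous periodic functions\<close>

text \<open>
  Cosines for \<open>j \<ge> 0\<close> and sines for \<open>j < 0\<close>: a single integer runs through an orthogonal basis of the
  functions on the circle, and \<open>j\<^sup>2\<close> is the eigenvalue.
\<close>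

definition trig :: "int \<Rightarrow> real \<Rightarrow> real" where
  "trig j t = (if j \<ge> 0 then cos (of_int j * t) else sin (of_int j * t))"

definition trig' :: "int \<Rightarrow> real \<Rightarrow> real" where
  "trig' j t = (if j \<ge> 0 then - of_int j * sin (of_int j * t) else of_int j * cos (of_int j * t))"

lemma trig_deriv: "(trig j has_real_derivative trig' j t) (at t)"
  unfolding trig_def[abs_def] trig'_def by (auto intro!: derivative_eq_intros)

lemma trig'_deriv: "(trig' j has_real_derivative - (of_int j)\<^sup>2 * trig j t) (at t)"
  unfolding trig_def trig'_def[abs_def] by (auto intro!: derivative_eq_intros simp: power2_eq_square)

lemma cont_trig [continuous_intros]:
  assumes "continuous_on S f"
  shows "continuous_on S (\<lambda>x. trig j (f x))" "continuous_on S (\<lambda>x. trig' j (f x))"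
proof -
  have "continuous_on UNIV (trig j)" "continuous_on UNIV (trig' j)"
    by (meson trig_deriv trig'_deriv DERIV_isCont continuous_at_imp_continuous_on)+
  then show "continuous_on S (\<lambda>x. trig j (f x))" "continuous_on S (\<lambda>x. trig' j (f x))"
    using assms continuous_on_compose2 by (metis subset_UNIV)+
qed

lemma sin_cos_int_periodic:
  "cos (of_int m * (t + 2 * pi)) = cos (of_int m * t)" "sin (of_int m * (t + 2 * pi)) = sin (of_int m * t)"
proof -
  have e: "of_int m * (t + 2 * pi) = of_int m * t + 2 * pi * of_int m" by (simp add: algebra_simps)
  show "cos (of_int m * (t + 2 * pi)) = cos (of_int m * t)" "sin (of_int m * (t + 2 * pi)) = sin (of_int m * t)"
    unfolding e by (simp_all add: sin_add cos_add)
qed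

lemma trig_periodic: "trig j (t + 2 * pi) = trig j t" "trig' j (t + 2 * pi) = trig' j t"
  by (simp_all add: trig_def trig'_def sin_cos_int_periodic)

lemma has_integral_cos_int:
  "((\<lambda>t. cos (of_int m * t)) has_integral (if m = 0 then 2 * pi else 0)) {0..2 * pi}"
proof (cases "m = 0")
  case True
  then show ?thesis using has_integral_const_real[of "1::real" 0 "2 * pi"] by simp
next
  case False
  have "((\<lambda>t. cos (of_int m * t)) has_integral sin (of_int m * (2 * pi)) / of_int m - sin (of_int m * 0) / of_int m) {0..2 * pi}"
    by (rule fundamental_theorem_of_calculus)
      (use False in \<open>auto intro!: derivative_eq_intros simp: has_real_derivative_iff_has_vector_derivative[symmetric]\<close>)
  then show ?thesis using False sin_cos_int_periodic[of m 0] by simp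
qed

lemma has_integral_sin_int: "((\<lambda>t. sin (of_int m * t)) has_integral 0) {0..2 * pi}"
proof (cases "m = 0")
  case False
  have "((\<lambda>t. sin (of_int m * t)) has_integral - cos (of_int m * (2 * pi)) / of_int m - - cos (of_int m * 0) / of_int m) {0..2 * pi}"
    by (rule fundamental_theorem_of_calculus)
      (use False in \<open>auto intro!: derivative_eq_intros simp: has_real_derivative_iff_has_vector_derivative[symmetric]\<close>)
  then show ?thesis using False sin_cos_int_periodic[of m 0] by simp
qed simp

lemma trig_product:
  "trig i t * trig j t =
    (if i \<ge> 0 \<and> j \<ge> 0 then (cos (of_int (i - j) * t) + cos (of_int (i + j) * t)) / 2
     else if i < 0 \<and> j < 0 then (cos (of_int (i - j) * t) - cos (of_int (i + j) * t)) / 2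
     else if i < 0 then (sin (of_int (i + j) * t) + sin (of_int (i - j) * t)) / 2
     else (sin (of_int (i + j) * t) - sin (of_int (i - j) * t)) / 2)"
  by (simp add: trig_def left_diff_distrib distrib_right sin_add cos_add sin_diff cos_diff)

definition trig_norm2 :: "int \<Rightarrow> real" where
  "trig_norm2 j = (if j = 0 then 2 * pi else pi)"

lemma trig_norm2_pos: "trig_norm2 j > 0"
  by (simp add: trig_norm2_def)

lemma trig_orthogonal:
  "((\<lambda>t. trig i t * trig j t) has_integral (if i = j then trig_norm2 j else 0)) {0..2 * pi}"
proof -
  note C = has_integral_cos_int and S = has_integral_sin_int
  consider "i \<ge> 0" "j \<ge> 0" | "i < 0" "j < 0" | "i < 0" "j \<ge> 0" | "i \<ge> 0" "j < 0" by linarith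
  then show ?thesis
  proof cases
    case 1
    have "((\<lambda>t. (cos (of_int (i - j) * t) + cos (of_int (i + j) * t)) / 2) has_integral
      ((if i - j = 0 then 2 * pi else 0) + (if i + j = 0 then 2 * pi else 0)) / 2) {0..2 * pi}"
      by (intro has_integral_divide has_integral_add C)
    moreover have "(\<lambda>t. trig i t * trig j t) = (\<lambda>t. (cos (of_int (i - j) * t) + cos (of_int (i + j) * t)) / 2)"
      unfolding trig_product using 1 by auto
    moreover have "((if i - j = 0 then 2 * pi else 0) + (if i + j = 0 then 2 * pi else 0)) / 2 = (if i = j then trig_norm2 j else 0)"
      using 1 by (auto simp: trig_norm2_def)
    ultimately show ?thesis by (simp only:)
  next
    case 2
    have "((\<lambda>t. (cos (of_int (i - j) * t) - cos (of_int (i + j) * t)) / 2) has_integral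
      ((if i - j = 0 then 2 * pi else 0) - (if i + j = 0 then 2 * pi else 0)) / 2) {0..2 * pi}"
      by (intro has_integral_divide has_integral_diff C)
    moreover have "(\<lambda>t. trig i t * trig j t) = (\<lambda>t. (cos (of_int (i - j) * t) - cos (of_int (i + j) * t)) / 2)"
      unfolding trig_product using 2 by auto
    moreover have "((if i - j = 0 then 2 * pi else 0) - (if i + j = 0 then 2 * pi else 0)) / 2 = (if i = j then trig_norm2 j else 0)"
      using 2 by (auto simp: trig_norm2_def)
    ultimately show ?thesis by (simp only:)
  next
    case 3
    have "((\<lambda>t. (sin (of_int (i + j) * t) + sin (of_int (i - j) * t)) / 2) has_integral (0 + 0) / 2) {0..2 * pi}"
      by (intro has_integral_divide has_integral_add S)
    moreover have "(\<lambda>t. trig i t * trig j t) = (\<lambda>t. (sin (of_int (i + j) * t) + sin (of_int (i - j) * t)) / 2)"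
      unfolding trig_product using 3 by auto
    moreover have "(0 + 0) / 2 = (if i = j then trig_norm2 j else 0)"
      using 3 by (auto simp: trig_norm2_def)
    ultimately show ?thesis by (simp only:)
  next
    case 4
    have "((\<lambda>t. (sin (of_int (i + j) * t) - sin (of_int (i - j) * t)) / 2) has_integral (0 - 0) / 2) {0..2 * pi}"
      by (intro has_integral_divide has_integral_diff S)
    moreover have "(\<lambda>t. trig i t * trig j t) = (\<lambda>t. (sin (of_int (i + j) * t) - sin (of_int (i - j) * t)) / 2)"
      unfolding trig_product using 4 by auto
    moreover have "(0 - 0) / 2 = (if i = j then trig_norm2 j else 0)"
      using 4 by (auto simp: trig_norm2_def)
    ultimately show ?thesis by (simp only:)
  qed
qed

definition orthogonal_to_trig :: "(real \<Rightarrow> real) \<Rightarrow> bool" where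
  "orthogonal_to_trig u \<longleftrightarrow> continuous_on UNIV u \<and>
    (\<forall>m::int. integral {0..2 * pi} (\<lambda>t. u t * cos (of_int m * t)) = 0 \<and>
              integral {0..2 * pi} (\<lambda>t. u t * sin (of_int m * t)) = 0)"

lemma orthogonal_to_trig_linear:
  assumes "orthogonal_to_trig u" "orthogonal_to_trig w"
  shows "orthogonal_to_trig (\<lambda>t. a * u t + b * w t)"
proof -
  have cu: "continuous_on S u" and cw: "continuous_on S w" for S
    using assms by (auto simp: orthogonal_to_trig_def intro: continuous_on_subset)
  have "integral {0..2 * pi} (\<lambda>t. (a * u t + b * w t) * c t) =
      a * integral {0..2 * pi} (\<lambda>t. u t * c t) + b * integral {0..2 * pi} (\<lambda>t. w t * c t)"
    if c: "continuous_on {0..2 * pi} c" for c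
  proof -
    have i: "(\<lambda>t. u t * c t) integrable_on {0..2 * pi}" "(\<lambda>t. w t * c t) integrable_on {0..2 * pi}"
      by (intro integrable_continuous_real continuous_intros cu cw c)+
    have "((\<lambda>t. a * (u t * c t) + b * (w t * c t)) has_integral
      a * integral {0..2 * pi} (\<lambda>t. u t * c t) + b * integral {0..2 * pi} (\<lambda>t. w t * c t)) {0..2 * pi}"
      by (intro has_integral_add has_integral_mult_right integrable_integral i)
    then show ?thesis by (intro integral_unique) (simp add: algebra_simps)
  qed
  then show ?thesis
    using assms unfolding orthogonal_to_trig_def
    by (auto intro!: continuous_intros simp: continuous_on_cos continuous_on_sin)
qed

text \<open>
  Multiplication by \<open>cos\<close> or \<open>sin\<close> shifts all frequencies by one, up and down.
\<close>

lemma orthogonal_to_trig_mult: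
  assumes "orthogonal_to_trig u"
  shows "orthogonal_to_trig (\<lambda>t. u t * cos t)" "orthogonal_to_trig (\<lambda>t. u t * sin t)"
proof -
  have cu: "continuous_on S u" for S
    using assms by (auto simp: orthogonal_to_trig_def intro: continuous_on_subset)
  define I where "I f = integral {0..2 * pi} (\<lambda>t. u t * f t)" for f :: "real \<Rightarrow> real"
  have half: "I (\<lambda>t. (f t + c * g t) / 2) = (I f + c * I g) / 2"
    if "continuous_on {0..2 * pi} f" "continuous_on {0..2 * pi} g" for f g c
  proof -
    have i: "(\<lambda>t. u t * f t) integrable_on {0..2 * pi}" "(\<lambda>t. u t * g t) integrable_on {0..2 * pi}"
      by (intro integrable_continuous_real continuous_intros cu that)+
    have "((\<lambda>t. (u t * f t + c * (u t * g t)) / 2) has_integral (I f + c * I g) / 2) {0..2 * pi}"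
      unfolding I_def by (intro has_integral_add has_integral_mult_right has_integral_divide integrable_integral i)
    then show ?thesis unfolding I_def by (intro integral_unique) (simp add: algebra_simps)
  qed
  have C: "I (\<lambda>t. cos (of_int m * t)) = 0" and S: "I (\<lambda>t. sin (of_int m * t)) = 0" for m
    using assms by (auto simp: orthogonal_to_trig_def I_def)
  have z: "I (\<lambda>t. (cos (of_int m * t) + c * cos (of_int n * t)) / 2) = 0"
    "I (\<lambda>t. (sin (of_int m * t) + c * sin (of_int n * t)) / 2) = 0" for m n c
    by (subst half; auto intro!: continuous_intros simp: C S)+
  have 1: "cos t * cos (of_int m * t) = (cos (of_int (m + 1) * t) + 1 * cos (of_int (m - 1) * t)) / 2"
    "cos t * sin (of_int m * t) = (sin (of_int (m + 1) * t) + 1 * sin (of_int (m - 1) * t)) / 2"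
    "sin t * cos (of_int m * t) = (sin (of_int (m + 1) * t) + -1 * sin (of_int (m - 1) * t)) / 2"
    "sin t * sin (of_int m * t) = (cos (of_int (m - 1) * t) + -1 * cos (of_int (m + 1) * t)) / 2" for m and t :: real
    by (simp_all add: sin_add cos_add sin_diff cos_diff algebra_simps)
  show "orthogonal_to_trig (\<lambda>t. u t * cos t)" "orthogonal_to_trig (\<lambda>t. u t * sin t)"
    unfolding orthogonal_to_trig_def mult.assoc 1 I_def[symmetric]
    by (intro conjI allI z continuous_intros cu)+
qed

lemma orthogonal_to_trig_polynomial:
  assumes "real_polynomial_function p" "orthogonal_to_trig u"
  shows "orthogonal_to_trig (\<lambda>t. u t * p (cis t))"
  using assms
proof (induction arbitrary: u)
  case (linear f)
  interpret bounded_linear f by fact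
  have "f (cis t) = cos t * f 1 + sin t * f \<i>" for t
  proof -
    have "cis t = cos t *\<^sub>R 1 + sin t *\<^sub>R \<i>" by (simp add: complex_eq_iff)
    then show ?thesis by (simp only: add scaleR real_scaleR_def)
  qed
  then have "(\<lambda>t. u t * f (cis t)) = (\<lambda>t. f 1 * (u t * cos t) + f \<i> * (u t * sin t))"
    by (simp add: algebra_simps)
  then show ?case
    using orthogonal_to_trig_linear[OF orthogonal_to_trig_mult[OF linear.prems], of "f 1" "f \<i>"] by simp
next
  case (const c)
  then show ?case using orthogonal_to_trig_linear[OF const.prems const.prems, of c 0] by (simp add: mult.commute)
next
  case (add f g)
  then show ?case
    using orthogonal_to_trig_linear[OF add.IH(1)[OF add.prems] add.IH(2)[OF add.prems], of 1 1]
    by (simp add: algebra_simps)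
next
  case (mult f g)
  then show ?case using mult.IH(2)[OF mult.IH(1)[OF mult.prems]] by (simp add: mult.assoc)
qed

text \<open>
  The two branches of the argument jump at opposite half-axes, and a function with period \<open>2 * pi\<close>
  does not distinguish them.
\<close>

lemma periodic_factors_through_circle:
  fixes g :: "real \<Rightarrow> real"
  assumes "continuous_on UNIV g" and per: "\<And>t. g (t + 2 * pi) = g t"
  obtains G where "continuous_on (sphere 0 1) G" "\<And>t. G (cis t) = g t"
proof -
  have per_int: "g (t + 2 * pi * of_int n) = g t" for t n
    using periodic_shift_int[of g "2 * pi" t n, OF per] by (simp add: mult.commute)
  have cis: "g a = g b" if "cis a = cis b" for a b
  proof -
    have "sin a = sin b \<and> cos a = cos b" using that by (simp add: complex_eq_iff)
    then obtain n :: int where "a = b + 2 * pi * of_int n"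
      unfolding sin_cos_eq_iff by (auto simp: algebra_simps)
    then show ?thesis using per_int by simp
  qed
  have gc: "isCont g t" for t using assms(1) by (simp add: continuous_on_eq_continuous_at)
  have pi2: "g (Arg2pi w) = g (Arg w)" if "w \<noteq> 0" for w
  proof (rule cis)
    have "w = of_real (norm w) * cis (Arg2pi w)" using Arg2pi_eq[of w] by (simp add: cis_conv_exp mult.commute)
    moreover have "w = of_real (norm w) * cis (Arg w)" using Arg_eq[OF that] by (simp add: cis_conv_exp mult.commute)
    ultimately have "of_real (norm w) * cis (Arg2pi w) = of_real (norm w) * cis (Arg w)" by metis
    then show "cis (Arg2pi w) = cis (Arg w)" using that by simp
  qed
  show ?thesis
  proof (rule that[of "\<lambda>w. g (Arg w)"])
    show "continuous_on (sphere 0 1) (\<lambda>w. g (Arg w))"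
    proof (intro continuous_at_imp_continuous_on ballI)
      fix w :: complex assume w: "w \<in> sphere 0 1"
      show "isCont (\<lambda>w. g (Arg w)) w"
      proof (cases "w \<in> \<real>\<^sub>\<le>\<^sub>0")
        case False
        then show ?thesis by (intro isCont_o2[OF continuous_at_Arg gc])
      next
        case True
        then have "w \<notin> \<real>\<^sub>\<ge>\<^sub>0" using w by (auto simp: nonneg_Reals_def nonpos_Reals_def)
        then have *: "isCont (\<lambda>w. g (Arg2pi w)) w" by (intro isCont_o2[OF continuous_at_Arg2pi gc])
        have "w \<noteq> 0" using w by auto
        then have "\<forall>\<^sub>F v in nhds w. g (Arg2pi v) = g (Arg v)"
          by (rule eventually_mono[OF t1_space_nhds pi2])
        from isCont_cong[OF this] show ?thesis using * by (rule iffD1)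
      qed
    qed
    show "g (Arg (cis t)) = g t" for t
      using cis_Arg[of "cis t"] by (intro cis) (simp add: sgn_div_norm)
  qed
qed

text \<open>
  A function that is orthogonal to all frequencies is orthogonal to its products with polynomials on
  the circle. By the Weierstrass theorem such polynomials approximate the function itself, so its
  square has integral zero.
\<close>

theorem fourier_complete:
  fixes g :: "real \<Rightarrow> real"
  assumes cont: "continuous_on UNIV g" and per: "\<And>t. g (t + 2 * pi) = g t"
    and zero: "\<And>j. integral {0..2 * pi} (\<lambda>t. g t * trig j t) = 0"
  shows "g t = 0"
proof -
  have cg: "continuous_on S g" for S using cont continuous_on_subset by blast
  have o: "orthogonal_to_trig g"
    unfolding orthogonal_to_trig_def
  proof (intro conjI allI cont)
    fix m :: int
    have "cos (of_int m * t) = trig \<bar>m\<bar> t" for t by (simp add: trig_def abs_if)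
    then show "integral {0..2 * pi} (\<lambda>t. g t * cos (of_int m * t)) = 0" using zero[of "\<bar>m\<bar>"] by simp
    have "sin (of_int m * t) = - sgn (of_int m) * trig (- \<bar>m\<bar>) t" for t by (auto simp: trig_def abs_if sgn_if)
    then have "(\<lambda>t. g t * sin (of_int m * t)) = (\<lambda>t. - sgn (of_int m) * (g t * trig (- \<bar>m\<bar>) t))" by auto
    then show "integral {0..2 * pi} (\<lambda>t. g t * sin (of_int m * t)) = 0" using zero[of "- \<bar>m\<bar>"] by (simp only: integral_mult_right mult_zero_right)
  qed
  obtain G where G: "continuous_on (sphere 0 1) G" "\<And>t. G (cis t) = g t"
    using periodic_factors_through_circle[OF cont per] by blast
  have "integral {0..2 * pi} (\<lambda>t. g t * g t) \<le> 0 + e" if "e > 0" for e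
  proof -
    define M where "M = integral {0..2 * pi} (\<lambda>t. \<bar>g t\<bar>)"
    have M: "M \<ge> 0" unfolding M_def
      by (rule integral_nonneg) (auto intro!: integrable_continuous_real continuous_intros cg)
    define d where "d = e / (M + 1)"
    have d: "d > 0" using that M by (simp add: d_def)
    obtain p where p: "real_polynomial_function p" "\<And>x. x \<in> sphere 0 1 \<Longrightarrow> \<bar>G x - p x\<bar> < d"
      using Stone_Weierstrass_real_polynomial_function[OF compact_sphere G(1) d] by blast
    have po: "orthogonal_to_trig (\<lambda>t. g t * p (cis t))" by (rule orthogonal_to_trig_polynomial[OF p(1) o])
    then have cp: "continuous_on S (\<lambda>t. g t * p (cis t))" for S
      by (auto simp: orthogonal_to_trig_def intro: continuous_on_subset)
    have "integral {0..2 * pi} (\<lambda>t. g t * p (cis t) * cos (of_int 0 * t)) = 0"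
      using po unfolding orthogonal_to_trig_def by blast
    then have 0: "integral {0..2 * pi} (\<lambda>t. g t * p (cis t)) = 0" by simp
    have "integral {0..2 * pi} (\<lambda>t. g t * g t) = integral {0..2 * pi} (\<lambda>t. g t * g t - g t * p (cis t))"
      by (subst integral_diff) (auto intro!: integrable_continuous_real continuous_intros cg cp simp: 0)
    also have "\<dots> \<le> integral {0..2 * pi} (\<lambda>t. d * \<bar>g t\<bar>)"
    proof (rule integral_le)
      show "g t * g t - g t * p (cis t) \<le> d * \<bar>g t\<bar>" for t
      proof -
        have "g t * (g t - p (cis t)) \<le> \<bar>g t\<bar> * \<bar>g t - p (cis t)\<bar>" by (metis abs_ge_self abs_mult)
        also have "\<dots> \<le> \<bar>g t\<bar> * d" using p(2)[of "cis t"] G(2)[of t] by (intro mult_left_mono) auto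
        finally show ?thesis by (simp add: algebra_simps)
      qed
    qed (auto intro!: integrable_continuous_real continuous_intros cg cp)
    also have "\<dots> = d * M" by (simp add: M_def)
    also have "\<dots> \<le> e" using that M by (simp add: d_def field_simps)
    finally show ?thesis by simp
  qed
  then have "integral {0..2 * pi} (\<lambda>t. g t * g t) \<le> 0" by (rule field_le_epsilon)
  moreover have "integral {0..2 * pi} (\<lambda>t. g t * g t) \<ge> 0"
    by (rule integral_nonneg) (auto intro!: integrable_continuous_real continuous_intros cg)
  ultimately have "integral {0..2 * pi} (\<lambda>t. g t * g t) = 0" by linarith
  then have z: "\<forall>t\<in>{0..2 * pi}. g t * g t = 0"
    by (subst (asm) integral_eq_0_iff) (auto intro!: continuous_intros cg)
  obtain t' where "0 \<le> t'" "t' < 0 + 2 * pi" "g t' = g t"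
    using periodic_reduce[of g "2 * pi" 0 t, OF per] pi_gt_zero by auto
  then show ?thesis using z by auto
qed

section \<open>Smooth functions of one variable\<close>

definition smooth1 :: "(real \<Rightarrow> real) \<Rightarrow> bool" where
  "smooth1 f \<longleftrightarrow> (\<forall>n s. (deriv ^^ n) f differentiable (at s))"

text \<open>
  Smoothness in recursive form, which makes the closure properties accessible to induction.
\<close>

primrec times_differentiable :: "nat \<Rightarrow> (real \<Rightarrow> real) \<Rightarrow> bool" where
  "times_differentiable 0 f \<longleftrightarrow> True"
| "times_differentiable (Suc n) f \<longleftrightarrow> (\<exists>f'. (\<forall>s. (f has_real_derivative f' s) (at s)) \<and> times_differentiable n f')"

lemma times_differentiable_SucI:
  assumes "\<And>s. (f has_real_derivative f' s) (at s)" "times_differentiable n f'"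
  shows "times_differentiable (Suc n) f"
  unfolding times_differentiable.simps by (intro exI[of _ f'] conjI allI assms)

lemma times_differentiable_Suc_deriv:
  "times_differentiable (Suc n) f \<longleftrightarrow> (\<forall>s. f differentiable (at s)) \<and> times_differentiable n (deriv f)"
proof
  assume "times_differentiable (Suc n) f"
  then obtain f' where f': "\<And>s. (f has_real_derivative f' s) (at s)" "times_differentiable n f'" by auto
  then have "deriv f = f'" by (auto intro: DERIV_imp_deriv)
  then show "(\<forall>s. f differentiable (at s)) \<and> times_differentiable n (deriv f)"
    using f' real_differentiable_def by blast
next
  assume *: "(\<forall>s. f differentiable (at s)) \<and> times_differentiable n (deriv f)"
  then have "(f has_real_derivative deriv f s) (at s)" for s
    using DERIV_deriv_iff_real_differentiable by blast
  then show "times_differentiable (Suc n) f" using * by auto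
qed

lemma smooth1_iff: "smooth1 f \<longleftrightarrow> (\<forall>n. times_differentiable n f)"
proof
  show "\<forall>n. times_differentiable n f" if "smooth1 f"
  proof
    fix n show "times_differentiable n f"
      using that
    proof (induction n arbitrary: f)
      case (Suc n)
      have "smooth1 (deriv f)"
        using Suc.prems unfolding smooth1_def by (metis comp_apply funpow_Suc_right)
      moreover have "f differentiable (at s)" for s
        using Suc.prems unfolding smooth1_def by (metis funpow_0)
      ultimately show ?case unfolding times_differentiable_Suc_deriv using Suc.IH by blast
    qed simp
  qed
  show "smooth1 f" if "\<forall>n. times_differentiable n f"
  proof -
    have "times_differentiable n ((deriv ^^ k) f)" for n k
    proof (induction k arbitrary: n)
      case (Suc k)
      have "times_differentiable (Suc n) ((deriv ^^ k) f)" by (rule Suc.IH)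
      then show ?case unfolding times_differentiable_Suc_deriv by simp
    qed (use that in simp)
    then show ?thesis unfolding smooth1_def by (metis times_differentiable_Suc_deriv)
  qed
qed

lemma smooth1_DERIV: "smooth1 f \<Longrightarrow> (f has_real_derivative deriv f s) (at s)"
  unfolding smooth1_def by (metis DERIV_deriv_iff_real_differentiable funpow_0)

lemma smooth1_deriv: "smooth1 f \<Longrightarrow> smooth1 (deriv f)"
  unfolding smooth1_iff by (metis times_differentiable_Suc_deriv)

lemma smooth1_cont: "smooth1 f \<Longrightarrow> continuous_on S f"
  by (meson smooth1_DERIV DERIV_isCont continuous_at_imp_continuous_on)

lemma times_differentiable_lower: "times_differentiable (Suc n) f \<Longrightarrow> times_differentiable n f"
proof (induction n arbitrary: f)
  case (Suc n)
  then obtain f' where f': "\<And>s. (f has_real_derivative f' s) (at s)" "times_differentiable (Suc n) f'" by auto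
  then show ?case using Suc.IH by auto
qed simp

lemma times_differentiable_const: "times_differentiable n (\<lambda>_. c)"
proof (induction n arbitrary: c)
  case (Suc n) then show ?case by (auto intro!: exI[of _ "\<lambda>_. 0"])
qed simp

lemma times_differentiable_add:
  "times_differentiable n f \<Longrightarrow> times_differentiable n g \<Longrightarrow> times_differentiable n (\<lambda>s. f s + g s)"
proof (induction n arbitrary: f g)
  case (Suc n)
  from Suc.prems obtain f' g' where *: "\<And>s. (f has_real_derivative f' s) (at s)" "times_differentiable n f'"
    "\<And>s. (g has_real_derivative g' s) (at s)" "times_differentiable n g'" by auto
  then show ?case using Suc.IH[OF *(2,4)] by (auto intro!: exI[of _ "\<lambda>s. f' s + g' s"] derivative_eq_intros)
qed simp

lemma times_differentiable_mult:
  "times_differentiable n f \<Longrightarrow> times_differentiable n g \<Longrightarrow> times_differentiable n (\<lambda>s. f s * g s)"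
proof (induction n arbitrary: f g)
  case (Suc n)
  from Suc.prems obtain f' g' where *: "\<And>s. (f has_real_derivative f' s) (at s)" "times_differentiable n f'"
    "\<And>s. (g has_real_derivative g' s) (at s)" "times_differentiable n g'" by auto
  have "times_differentiable n (\<lambda>s. f' s * g s + g' s * f s)"
    by (intro times_differentiable_add Suc.IH * Suc.prems[THEN times_differentiable_lower])
  then show ?case using * by (auto intro!: exI[of _ "\<lambda>s. f' s * g s + g' s * f s"] derivative_eq_intros)
qed simp

lemma times_differentiable_exp: "times_differentiable n f \<Longrightarrow> times_differentiable n (\<lambda>s. exp (f s))"
proof (induction n arbitrary: f)
  case (Suc n)
  from Suc.prems obtain f' where *: "\<And>s. (f has_real_derivative f' s) (at s)" "times_differentiable n f'" by auto
  have "times_differentiable n (\<lambda>s. exp (f s) * f' s)"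
    by (intro times_differentiable_mult Suc.IH * Suc.prems[THEN times_differentiable_lower])
  then show ?case using * by (auto intro!: exI[of _ "\<lambda>s. exp (f s) * f' s"] derivative_eq_intros)
qed simp

lemma times_differentiable_inverse:
  assumes "times_differentiable n f" "\<And>s. f s \<noteq> 0" shows "times_differentiable n (\<lambda>s. inverse (f s))"
  using assms(1)
proof (induction n)
  case (Suc n)
  from Suc.prems obtain f' where *: "\<And>s. (f has_real_derivative f' s) (at s)" "times_differentiable n f'" by auto
  have "times_differentiable n (\<lambda>s. (-1) * (inverse (f s) * f' s * inverse (f s)))"
    by (intro times_differentiable_mult times_differentiable_const Suc.IH * Suc.prems[THEN times_differentiable_lower])
  moreover have "((\<lambda>s. inverse (f s)) has_real_derivative (-1) * (inverse (f s) * f' s * inverse (f s))) (at s)" for s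
    using DERIV_inverse'[OF *(1) assms(2), of s] by simp
  ultimately show ?case unfolding times_differentiable.simps by (intro exI conjI allI)
qed simp

lemma times_differentiable_sqrt:
  assumes "times_differentiable n f" "\<And>s. f s > 0" shows "times_differentiable n (\<lambda>s. sqrt (f s))"
  using assms(1)
proof (induction n)
  case (Suc n)
  from Suc.prems obtain f' where *: "\<And>s. (f has_real_derivative f' s) (at s)" "times_differentiable n f'" by auto
  have nz: "sqrt (f s) \<noteq> 0" for s using assms(2)[of s] by simp
  have "times_differentiable n (\<lambda>s. 1 / 2 * (f' s * inverse (sqrt (f s))))"
    by (intro times_differentiable_mult times_differentiable_const times_differentiable_inverse nz Suc.IH *
        Suc.prems[THEN times_differentiable_lower])
  moreover have "((\<lambda>s. sqrt (f s)) has_real_derivative 1 / 2 * (f' s * inverse (sqrt (f s)))) (at s)" for s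
    using DERIV_chain2[OF DERIV_real_sqrt[OF assms(2)] *(1), of s] by (simp add: field_simps)
  ultimately show ?case unfolding times_differentiable.simps by (intro exI conjI allI)
qed simp

lemma smooth1_const: "smooth1 (\<lambda>_. c)"
  by (simp add: smooth1_iff times_differentiable_const)

lemma smooth1_add: "smooth1 f \<Longrightarrow> smooth1 g \<Longrightarrow> smooth1 (\<lambda>s. f s + g s)"
  by (simp add: smooth1_iff times_differentiable_add)

lemma smooth1_mult: "smooth1 f \<Longrightarrow> smooth1 g \<Longrightarrow> smooth1 (\<lambda>s. f s * g s)"
  by (simp add: smooth1_iff times_differentiable_mult)

lemma smooth1_diff: "smooth1 f \<Longrightarrow> smooth1 g \<Longrightarrow> smooth1 (\<lambda>s. f s - g s)"
  using smooth1_add[of f "\<lambda>s. (-1) * g s"] smooth1_mult[OF smooth1_const[of "-1"], of g] by simp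

lemma smooth1_minus: "smooth1 f \<Longrightarrow> smooth1 (\<lambda>s. - f s)"
  using smooth1_mult[OF smooth1_const[of "-1"], of f] by simp

lemma smooth1_exp: "smooth1 f \<Longrightarrow> smooth1 (\<lambda>s. exp (f s))"
  by (simp add: smooth1_iff times_differentiable_exp)

lemma smooth1_inverse: "smooth1 f \<Longrightarrow> (\<And>s. f s \<noteq> 0) \<Longrightarrow> smooth1 (\<lambda>s. inverse (f s))"
  by (simp add: smooth1_iff times_differentiable_inverse)

lemma smooth1_divide: "smooth1 f \<Longrightarrow> smooth1 g \<Longrightarrow> (\<And>s. g s \<noteq> 0) \<Longrightarrow> smooth1 (\<lambda>s. f s / g s)"
  unfolding divide_inverse by (intro smooth1_mult smooth1_inverse)

lemma smooth1_sqrt: "smooth1 f \<Longrightarrow> (\<And>s. f s > 0) \<Longrightarrow> smooth1 (\<lambda>s. sqrt (f s))"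
  by (simp add: smooth1_iff times_differentiable_sqrt)

lemma smooth1_power2: "smooth1 f \<Longrightarrow> smooth1 (\<lambda>s. (f s)\<^sup>2)"
  unfolding power2_eq_square by (rule smooth1_mult)

lemmas smooth1_intros = smooth1_const smooth1_add smooth1_mult smooth1_diff smooth1_minus smooth1_exp
  smooth1_divide smooth1_sqrt smooth1_power2

text \<open>Solutions of a linear system gain one derivative from each equation.\<close>

lemma linear_system_smooth:
  assumes y: "\<And>s. (y has_real_derivative a s * p s) (at s)" and p: "\<And>s. (p has_real_derivative b s * y s) (at s)"
    and "smooth1 a" "smooth1 b"
  shows "smooth1 y" "smooth1 p"
proof -
  have "times_differentiable n y \<and> times_differentiable n p" for n
  proof (induction n)
    case (Suc n)
    then have "times_differentiable n (\<lambda>s. a s * p s)" "times_differentiable n (\<lambda>s. b s * y s)"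
      using assms(3,4) by (auto intro: times_differentiable_mult simp: smooth1_iff)
    then show ?case by (intro conjI times_differentiable_SucI[OF y] times_differentiable_SucI[OF p])
  qed simp
  then show "smooth1 y" "smooth1 p" by (simp_all add: smooth1_iff)
qed

section \<open>Partial derivatives\<close>

lemma pd_eqI: "((\<lambda>t. f (p + t *\<^sub>R axis i 1)) has_vector_derivative D) (at 0) \<Longrightarrow> pd i f p = D"
  unfolding pd_def by (rule vector_derivative_at)

lemma pd_eqI_real: "((\<lambda>t. f (p + t *\<^sub>R axis i 1)) has_real_derivative D) (at 0) \<Longrightarrow> pd i f p = D"
  by (rule pd_eqI) (simp add: has_real_derivative_iff_has_vector_derivative)

lemma pd_has_vector_derivative:
  assumes "f differentiable (at p)"
  shows "((\<lambda>t. f (p + t *\<^sub>R axis i 1)) has_vector_derivative pd i f p) (at 0)"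
proof -
  obtain D where D: "(f has_derivative D) (at p)" using assms by (auto simp: differentiable_def)
  have "((\<lambda>t. p + t *\<^sub>R axis i (1::real)) has_derivative (\<lambda>t. t *\<^sub>R axis i 1)) (at 0)"
    by (auto intro!: derivative_eq_intros)
  from diff_chain_at[OF this, of f D] D
  have "((\<lambda>t. f (p + t *\<^sub>R axis i 1)) has_derivative (\<lambda>t. D (t *\<^sub>R axis i 1))) (at 0)"
    by (simp add: o_def)
  moreover have "D (t *\<^sub>R axis i 1) = t *\<^sub>R D (axis i 1)" for t
    using has_derivative_linear[OF D] by (simp add: linear_cmul)
  ultimately have "((\<lambda>t. f (p + t *\<^sub>R axis i 1)) has_vector_derivative D (axis i 1)) (at 0)"
    by (simp add: has_vector_derivative_def)
  then show ?thesis using pd_eqI by metis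
qed

lemma pd_has_real_derivative:
  "f differentiable (at p) \<Longrightarrow> ((\<lambda>t. f (p + t *\<^sub>R axis i 1)) has_real_derivative pd i f p) (at 0)"
  by (simp add: pd_has_vector_derivative has_real_derivative_iff_has_vector_derivative)

lemma axis_nth_2 [simp]:
  "axis (1::2) (x::real) $ 1 = x" "axis (1::2) (x::real) $ 2 = 0"
  "axis (2::2) (x::real) $ 1 = 0" "axis (2::2) (x::real) $ 2 = x"
  by (simp_all add: axis_def)

lemma vector2_shift:
  "vector [s, t] + h *\<^sub>R axis (1::2) 1 = (vector [s + h, t] :: real^2)"
  "vector [s, t] + h *\<^sub>R axis (2::2) 1 = (vector [s, t + h] :: real^2)"
  by (simp_all add: vec_eq_iff forall_2)

lemma vector2_eta: "vector [p $ 1, p $ 2] = (p :: real^2)"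
  by (simp add: vec_eq_iff forall_2)

lemma pd_slice:
  assumes "\<And>p. f differentiable (at p)"
  shows "((\<lambda>s. f (vector [s, t])) has_real_derivative pd 1 f (vector [s, t])) (at s)"
    and "((\<lambda>t. f (vector [s, t])) has_real_derivative pd 2 f (vector [s, t])) (at t)"
proof -
  have "((\<lambda>h. f (vector [s + h, t])) has_real_derivative pd 1 f (vector [s, t])) (at 0)"
    "((\<lambda>h. f (vector [s, t + h])) has_real_derivative pd 2 f (vector [s, t])) (at 0)"
    by (rule pd_has_real_derivative[OF assms, of "vector [s, t]", where i=1, unfolded vector2_shift]
        pd_has_real_derivative[OF assms, of "vector [s, t]", where i=2, unfolded vector2_shift])+
  then show "((\<lambda>s. f (vector [s, t])) has_real_derivative pd 1 f (vector [s, t])) (at s)"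
    "((\<lambda>t. f (vector [s, t])) has_real_derivative pd 2 f (vector [s, t])) (at t)"
    using DERIV_shift[of "\<lambda>s. f (vector [s, t])" _ 0 s] DERIV_shift[of "\<lambda>t. f (vector [s, t])" _ 0 t]
    by (simp_all add: add.commute)
qed

lemma pd_mult_left:
  assumes h: "(h has_real_derivative h') (at (p $ 1))" and F: "F differentiable (at p)"
  shows "pd 1 (\<lambda>q. h (q $ 1) * F q) p = h' * F p + h (p $ 1) * pd 1 F p"
    and "pd 2 (\<lambda>q. h (q $ 1) * F q) p = h (p $ 1) * pd 2 F p"
proof -
  have "((\<lambda>t. h (p $ 1 + t)) has_real_derivative h') (at 0)"
    using h by (simp add: DERIV_shift[symmetric] add.commute[of "p $ 1"])
  from DERIV_mult[OF this pd_has_real_derivative[OF F]]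
  show "pd 1 (\<lambda>q. h (q $ 1) * F q) p = h' * F p + h (p $ 1) * pd 1 F p"
    by (intro pd_eqI_real) (simp add: mult.commute)
  have "((\<lambda>t. h (p $ 1) * F (p + t *\<^sub>R axis 2 1)) has_real_derivative h (p $ 1) * pd 2 F p) (at 0)"
    by (rule DERIV_cmult[OF pd_has_real_derivative[OF F]])
  then show "pd 2 (\<lambda>q. h (q $ 1) * F q) p = h (p $ 1) * pd 2 F p"
    by (intro pd_eqI_real) simp
qed

lemma differentiable_nth: "(\<lambda>q::real^2. q $ i) differentiable (at p)"
  by (simp add: bounded_linear_imp_differentiable bounded_linear_vec_nth)

lemma product_differentiable:
  assumes "smooth1 u" "smooth1 g"
  shows "(\<lambda>q::real^2. u (q $ 1) * g (q $ 2)) differentiable (at p)"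
proof -
  have "(\<lambda>q::real^2. u (q $ 1)) differentiable (at p)"
    by (rule differentiable_compose[OF _ differentiable_nth])
      (use smooth1_DERIV[OF assms(1)] real_differentiable_def in blast)
  moreover have "(\<lambda>q::real^2. g (q $ 2)) differentiable (at p)"
    by (rule differentiable_compose[OF _ differentiable_nth])
      (use smooth1_DERIV[OF assms(2)] real_differentiable_def in blast)
  ultimately show ?thesis by (rule differentiable_mult)
qed

lemma pd_product:
  assumes "smooth1 u" "smooth1 g"
  shows "pd 1 (\<lambda>q. u (q $ 1) * g (q $ 2)) = (\<lambda>q. deriv u (q $ 1) * g (q $ 2))"
    and "pd 2 (\<lambda>q. u (q $ 1) * g (q $ 2)) = (\<lambda>q. u (q $ 1) * deriv g (q $ 2))"
proof -
  have s: "((\<lambda>t. h (a + t)) has_real_derivative deriv h a) (at 0)" if "smooth1 h" for h a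
    using smooth1_DERIV[OF that, of a] by (simp add: DERIV_shift[symmetric] add.commute[of a])
  show "pd 1 (\<lambda>q. u (q $ 1) * g (q $ 2)) = (\<lambda>q. deriv u (q $ 1) * g (q $ 2))"
    by (rule ext, rule pd_eqI_real) (auto intro!: derivative_eq_intros s assms)
  show "pd 2 (\<lambda>q. u (q $ 1) * g (q $ 2)) = (\<lambda>q. u (q $ 1) * deriv g (q $ 2))"
    by (rule ext, rule pd_eqI_real) (auto intro!: derivative_eq_intros s assms)
qed

text \<open>
  Partial derivatives of all orders stay products of functions of a single coordinate.
\<close>

lemma smooth_product:
  assumes "smooth1 u" "smooth1 g" shows "smooth (\<lambda>q. u (q $ 1) * g (q $ 2))"
proof -
  have "\<exists>u' g'. smooth1 u' \<and> smooth1 g' \<and> foldr pd is (\<lambda>q. u (q $ 1) * g (q $ 2)) = (\<lambda>q. u' (q $ 1) * g' (q $ 2))" for "is"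
  proof (induction "is")
    case Nil then show ?case using assms by auto
  next
    case (Cons i "is")
    then obtain u' g' where *: "smooth1 u'" "smooth1 g'" "foldr pd is (\<lambda>q. u (q $ 1) * g (q $ 2)) = (\<lambda>q. u' (q $ 1) * g' (q $ 2))"
      by blast
    show ?case
      using exhaust_2[of i] pd_product[OF *(1,2)] smooth1_deriv *(1,2) by (auto simp: *(3))
  qed
  then show ?thesis unfolding smooth_def using product_differentiable by metis
qed

lemma smooth_pd: "smooth f \<Longrightarrow> smooth (pd i f)"
  unfolding smooth_def
proof (intro allI)
  fix "is" p assume "\<forall>is p. foldr pd is f differentiable (at p)"
  then have "foldr pd (is @ [i]) f differentiable (at p)" by blast
  then show "foldr pd is (pd i f) differentiable (at p)" by simp
qed

lemma smooth_differentiable: "smooth f \<Longrightarrow> f differentiable (at p)"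
  unfolding smooth_def by (drule spec[of _ "[]"]) simp

lemma smooth_continuous_slice: "smooth f \<Longrightarrow> continuous_on S (\<lambda>(s, t). f (vector [s, t]))"
proof -
  assume "smooth f"
  then have f: "continuous_on UNIV f"
    using smooth_differentiable differentiable_imp_continuous_within continuous_at_imp_continuous_on by blast
  have "vector [s, t] = s *\<^sub>R axis 1 1 + t *\<^sub>R axis (2::2) (1::real)" for s t
    by (simp add: vec_eq_iff forall_2)
  then have "continuous_on S (\<lambda>(s, t). vector [s, t] :: real^2)"
    by (auto simp: case_prod_beta intro!: continuous_intros)
  from continuous_on_compose2[OF f this] show ?thesis by (simp add: case_prod_beta)
qed

section \<open>Diagonal two-by-two matrices\<close>

definition diag2 :: "real \<Rightarrow> real \<Rightarrow> real^2^2" where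
  "diag2 a b = (\<chi> i j. if i = j then (if i = 1 then a else b) else 0)"

lemma diag2_nth [simp]: "diag2 a b $ 1 $ 1 = a" "diag2 a b $ 1 $ 2 = 0" "diag2 a b $ 2 $ 1 = 0" "diag2 a b $ 2 $ 2 = b"
  by (simp_all add: diag2_def)

lemma diag2_mult: "diag2 a b ** diag2 c d = diag2 (a * c) (b * d)"
  by (simp add: vec_eq_iff forall_2 matrix_matrix_mult_def sum_2)

lemma diag2_one: "diag2 1 1 = mat 1"
  by (simp add: vec_eq_iff forall_2 mat_def)

lemma matrix_inv_diag2: "a \<noteq> 0 \<Longrightarrow> b \<noteq> 0 \<Longrightarrow> matrix_inv (diag2 a b) = diag2 (1 / a) (1 / b)"
proof -
  assume "a \<noteq> 0" "b \<noteq> 0"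
  then have l: "diag2 a b ** diag2 (1 / a) (1 / b) = mat 1" and r: "diag2 (1 / a) (1 / b) ** diag2 a b = mat 1"
    by (simp_all add: diag2_mult diag2_one)
  have "diag2 a b ** matrix_inv (diag2 a b) = mat 1 \<and> matrix_inv (diag2 a b) ** diag2 a b = mat 1"
    unfolding matrix_inv_def by (rule someI[of _ "diag2 (1 / a) (1 / b)"]) (simp add: l r)
  then show ?thesis by (metis r matrix_mul_assoc matrix_mul_lid matrix_mul_rid)
qed

lemma det_diag2: "det (diag2 a b) = a * b"
  by (simp add: det_2)

lemma trace_diag2: "trace (diag2 a b) = a + b"
  by (simp add: trace_def sum_2)

lemma diag2_vector: "(diag2 a b *v x) $ 1 = a * x $ 1" "(diag2 a b *v x) $ 2 = b * x $ 2"
  by (simp_all add: matrix_vector_mult_def sum_2)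

section \<open>Surfaces of revolution\<close>

text \<open>The derivative of a surface of revolution with respect to the angle of rotation.\<close>

definition rotate_tangent :: "(real \<Rightarrow> real) \<Rightarrow> real^2 \<Rightarrow> real^3" where
  "rotate_tangent a p = vector [- a (p $ 1) * sin (p $ 2), a (p $ 1) * cos (p $ 2), 0]"

lemma has_vector_derivative_vector3:
  assumes "(a has_real_derivative a') (at t)" "(b has_real_derivative b') (at t)" "(c has_real_derivative c') (at t)"
  shows "((\<lambda>t. vector [a t, b t, c t] :: real^3) has_vector_derivative vector [a', b', c']) (at t)"
proof -
  have v: "vector [x, y, w] = x *\<^sub>R axis 1 1 + y *\<^sub>R axis 2 1 + w *\<^sub>R axis (3::3) (1::real)" for x y w :: real
    by (simp add: vec_eq_iff forall_3 axis_def)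
  show ?thesis
    unfolding v
    using assms by (intro has_vector_derivative_add has_vector_derivative_scaleR[where g="\<lambda>_. axis _ _" and g'=0, simplified]) auto
qed

lemma shift_deriv: "(h has_real_derivative h') (at a) \<Longrightarrow> ((\<lambda>t. h (a + t)) has_real_derivative h') (at 0)"
  for a :: real
  by (simp add: DERIV_shift[symmetric] add.commute[of a])

lemma pd_revolve:
  assumes "\<And>s. (a has_real_derivative a' s) (at s)" "\<And>s. (b has_real_derivative b' s) (at s)"
  shows "pd 1 (revolve a b) = revolve a' b'" "pd 2 (revolve a b) = rotate_tangent a"
proof -
  note d = shift_deriv[OF assms(1)] shift_deriv[OF assms(2)]
  show "pd 1 (revolve a b) = revolve a' b'"
    unfolding revolve_def[abs_def]
    by (rule ext, rule pd_eqI, rule has_vector_derivative_vector3) (auto intro!: derivative_eq_intros d)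
  show "pd 2 (revolve a b) = rotate_tangent a"
    unfolding revolve_def[abs_def] rotate_tangent_def[abs_def]
    by (rule ext, rule pd_eqI, rule has_vector_derivative_vector3) (auto intro!: derivative_eq_intros)
qed

lemma pd_rotate_tangent:
  assumes "\<And>s. (a has_real_derivative a' s) (at s)"
  shows "pd 1 (rotate_tangent a) = rotate_tangent a'" "pd 2 (rotate_tangent a) = revolve (\<lambda>s. - a s) (\<lambda>_. 0)"
proof -
  note d = shift_deriv[OF assms(1)]
  show "pd 1 (rotate_tangent a) = rotate_tangent a'"
    unfolding rotate_tangent_def[abs_def]
    by (rule ext, rule pd_eqI, rule has_vector_derivative_vector3) (auto intro!: derivative_eq_intros d)
  show "pd 2 (rotate_tangent a) = revolve (\<lambda>s. - a s) (\<lambda>_. 0)"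
    unfolding revolve_def[abs_def] rotate_tangent_def[abs_def]
    by (rule ext, rule pd_eqI, rule has_vector_derivative_vector3) (auto intro!: derivative_eq_intros)
qed

lemma inner3: "(x::real^3) \<bullet> y = x $ 1 * y $ 1 + x $ 2 * y $ 2 + x $ 3 * y $ 3"
  by (simp add: inner_vec_def sum_3)

lemma revolve_nth: "revolve a b p $ 1 = a (p $ 1) * cos (p $ 2)" "revolve a b p $ 2 = a (p $ 1) * sin (p $ 2)"
    "revolve a b p $ 3 = b (p $ 1)"
  and rotate_tangent_nth: "rotate_tangent a p $ 1 = - a (p $ 1) * sin (p $ 2)"
    "rotate_tangent a p $ 2 = a (p $ 1) * cos (p $ 2)" "rotate_tangent a p $ 3 = 0"
  by (simp_all add: revolve_def rotate_tangent_def)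

lemma sin_cos_sq: "sin t * sin t + cos t * cos t = (1::real)"
  using sin_cos_squared_add[of t] by (simp add: power2_eq_square)

lemma inner_revolve:
  "revolve a b p \<bullet> revolve c d p = a (p $ 1) * c (p $ 1) + b (p $ 1) * d (p $ 1)"
  "revolve a b p \<bullet> rotate_tangent c p = 0" "rotate_tangent c p \<bullet> revolve a b p = 0"
  "rotate_tangent a p \<bullet> rotate_tangent c p = a (p $ 1) * c (p $ 1)"
  unfolding inner3 revolve_nth rotate_tangent_nth
  using sin_cos_sq[of "p $ 2"] by algebra+

lemma cross_revolve:
  "cross3 (revolve a b p) (rotate_tangent c p) = c (p $ 1) *\<^sub>R revolve (\<lambda>s. - b s) a p"
proof -
  have "a (p $ 1) * cos (p $ 2) * (c (p $ 1) * cos (p $ 2)) - a (p $ 1) * sin (p $ 2) * (- c (p $ 1) * sin (p $ 2)) = c (p $ 1) * a (p $ 1)"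
    using sin_cos_sq[of "p $ 2"] by algebra
  then show ?thesis
    by (simp add: vec_eq_iff forall_3 cross3_def revolve_nth rotate_tangent_nth algebra_simps)
qed

lemma vec2_eqI: "A $ 1 $ 1 = B $ 1 $ 1 \<Longrightarrow> A $ 1 $ 2 = B $ 1 $ 2 \<Longrightarrow> A $ 2 $ 1 = B $ 2 $ 1 \<Longrightarrow> A $ 2 $ 2 = B $ 2 $ 2 \<Longrightarrow> A = (B :: real^2^2)"
  by (simp add: vec_eq_iff forall_2)

locale profile =
  fixes T :: real and r z :: "real \<Rightarrow> real"
  assumes curve: "closed_halfplane_curve T r z"
begin

definition rd where "rd = deriv r"
definition zd where "zd = deriv z"
definition rdd where "rdd = deriv rd"
definition zdd where "zdd = deriv zd"

lemma T_pos: "T > 0" and r_pos: "r s > 0" and per_r: "r (s + T) = r s" and per_z: "z (s + T) = z s"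
  and regular: "rd s \<noteq> 0 \<or> zd s \<noteq> 0" and smooth_r: "smooth1 r" and smooth_z: "smooth1 z"
  using curve by (auto simp: closed_halfplane_curve_def rd_def zd_def smooth1_def)

lemma smooth_rd: "smooth1 rd" and smooth_zd: "smooth1 zd" and smooth_rdd: "smooth1 rdd" and smooth_zdd: "smooth1 zdd"
  by (auto simp: rd_def zd_def rdd_def zdd_def intro!: smooth1_deriv smooth_r smooth_z)

lemma r_deriv: "(r has_real_derivative rd s) (at s)" and z_deriv: "(z has_real_derivative zd s) (at s)"
  and rd_deriv: "(rd has_real_derivative rdd s) (at s)" and zd_deriv: "(zd has_real_derivative zdd s) (at s)"
  unfolding rd_def zd_def rdd_def zdd_def by (rule smooth1_DERIV smooth1_deriv smooth_r smooth_z)+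

lemma periodic_deriv:
  assumes "\<And>s. (f has_real_derivative f' s) (at s)" "\<And>s. f (s + T) = f s" shows "f' (s + T) = f' s"
proof -
  have "((\<lambda>s. f (s + T)) has_real_derivative f' (s + T)) (at s)"
    using assms(1)[of "s + T"] by (simp add: DERIV_shift)
  then show ?thesis using assms by (simp add: DERIV_unique)
qed

lemma per_rd: "rd (s + T) = rd s" and per_zd: "zd (s + T) = zd s"
  and per_rdd: "rdd (s + T) = rdd s" and per_zdd: "zdd (s + T) = zdd s"
proof -
  show rd: "rd (s + T) = rd s" for s by (rule periodic_deriv[OF r_deriv per_r])
  show zd: "zd (s + T) = zd s" for s by (rule periodic_deriv[OF z_deriv per_z])
  show "rdd (s + T) = rdd s" by (rule periodic_deriv[OF rd_deriv rd])
  show "zdd (s + T) = zdd s" by (rule periodic_deriv[OF zd_deriv zd])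
qed

definition speed :: "real \<Rightarrow> real" where "speed s = sqrt ((rd s)\<^sup>2 + (zd s)\<^sup>2)"

lemma speed_sq_pos: "(rd s)\<^sup>2 + (zd s)\<^sup>2 > 0"
  using regular[of s] by (simp add: sum_power2_gt_zero_iff)

lemma speed_pos: "speed s > 0"
  using speed_sq_pos by (simp add: speed_def)

lemma speed_sq: "(speed s)\<^sup>2 = (rd s)\<^sup>2 + (zd s)\<^sup>2"
  using speed_sq_pos[of s] by (simp add: speed_def)

lemma per_speed: "speed (s + T) = speed s"
  by (simp add: speed_def per_rd per_zd)

lemma smooth_speed: "smooth1 speed"
  unfolding speed_def[abs_def] by (intro smooth1_intros smooth_rd smooth_zd speed_sq_pos)

definition speedd where "speedd s = (rd s * rdd s + zd s * zdd s) / speed s"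

lemma speed_deriv: "(speed has_real_derivative speedd s) (at s)"
proof -
  have "((\<lambda>s. (rd s)\<^sup>2 + (zd s)\<^sup>2) has_real_derivative 2 * (rd s * rdd s + zd s * zdd s)) (at s)"
    by (auto intro!: derivative_eq_intros rd_deriv zd_deriv)
  from DERIV_chain2[OF DERIV_real_sqrt[OF speed_sq_pos] this]
  have "(speed has_real_derivative inverse (sqrt ((rd s)\<^sup>2 + (zd s)\<^sup>2)) / 2 * (2 * (rd s * rdd s + zd s * zdd s))) (at s)"
    unfolding speed_def[abs_def] .
  moreover have "inverse (sqrt ((rd s)\<^sup>2 + (zd s)\<^sup>2)) / 2 * (2 * (rd s * rdd s + zd s * zdd s)) = speedd s"
  proof -
    have "1 / q / 2 * (2 * n) = n / q" for q n :: real by simp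
    then show ?thesis unfolding speedd_def speed_def inverse_eq_divide .
  qed
  ultimately show ?thesis by (simp only:)
qed

abbreviation X where "X \<equiv> revolve r z"

lemma pd_X: "pd 1 X = revolve rd zd" "pd 2 X = rotate_tangent r"
    "pd 1 (revolve rd zd) = revolve rdd zdd" "pd 2 (revolve rd zd) = rotate_tangent rd"
    "pd 1 (rotate_tangent r) = rotate_tangent rd" "pd 2 (rotate_tangent r) = revolve (\<lambda>s. - r s) (\<lambda>_. 0)"
  by (simp_all add: pd_revolve[OF r_deriv z_deriv] pd_revolve[OF rd_deriv zd_deriv] pd_rotate_tangent[OF r_deriv])

lemma metric_X: "metric X p = diag2 ((speed (p $ 1))\<^sup>2) ((r (p $ 1))\<^sup>2)"
  unfolding speed_sq by (rule vec2_eqI) (simp_all add: metric_def pd_X inner_revolve power2_eq_square)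

lemma area_density_X: "area_density X p = speed (p $ 1) * r (p $ 1)"
  using speed_pos[of "p $ 1"] r_pos[of "p $ 1"]
  by (simp add: area_density_def metric_X det_diag2 real_sqrt_mult)

lemma unit_normal_X: "unit_normal X p = revolve (\<lambda>s. - zd s / speed s) (\<lambda>s. rd s / speed s) p"
proof -
  let ?N = "revolve (\<lambda>s. - zd s) rd p"
  have "norm ?N = speed (p $ 1)"
    by (simp add: norm_eq_sqrt_inner inner_revolve speed_def power2_eq_square add.commute)
  moreover have "sgn (r (p $ 1) *\<^sub>R ?N) = sgn ?N"
    using r_pos[of "p $ 1"] by (simp add: sgn_scaleR)
  ultimately have "unit_normal X p = inverse (speed (p $ 1)) *\<^sub>R ?N"
    by (simp add: unit_normal_def pd_X cross_revolve sgn_div_norm)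
  then show ?thesis by (simp add: vec_eq_iff forall_3 revolve_nth field_simps)
qed

definition curv :: "real \<Rightarrow> real" where
  "curv s = (rd s * zdd s - zd s * rdd s) / (speed s) ^ 3"

definition par_curv :: "real \<Rightarrow> real" where
  "par_curv s = zd s / (r s * speed s)"

lemma shape_operator_X: "shape_operator X p = diag2 (curv (p $ 1)) (par_curv (p $ 1))"
proof -
  have v: "speed (p $ 1) \<noteq> 0" "r (p $ 1) \<noteq> 0" using speed_pos[of "p $ 1"] r_pos[of "p $ 1"] by auto
  have "second_form X p = diag2 ((rd (p $ 1) * zdd (p $ 1) - zd (p $ 1) * rdd (p $ 1)) / speed (p $ 1)) (r (p $ 1) * zd (p $ 1) / speed (p $ 1))"
    by (rule vec2_eqI)
      (simp_all add: second_form_def normal_part_def unit_normal_X pd_X inner_revolve diff_divide_distrib mult.commute)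
  then show ?thesis
    using v unfolding shape_operator_def metric_X
    by (simp add: matrix_inv_diag2 diag2_mult curv_def par_curv_def power2_eq_square power3_eq_cube)
qed

lemma mean_curvature_X: "mean_curvature X p = - (curv (p $ 1) + par_curv (p $ 1))"
  by (simp add: mean_curvature_def shape_operator_X trace_diag2)

lemma second_form_norm2_X: "second_form_norm2 X p = (curv (p $ 1))\<^sup>2 + (par_curv (p $ 1))\<^sup>2"
  by (simp add: second_form_norm2_def shape_operator_X diag2_mult trace_diag2 power2_eq_square)

lemma normal_part_X: "normal_part X (X p) p = (z (p $ 1) * rd (p $ 1) - r (p $ 1) * zd (p $ 1)) / speed (p $ 1)"
  by (simp add: normal_part_def unit_normal_X inner_revolve diff_divide_distrib)

lemma self_shrinker_iff:
  "self_shrinker X \<longleftrightarrow> (\<forall>s. - (curv s + par_curv s) = (z s * rd s - r s * zd s) / speed s / 2)"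
proof -
  have "(\<forall>p::real^2. Q (p $ 1)) \<longleftrightarrow> (\<forall>s. Q s)" for Q :: "real \<Rightarrow> bool"
    by (metis vector_2(1))
  from this[of "\<lambda>s. - (curv s + par_curv s) = (z s * rd s - r s * zd s) / speed s / 2"]
  show ?thesis unfolding self_shrinker_def mean_curvature_X normal_part_X .
qed

lemma norm_X: "(norm (X p))\<^sup>2 = (r (p $ 1))\<^sup>2 + (z (p $ 1))\<^sup>2"
  unfolding power2_norm_eq_inner inner_revolve by (simp add: power2_eq_square)

text \<open>
  The length element of the profile in the metric \<open>sigma\<^sup>2 * (dr\<^sup>2 + dz\<^sup>2)\<close> of the half-plane integrates to the
  Gaussian area of the surface.
\<close>

definition sigma :: "real \<Rightarrow> real" where
  "sigma s = r s * exp (- ((r s)\<^sup>2 + (z s)\<^sup>2) / 4) / 2"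

lemma sigma_pos: "sigma s > 0"
  using r_pos by (simp add: sigma_def)

lemma per_sigma: "sigma (s + T) = sigma s"
  by (simp add: sigma_def per_r per_z)

lemma smooth_sigma: "smooth1 sigma"
  unfolding sigma_def[abs_def] by (intro smooth1_intros smooth_r smooth_z) auto

text \<open>The derivative of \<open>ln sigma\<close> with respect to arc length.\<close>

definition eta :: "real \<Rightarrow> real" where
  "eta s = (rd s / r s - (r s * rd s + z s * zd s) / 2) / speed s"

lemma sigma_deriv: "(sigma has_real_derivative sigma s * speed s * eta s) (at s)"
proof -
  have "(sigma has_real_derivative (rd s * exp (- ((r s)\<^sup>2 + (z s)\<^sup>2) / 4)
      + r s * (exp (- ((r s)\<^sup>2 + (z s)\<^sup>2) / 4) * (- (2 * r s * rd s + 2 * z s * zd s) / 4))) / 2) (at s)"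
    unfolding sigma_def[abs_def]
    by (rule derivative_eq_intros r_deriv z_deriv refl | simp add: field_simps)+
  moreover have "(rd s * exp (- ((r s)\<^sup>2 + (z s)\<^sup>2) / 4)
      + r s * (exp (- ((r s)\<^sup>2 + (z s)\<^sup>2) / 4) * (- (2 * r s * rd s + 2 * z s * zd s) / 4))) / 2 = sigma s * speed s * eta s"
    using r_pos[of s] speed_pos[of s] by (simp add: sigma_def eta_def field_simps)
  ultimately show ?thesis by simp
qed

text \<open>The Frenet equation: along a unit tangent, the derivative is the curvature times the normal.\<close>

lemma tangent_deriv:
  "((\<lambda>s. rd s / speed s) has_real_derivative - (curv s * zd s)) (at s)"
  "((\<lambda>s. zd s / speed s) has_real_derivative curv s * rd s) (at s)"
proof -
  have v: "speed s \<noteq> 0" using speed_pos[of s] by simp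
  have v3: "speed s * speed s * speed s = ((rd s)\<^sup>2 + (zd s)\<^sup>2) * speed s" using speed_sq[of s] by (simp add: power2_eq_square)
  have "((\<lambda>s. rd s / speed s) has_real_derivative (rdd s * speed s - rd s * speedd s) / (speed s * speed s)) (at s)"
    by (rule DERIV_divide[OF rd_deriv speed_deriv v])
  moreover have "(rdd s * speed s - rd s * speedd s) / (speed s * speed s)
      = (rdd s * (speed s)\<^sup>2 - rd s * (rd s * rdd s + zd s * zdd s)) / (speed s) ^ 3"
    using v by (simp add: speedd_def power2_eq_square power3_eq_cube field_simps)
  moreover have "\<dots> = - (curv s * zd s)"
    using v unfolding speed_sq curv_def by (simp add: power2_eq_square field_simps)
  ultimately show "((\<lambda>s. rd s / speed s) has_real_derivative - (curv s * zd s)) (at s)" by simp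
  have "((\<lambda>s. zd s / speed s) has_real_derivative (zdd s * speed s - zd s * speedd s) / (speed s * speed s)) (at s)"
    by (rule DERIV_divide[OF zd_deriv speed_deriv v])
  moreover have "(zdd s * speed s - zd s * speedd s) / (speed s * speed s)
      = (zdd s * (speed s)\<^sup>2 - zd s * (rd s * rdd s + zd s * zdd s)) / (speed s) ^ 3"
    using v by (simp add: speedd_def power2_eq_square power3_eq_cube field_simps)
  moreover have "\<dots> = curv s * rd s"
    using v unfolding speed_sq curv_def by (simp add: power2_eq_square field_simps)
  ultimately show "((\<lambda>s. zd s / speed s) has_real_derivative curv s * rd s) (at s)" by simp
qed

definition potential :: "real \<Rightarrow> real" where
  "potential s = (curv s)\<^sup>2 + (par_curv s)\<^sup>2 + 1 / 2"

text \<open>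
  The shrinker equation says that the profile is a geodesic of the metric
  \<open>sigma\<^sup>2 * (dr\<^sup>2 + dz\<^sup>2)\<close>. Its curvature is then the normal derivative of \<open>ln sigma\<close>, which is what
  turns the second derivative of \<open>ln sigma\<close> along the curve into an expression in the principal curvatures.
\<close>

lemma eta_deriv:
  assumes "self_shrinker X"
  shows "(eta has_real_derivative speed s * (potential s - 1 - 1 / (r s)\<^sup>2)) (at s)"
proof -
  let ?t = "\<lambda>s. rd s / speed s" and ?n = "\<lambda>s. zd s / speed s"
  have v: "speed s > 0" "r s > 0" by (rule speed_pos r_pos)+
  have eq: "eta = (\<lambda>s. ?t s / r s - (r s * ?t s + z s * ?n s) / 2)"
    by (rule ext) (simp add: eta_def diff_divide_distrib add_divide_distrib mult.commute)
  have H: "(z s * rd s - r s * zd s) / 2 = - speed s * curv s - zd s / r s"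
  proof -
    have "(z s * rd s - r s * zd s) / 2 = speed s * ((z s * rd s - r s * zd s) / speed s / 2)"
      using v by simp
    also have "\<dots> = speed s * (- (curv s + par_curv s))"
      using assms unfolding self_shrinker_iff by simp
    also have "\<dots> = - speed s * curv s - speed s * par_curv s" by (simp add: algebra_simps)
    also have "speed s * par_curv s = zd s / r s" using v by (simp add: par_curv_def)
    finally show ?thesis .
  qed
  have "(eta has_real_derivative (- (curv s * zd s) * r s - ?t s * rd s) / (r s * r s)
      - (rd s * ?t s + - (curv s * zd s) * r s + (zd s * ?n s + curv s * rd s * z s)) / 2) (at s)"
    unfolding eq
    by (intro DERIV_diff DERIV_divide DERIV_cdivide DERIV_add DERIV_mult tangent_deriv r_deriv z_deriv) (use v in simp)
  moreover have "(- (curv s * zd s) * r s - ?t s * rd s) / (r s * r s)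
      - (rd s * ?t s + - (curv s * zd s) * r s + (zd s * ?n s + curv s * rd s * z s)) / 2
      = - (curv s * zd s / r s) - (rd s)\<^sup>2 / (speed s * (r s)\<^sup>2) - ((rd s)\<^sup>2 + (zd s)\<^sup>2) / speed s / 2
        - curv s * ((z s * rd s - r s * zd s) / 2)"
    using v by (simp add: field_simps power2_eq_square)
  moreover have "\<dots> = - ((speed s)\<^sup>2 - (zd s)\<^sup>2) / (speed s * (r s)\<^sup>2) - (speed s)\<^sup>2 / speed s / 2 + speed s * (curv s)\<^sup>2"
    unfolding H speed_sq by (simp add: field_simps power2_eq_square)
  moreover have "\<dots> = speed s * (potential s - 1 - 1 / (r s)\<^sup>2)"
    using v by (simp add: potential_def par_curv_def field_simps power2_eq_square)
  ultimately show ?thesis by simp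
qed

end

section \<open>Separation of variables\<close>

context profile begin

abbreviation P where "P \<equiv> torus_periods T"

definition flux :: "real \<Rightarrow> real" where "flux s = sigma s / speed s"

lemma smooth_flux: "smooth1 flux"
  unfolding flux_def[abs_def] using speed_pos by (intro smooth1_intros smooth_sigma smooth_speed) (metis less_irrefl)

definition wgt :: "real \<Rightarrow> real" where "wgt s = sigma s * speed s"

lemma wgt_pos: "wgt s > 0"
  by (simp add: wgt_def sigma_pos speed_pos)

lemma per_wgt: "wgt (s + T) = wgt s"
  by (simp add: wgt_def per_sigma per_speed)

lemma smooth_wgt: "smooth1 wgt"
  unfolding wgt_def[abs_def] by (intro smooth1_intros smooth_sigma smooth_speed)

text \<open>
  In these coordinates the metric is diagonal and independent of the angle, so the operator splits into
  a Sturm-Liouville part along the profile and the second derivative in the angle.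
\<close>

lemma stability_op_X:
  assumes "smooth f"
  shows "wgt (p $ 1) * stability_op X f p =
    deriv flux (p $ 1) * pd 1 f p + flux (p $ 1) * pd 1 (pd 1 f) p
    + wgt (p $ 1) * (pd 2 (pd 2 f) p / (r (p $ 1))\<^sup>2 + potential (p $ 1) * f p)"
proof -
  let ?s = "p $ 1"
  define em where "em s = exp (- ((r s)\<^sup>2 + (z s)\<^sup>2) / 4)" for s
  define b where "b s = speed s * em s / r s" for s
  have em: "em s > 0" for s by (simp add: em_def)
  have v: "speed s > 0" "r s > 0" for s by (rule speed_pos r_pos)+
  have sg: "sigma s = r s * em s / 2" for s by (simp add: sigma_def em_def)
  have grad: "surf_grad X f q $ 1 = 1 / (speed (q $ 1))\<^sup>2 * pd 1 f q"
    "surf_grad X f q $ 2 = 1 / (r (q $ 1))\<^sup>2 * pd 2 f q" for q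
    unfolding surf_grad_def metric_X using v[of "q $ 1"] by (simp_all add: matrix_inv_diag2 diag2_vector)
  have V: "(\<lambda>q. area_density X q * (exp (- (norm (X q))\<^sup>2 / 4) *\<^sub>R surf_grad X f q) $ 1) = (\<lambda>q. 2 * flux (q $ 1) * pd 1 f q)"
    "(\<lambda>q. area_density X q * (exp (- (norm (X q))\<^sup>2 / 4) *\<^sub>R surf_grad X f q) $ 2) = (\<lambda>q. b (q $ 1) * pd 2 f q)"
  proof -
    show "(\<lambda>q. area_density X q * (exp (- (norm (X q))\<^sup>2 / 4) *\<^sub>R surf_grad X f q) $ 1) = (\<lambda>q. 2 * flux (q $ 1) * pd 1 f q)"
    proof
      fix q show "area_density X q * (exp (- (norm (X q))\<^sup>2 / 4) *\<^sub>R surf_grad X f q) $ 1 = 2 * flux (q $ 1) * pd 1 f q"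
        unfolding area_density_X norm_X vector_scaleR_component grad em_def[symmetric] flux_def sg
        using v[of "q $ 1"] by (simp add: power2_eq_square field_simps)
    qed
    show "(\<lambda>q. area_density X q * (exp (- (norm (X q))\<^sup>2 / 4) *\<^sub>R surf_grad X f q) $ 2) = (\<lambda>q. b (q $ 1) * pd 2 f q)"
    proof
      fix q show "area_density X q * (exp (- (norm (X q))\<^sup>2 / 4) *\<^sub>R surf_grad X f q) $ 2 = b (q $ 1) * pd 2 f q"
        unfolding area_density_X norm_X vector_scaleR_component grad em_def[symmetric] b_def
        using v[of "q $ 1"] by (simp add: power2_eq_square field_simps)
    qed
  qed
  have "((\<lambda>s. 2 * flux s) has_real_derivative 2 * deriv flux ?s) (at ?s)"
    by (intro DERIV_cmult smooth1_DERIV smooth_flux)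
  then have p1: "pd 1 (\<lambda>q. 2 * flux (q $ 1) * pd 1 f q) p = 2 * deriv flux ?s * pd 1 f p + 2 * flux ?s * pd 1 (pd 1 f) p"
    by (rule pd_mult_left(1)) (intro smooth_differentiable smooth_pd assms)
  have sb: "smooth1 b"
    unfolding b_def[abs_def] em_def using v
    by (intro smooth1_intros smooth_speed smooth_r smooth_z) (auto simp: less_imp_neq[symmetric])
  have p2: "pd 2 (\<lambda>q. b (q $ 1) * pd 2 f q) p = b ?s * pd 2 (pd 2 f) p"
    by (rule pd_mult_left(2)[OF smooth1_DERIV[OF sb]]) (intro smooth_differentiable smooth_pd assms)
  have "drift_laplacian X f p = exp ((norm (X p))\<^sup>2 / 4) *
      ((2 * deriv flux ?s * pd 1 f p + 2 * flux ?s * pd 1 (pd 1 f) p + b ?s * pd 2 (pd 2 f) p) / (speed ?s * r ?s))"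
    unfolding drift_laplacian_def surf_div_def sum_2 V p1 p2 unfolding area_density_X ..
  also have "exp ((norm (X p))\<^sup>2 / 4) = 1 / em ?s"
    unfolding norm_X em_def minus_divide_left[symmetric] exp_minus inverse_eq_divide by simp
  finally have "wgt ?s * drift_laplacian X f p = wgt ?s * (1 / em ?s) / (speed ?s * r ?s) *
      (2 * deriv flux ?s * pd 1 f p + 2 * flux ?s * pd 1 (pd 1 f) p + b ?s * pd 2 (pd 2 f) p)"
    by simp
  also have "wgt ?s * (1 / em ?s) / (speed ?s * r ?s) = 1 / 2"
    unfolding wgt_def sg using v[of ?s] em[of ?s] by (simp add: field_simps)
  finally have d: "wgt ?s * drift_laplacian X f p =
      deriv flux ?s * pd 1 f p + flux ?s * pd 1 (pd 1 f) p + b ?s / 2 * pd 2 (pd 2 f) p"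
    by (simp add: algebra_simps)
  have b: "b ?s / 2 = wgt ?s / (r ?s)\<^sup>2"
    unfolding b_def wgt_def sg using v[of ?s] by (simp add: power2_eq_square field_simps)
  show ?thesis
    unfolding stability_op_def second_form_norm2_X distrib_left d b potential_def
    by (simp add: algebra_simps)
qed

text \<open>
  A function \<open>u\<close> of frequency \<open>k\<close> is replaced by \<open>y = sigma * u\<close>. With respect to the arc length of the
  metric \<open>sigma\<^sup>2 * (dr\<^sup>2 + dz\<^sup>2)\<close>, whose element is \<open>wgt\<close>, the eigenvalue equation becomes
  \<open>y'' + (modepot k + \<mu> / sigma\<^sup>2) * y = 0\<close>. For \<open>k = 0\<close> the potential is the Gauss curvature, so that
  the equation with \<open>\<mu> = 0\<close> is the Jacobi equation of the profile.
\<close>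

definition modepot :: "nat \<Rightarrow> real \<Rightarrow> real" where
  "modepot k s = (1 + (1 - (real k)\<^sup>2) / (r s)\<^sup>2) / (sigma s)\<^sup>2"

definition mode_coeff :: "nat \<Rightarrow> real \<Rightarrow> real \<Rightarrow> real" where
  "mode_coeff k \<mu> s = wgt s * (modepot k s + \<mu> / (sigma s)\<^sup>2)"

definition modes :: "nat \<Rightarrow> real \<Rightarrow> (real \<Rightarrow> real) set" where
  "modes k \<mu> = periodic_solutions T wgt (mode_coeff k \<mu>)"

lemma sigma_mode_coeff:
  "sigma s * (mode_coeff k \<mu> s * (sigma s * u)) = wgt s * (1 + (1 - (real k)\<^sup>2) / (r s)\<^sup>2 + \<mu>) * u"
  using sigma_pos[of s] by (simp add: mode_coeff_def modepot_def field_simps power2_eq_square)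

lemma smooth_mode_coeff: "smooth1 (mode_coeff k \<mu>)"
proof -
  have "(r s)\<^sup>2 \<noteq> 0" "(sigma s)\<^sup>2 \<noteq> 0" for s using r_pos[of s] sigma_pos[of s] by auto
  then show ?thesis
    unfolding mode_coeff_def[abs_def] modepot_def
    by (intro smooth1_intros smooth_wgt smooth_r smooth_sigma) auto
qed

lemma smooth_modes:
  assumes "solves wgt (mode_coeff k \<mu>) y p" shows "smooth1 y" "smooth1 p"
proof -
  have "(y has_real_derivative wgt s * p s) (at s)" "(p has_real_derivative (- mode_coeff k \<mu> s) * y s) (at s)" for s
    using assms by (auto simp: solves_def)
  from linear_system_smooth[OF this smooth_wgt smooth1_minus[OF smooth_mode_coeff]]
  show "smooth1 y" "smooth1 p" by blast+
qed

lemma flux_deriv: "(flux has_real_derivative deriv flux s) (at s)"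
  by (rule smooth1_DERIV[OF smooth_flux])

text \<open>
  The conjugate variable \<open>u1 / speed + eta * u\<close> is the derivative of \<open>sigma * u\<close> with respect to the
  conformal arc length; the term with \<open>eta\<close> produces the change of potential.
\<close>

lemma mode_from_ode:
  assumes S: "self_shrinker X"
    and u: "\<And>s. (u has_real_derivative u1 s) (at s)" "\<And>s. (u1 has_real_derivative u2 s) (at s)"
    and ode: "\<And>s. deriv flux s * u1 s + flux s * u2 s + wgt s * (potential s - (real k)\<^sup>2 / (r s)\<^sup>2 + \<mu>) * u s = 0"
  shows "solves wgt (mode_coeff k \<mu>) (\<lambda>s. sigma s * u s) (\<lambda>s. u1 s / speed s + eta s * u s)"
  unfolding solves_def
proof (intro allI conjI)
  fix s
  have v: "speed s > 0" "sigma s > 0" by (rule speed_pos sigma_pos)+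
  show "((\<lambda>s. sigma s * u s) has_real_derivative wgt s * (u1 s / speed s + eta s * u s)) (at s)"
    by (rule DERIV_cong[OF DERIV_mult[OF sigma_deriv u(1)]])
      (use v in \<open>simp add: wgt_def field_simps\<close>)
  define D where "D = (u2 s * speed s - u1 s * speedd s) / (speed s * speed s)
      + (speed s * (potential s - 1 - 1 / (r s)\<^sup>2) * u s + u1 s * eta s)"
  have d: "((\<lambda>s. u1 s / speed s + eta s * u s) has_real_derivative D) (at s)"
    unfolding D_def using v
    by (intro DERIV_add DERIV_divide DERIV_mult u speed_deriv eta_deriv[OF S]) auto
  have f: "deriv flux s = (sigma s * speed s * eta s * speed s - sigma s * speedd s) / (speed s * speed s)"
    unfolding flux_def[abs_def] using v by (intro DERIV_imp_deriv DERIV_divide sigma_deriv speed_deriv) auto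
  have "sigma s * D = deriv flux s * u1 s + flux s * u2 s + wgt s * (potential s - 1 - 1 / (r s)\<^sup>2) * u s"
    unfolding D_def f flux_def wgt_def using v by (simp add: field_simps)
  also have "\<dots> = - (wgt s * (potential s - (real k)\<^sup>2 / (r s)\<^sup>2 + \<mu>) * u s) + wgt s * (potential s - 1 - 1 / (r s)\<^sup>2) * u s"
    using ode[of s] by linarith
  also have "\<dots> = - (wgt s * (1 + (1 - (real k)\<^sup>2) / (r s)\<^sup>2 + \<mu>) * u s)"
    by (simp add: diff_divide_distrib algebra_simps)
  also have "\<dots> = - (sigma s * (mode_coeff k \<mu> s * (sigma s * u s)))"
    unfolding sigma_mode_coeff ..
  finally have "sigma s * D = sigma s * (- mode_coeff k \<mu> s * (sigma s * u s))" by simp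
  then have "D = - mode_coeff k \<mu> s * (sigma s * u s)"
    using v(2) unfolding mult_cancel_left by linarith
  then show "((\<lambda>s. u1 s / speed s + eta s * u s) has_real_derivative - mode_coeff k \<mu> s * (sigma s * u s)) (at s)"
    using d by simp
qed

lemma ode_from_mode:
  assumes S: "self_shrinker X" and y: "solves wgt (mode_coeff k \<mu>) y p"
  defines "u \<equiv> \<lambda>s. y s / sigma s"
  shows "deriv flux s * deriv u s + flux s * deriv (deriv u) s + wgt s * (potential s - (real k)\<^sup>2 / (r s)\<^sup>2 + \<mu>) * u s = 0"
proof -
  have su: "smooth1 u" unfolding u_def using sigma_pos
    by (intro smooth1_intros smooth_modes[OF y] smooth_sigma) (metis less_irrefl)
  have yd: "(y has_real_derivative wgt s * p s) (at s)" "(p has_real_derivative - mode_coeff k \<mu> s * y s) (at s)" for s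
    using y by (auto simp: solves_def)
  have yu: "y s = sigma s * u s" for s using sigma_pos[of s] by (simp add: u_def)
  have fu: "flux s * deriv u s = sigma s * p s - eta s * y s" for s
  proof -
    have "((\<lambda>s. sigma s * u s) has_real_derivative sigma s * speed s * eta s * u s + deriv u s * sigma s) (at s)"
      by (rule DERIV_mult[OF sigma_deriv smooth1_DERIV[OF su]])
    then have "sigma s * speed s * eta s * u s + deriv u s * sigma s = wgt s * p s"
      using yd(1)[of s] unfolding yu[abs_def] by (rule DERIV_unique)
    then have "deriv u s = speed s * p s - speed s * eta s * u s"
    proof -
      assume "sigma s * speed s * eta s * u s + deriv u s * sigma s = wgt s * p s"
      then have "sigma s * deriv u s = sigma s * (speed s * p s - speed s * eta s * u s)"
        by (simp add: wgt_def algebra_simps)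
      then show ?thesis using sigma_pos[of s] unfolding mult_cancel_left by linarith
    qed
    from this show ?thesis
      unfolding flux_def yu[of s] using speed_pos[of s] by (simp only: \<open>deriv u s = _\<close>) (simp add: field_simps)
  qed
  have "((\<lambda>s. flux s * deriv u s) has_real_derivative deriv flux s * deriv u s + deriv (deriv u) s * flux s) (at s)"
    by (rule DERIV_mult[OF flux_deriv smooth1_DERIV[OF smooth1_deriv[OF su]]])
  moreover have "((\<lambda>s. sigma s * p s - eta s * y s) has_real_derivative
      (sigma s * speed s * eta s * p s + - mode_coeff k \<mu> s * y s * sigma s)
      - (speed s * (potential s - 1 - 1 / (r s)\<^sup>2) * y s + wgt s * p s * eta s)) (at s)"
    by (intro DERIV_diff DERIV_mult sigma_deriv yd eta_deriv[OF S])
  ultimately have "deriv flux s * deriv u s + deriv (deriv u) s * flux s =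
      (sigma s * speed s * eta s * p s + - mode_coeff k \<mu> s * y s * sigma s)
      - (speed s * (potential s - 1 - 1 / (r s)\<^sup>2) * y s + wgt s * p s * eta s)"
    unfolding fu by (rule DERIV_unique)
  also have "\<dots> = - (sigma s * (mode_coeff k \<mu> s * (sigma s * u s)))
      - wgt s * (potential s - 1 - 1 / (r s)\<^sup>2) * u s"
    by (simp add: yu wgt_def algebra_simps)
  finally have e: "deriv flux s * deriv u s + deriv (deriv u) s * flux s = - (sigma s * (mode_coeff k \<mu> s * (sigma s * u s)))
      - wgt s * (potential s - 1 - 1 / (r s)\<^sup>2) * u s" .
  have "sigma s * (mode_coeff k \<mu> s * (sigma s * u s)) = wgt s * (1 + (1 - (real k)\<^sup>2) / (r s)\<^sup>2 + \<mu>) * u s"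
    by (rule sigma_mode_coeff)
  then show ?thesis using e by (simp add: diff_divide_distrib algebra_simps)
qed

end

lemma smooth1_trig: "smooth1 (trig j)" "smooth1 (trig' j)"
proof -
  have "(trig j has_real_derivative 1 * trig' j t) (at t)"
    "(trig' j has_real_derivative (- (of_int j)\<^sup>2) * trig j t) (at t)" for t
    using trig_deriv trig'_deriv by simp_all
  from linear_system_smooth[OF this smooth1_const smooth1_const] show "smooth1 (trig j)" "smooth1 (trig' j)" by blast+
qed

lemma deriv_trig: "deriv (trig j) = trig' j" "deriv (trig' j) = (\<lambda>t. - (of_int j)\<^sup>2 * trig j t)"
  using trig_deriv trig'_deriv by (auto intro!: ext DERIV_imp_deriv)

lemma doubly_periodic_torus:
  "doubly_periodic (torus_periods T) f \<longleftrightarrow>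
    (\<forall>s t. f (vector [s + T, t]) = f (vector [s, t]) \<and> f (vector [s, t + 2 * pi]) = f (vector [s, t]))"
proof -
  have shift: "vector [s, t] + torus_periods T $ 1 *\<^sub>R axis 1 1 = (vector [s + T, t] :: real^2)"
    "vector [s, t] + torus_periods T $ 2 *\<^sub>R axis 2 1 = (vector [s, t + 2 * pi] :: real^2)" for s t
    by (simp_all add: torus_periods_def vec_eq_iff forall_2)
  have all: "(\<forall>p::real^2. Q p) \<longleftrightarrow> (\<forall>s t. Q (vector [s, t]))" for Q
    by (metis vector2_eta)
  show ?thesis
    unfolding doubly_periodic_def forall_2 all_conj_distrib all shift by blast
qed

lemma pd_periodic:
  assumes "doubly_periodic P f" shows "doubly_periodic P (pd i f)"
  unfolding doubly_periodic_def
proof (intro allI)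
  fix k p
  have "f (p + P $ k *\<^sub>R axis k 1 + t *\<^sub>R axis i 1) = f (p + t *\<^sub>R axis i 1)" for t
  proof -
    have "p + P $ k *\<^sub>R axis k 1 + t *\<^sub>R axis i 1 = (p + t *\<^sub>R axis i 1) + P $ k *\<^sub>R axis k 1"
      by (simp add: algebra_simps)
    then show ?thesis using assms unfolding doubly_periodic_def by metis
  qed
  then show "pd i f (p + P $ k *\<^sub>R axis k 1) = pd i f p" unfolding pd_def by simp
qed

lemma smooth_slice_cont:
  fixes f :: "real^2 \<Rightarrow> real"
  assumes "smooth f" shows "continuous_on S (\<lambda>t. f (vector [s, t]))"
proof -
  have "continuous_on S (\<lambda>t. (s, t))" by (intro continuous_intros)
  from continuous_on_compose2[OF smooth_continuous_slice[OF assms, of UNIV] this] show ?thesis by simp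
qed

text \<open>
  Taking Fourier coefficients in the angle commutes with differentiation along the profile.
\<close>

lemma trig_integral_deriv:
  assumes "smooth F"
  shows "((\<lambda>s. integral {0..2 * pi} (\<lambda>t. F (vector [s, t]) * trig j t)) has_real_derivative
    integral {0..2 * pi} (\<lambda>t. pd 1 F (vector [s, t]) * trig j t)) (at s)"
proof -
  have c: "continuous_on S (\<lambda>(s, t). G (vector [s, t]) * trig j t)" if "smooth G" for S and G :: "real^2 \<Rightarrow> real"
    using smooth_continuous_slice[OF that, of S]
    by (simp add: case_prod_beta) (intro continuous_intros)
  have "((\<lambda>s. integral (cbox 0 (2 * pi)) (\<lambda>t. F (vector [s, t]) * trig j t)) has_real_derivative
    integral (cbox 0 (2 * pi)) (\<lambda>t. pd 1 F (vector [s, t]) * trig j t)) (at s within UNIV)"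
  proof (rule leibniz_rule_field_derivative)
    show "((\<lambda>s. F (vector [s, t]) * trig j t) has_real_derivative pd 1 F (vector [s, t]) * trig j t) (at s within UNIV)" for s t
      using DERIV_cmult_right[OF pd_slice(1)[OF smooth_differentiable[OF assms]]] by simp
    show "(\<lambda>t. F (vector [s, t]) * trig j t) integrable_on cbox 0 (2 * pi)" for s
      by (intro integrable_continuous continuous_intros smooth_slice_cont assms)
    show "continuous_on (UNIV \<times> cbox 0 (2 * pi)) (\<lambda>(s, t). pd 1 F (vector [s, t]) * trig j t)"
      by (rule c[OF smooth_pd[OF assms]])
  qed auto
  then show ?thesis by simp
qed

context profile begin

definition lift :: "int \<Rightarrow> (real \<Rightarrow> real) \<Rightarrow> real^2 \<Rightarrow> real" where
  "lift j y p = y (p $ 1) / sigma (p $ 1) * trig j (p $ 2)"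

definition coeff :: "int \<Rightarrow> (real^2 \<Rightarrow> real) \<Rightarrow> real \<Rightarrow> real" where
  "coeff j f s = sigma s * integral {0..2 * pi} (\<lambda>t. f (vector [s, t]) * trig j t)"

lemma modes_lift:
  assumes S: "self_shrinker X" and y: "y \<in> modes (nat \<bar>j\<bar>) \<mu>"
  shows "lift j y \<in> eigenspace P X \<mu>"
proof -
  obtain p where p: "solves wgt (mode_coeff (nat \<bar>j\<bar>) \<mu>) y p" and per: "\<And>s. y (s + T) = y s"
    using y by (auto simp: modes_def periodic_solutions_def)
  define u where "u s = y s / sigma s" for s
  have su: "smooth1 u" unfolding u_def[abs_def] using sigma_pos
    by (intro smooth1_intros smooth_modes[OF p] smooth_sigma) (metis less_irrefl)
  have l: "lift j y = (\<lambda>q. u (q $ 1) * trig j (q $ 2))" by (rule ext) (simp add: lift_def u_def)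
  have sm: "smooth (lift j y)" unfolding l by (rule smooth_product[OF su smooth1_trig(1)])
  have dp: "doubly_periodic P (lift j y)"
    unfolding doubly_periodic_torus by (simp add: lift_def per per_sigma trig_periodic)
  have "- stability_op X (lift j y) q = \<mu> * lift j y q" for q
  proof -
    let ?s = "q $ 1" and ?t = "q $ 2"
    have k2: "(real (nat \<bar>j\<bar>))\<^sup>2 = (of_int j)\<^sup>2" by simp
    have "wgt ?s * stability_op X (lift j y) q =
        deriv flux ?s * (deriv u ?s * trig j ?t) + flux ?s * (deriv (deriv u) ?s * trig j ?t)
        + wgt ?s * (u ?s * (- (of_int j)\<^sup>2 * trig j ?t) / (r ?s)\<^sup>2 + potential ?s * (u ?s * trig j ?t))"
      unfolding stability_op_X[OF sm] unfolding l
      by (simp add: pd_product su smooth1_deriv smooth1_trig deriv_trig)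
    also have "\<dots> = trig j ?t * (deriv flux ?s * deriv u ?s + flux ?s * deriv (deriv u) ?s
        + wgt ?s * (potential ?s - (of_int j)\<^sup>2 / (r ?s)\<^sup>2 + \<mu>) * u ?s) - wgt ?s * \<mu> * (u ?s * trig j ?t)"
      by (simp add: algebra_simps)
    also have "\<dots> = - (wgt ?s * \<mu> * (u ?s * trig j ?t))"
      using ode_from_mode[OF S p, of ?s] unfolding k2 u_def[abs_def, symmetric] by (simp add: u_def)
    finally have "wgt ?s * stability_op X (lift j y) q = wgt ?s * (- \<mu> * lift j y q)"
      by (simp add: l)
    then show ?thesis using wgt_pos[of ?s] unfolding mult_cancel_left by linarith
  qed
  then show ?thesis using sm dp by (simp add: eigenspace_def)
qed

text \<open>
  Integrating the eigenvalue equation against a trigonometric function, the second derivative in the angle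
  becomes multiplication by \<open>- j\<^sup>2\<close> after two integrations by parts.
\<close>

lemma coeff_modes:
  assumes S: "self_shrinker X" and f: "f \<in> eigenspace P X \<mu>"
  shows "coeff j f \<in> modes (nat \<bar>j\<bar>) \<mu>"
proof -
  have sm: "smooth f" and dp: "doubly_periodic P f" and eig: "\<And>p. - stability_op X f p = \<mu> * f p"
    using f by (auto simp: eigenspace_def)
  define I where "I F s = integral {0..2 * pi} (\<lambda>t. F (vector [s, t]) * trig j t)" for F :: "real^2 \<Rightarrow> real" and s
  have Id: "(I F has_real_derivative I (pd 1 F) s) (at s)" if "smooth F" for F s
    unfolding I_def[abs_def] by (rule trig_integral_deriv[OF that])
  have Ii: "((\<lambda>t. F (vector [s, t]) * trig j t) has_integral I F s) {0..2 * pi}" if "smooth F" for F s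
    unfolding I_def
    by (intro integrable_integral integrable_continuous_real continuous_intros smooth_slice_cont that)
  note sm1 = smooth_pd[OF sm] note sm2 = smooth_pd[OF smooth_pd[OF sm]]
  have per: "F (vector [s + T, t]) = F (vector [s, t])" "F (vector [s, t + 2 * pi]) = F (vector [s, t])"
    if "doubly_periodic P F" for F :: "real^2 \<Rightarrow> real" and s t
    using that unfolding doubly_periodic_torus by blast+
  have theta: "I (pd 2 (pd 2 f)) s = - (of_int j)\<^sup>2 * I f s" for s
  proof -
    define W where "W t = pd 2 f (vector [s, t]) * trig j t - f (vector [s, t]) * trig' j t" for t
    have "(W has_real_derivative pd 2 (pd 2 f) (vector [s, t]) * trig j t + (of_int j)\<^sup>2 * (f (vector [s, t]) * trig j t)) (at t)" for t
    proof -
      have "(W has_real_derivative (pd 2 (pd 2 f) (vector [s, t]) * trig j t + trig' j t * pd 2 f (vector [s, t]))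
          - (pd 2 f (vector [s, t]) * trig' j t + (- (of_int j)\<^sup>2 * trig j t) * f (vector [s, t]))) (at t)"
        unfolding W_def[abs_def]
        by (intro DERIV_diff DERIV_mult pd_slice(2) smooth_differentiable sm sm1 trig_deriv trig'_deriv)
      then show ?thesis by (rule DERIV_cong) (simp add: algebra_simps)
    qed
    then have h1: "((\<lambda>t. pd 2 (pd 2 f) (vector [s, t]) * trig j t + (of_int j)\<^sup>2 * (f (vector [s, t]) * trig j t)) has_integral W (2 * pi) - W 0) {0..2 * pi}"
      by (intro fundamental_theorem_of_calculus)
        (auto simp: has_real_derivative_iff_has_vector_derivative[symmetric] intro: has_field_derivative_at_within)
    have W0: "W (2 * pi) - W 0 = 0"
      using per[OF dp, of s 0] per[OF pd_periodic[OF dp], of 2 s 0] trig_periodic[of j 0] by (simp add: W_def)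
    have h2: "((\<lambda>t. pd 2 (pd 2 f) (vector [s, t]) * trig j t + (of_int j)\<^sup>2 * (f (vector [s, t]) * trig j t))
        has_integral I (pd 2 (pd 2 f)) s + (of_int j)\<^sup>2 * I f s) {0..2 * pi}"
      by (intro has_integral_add has_integral_mult_right Ii sm sm2)
    show ?thesis using has_integral_unique[OF h2 h1] W0 by linarith
  qed
  have ode: "deriv flux s * I (pd 1 f) s + flux s * I (pd 1 (pd 1 f)) s
      + wgt s * (potential s - (real (nat \<bar>j\<bar>))\<^sup>2 / (r s)\<^sup>2 + \<mu>) * I f s = 0" for s
  proof -
    have "deriv flux s * pd 1 f (vector [s, t]) + flux s * pd 1 (pd 1 f) (vector [s, t])
       + wgt s * (pd 2 (pd 2 f) (vector [s, t]) / (r s)\<^sup>2 + potential s * f (vector [s, t])) + wgt s * \<mu> * f (vector [s, t]) = 0" (is "?e t = 0") for t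
    proof -
      have "stability_op X f (vector [s, t]) = - (\<mu> * f (vector [s, t]))" using eig[of "vector [s, t]"] by linarith
      then have "wgt s * stability_op X f (vector [s, t]) = - (wgt s * \<mu> * f (vector [s, t]))" by simp
      then show ?thesis using stability_op_X[OF sm, of "vector [s, t]"] by simp
    qed
    then have "?e t = 0" for t .
    then have "(deriv flux s * (pd 1 f (vector [s, t]) * trig j t) + flux s * (pd 1 (pd 1 f) (vector [s, t]) * trig j t)
       + wgt s / (r s)\<^sup>2 * (pd 2 (pd 2 f) (vector [s, t]) * trig j t) + wgt s * (potential s + \<mu>) * (f (vector [s, t]) * trig j t)) = 0 * trig j t" for t
    proof -
      have "deriv flux s * (a * g) + flux s * (b * g) + wgt s / (r s)\<^sup>2 * (c * g) + wgt s * (potential s + \<mu>) * (d * g)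
          = (deriv flux s * a + flux s * b + wgt s * (c / (r s)\<^sup>2 + potential s * d) + wgt s * \<mu> * d) * g" for a b c d g
        by (simp add: algebra_simps)
      then show ?thesis using \<open>?e t = 0\<close> by simp
    qed
    then have z: "((\<lambda>t. deriv flux s * (pd 1 f (vector [s, t]) * trig j t) + flux s * (pd 1 (pd 1 f) (vector [s, t]) * trig j t)
       + wgt s / (r s)\<^sup>2 * (pd 2 (pd 2 f) (vector [s, t]) * trig j t) + wgt s * (potential s + \<mu>) * (f (vector [s, t]) * trig j t)) has_integral 0) {0..2 * pi}"
      by simp
    have "((\<lambda>t. deriv flux s * (pd 1 f (vector [s, t]) * trig j t) + flux s * (pd 1 (pd 1 f) (vector [s, t]) * trig j t)
       + wgt s / (r s)\<^sup>2 * (pd 2 (pd 2 f) (vector [s, t]) * trig j t) + wgt s * (potential s + \<mu>) * (f (vector [s, t]) * trig j t))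
       has_integral deriv flux s * I (pd 1 f) s + flux s * I (pd 1 (pd 1 f)) s
       + wgt s / (r s)\<^sup>2 * I (pd 2 (pd 2 f)) s + wgt s * (potential s + \<mu>) * I f s) {0..2 * pi}"
      by (intro has_integral_add has_integral_mult_right Ii sm sm1 sm2)
    from has_integral_unique[OF this z] show ?thesis
      unfolding theta by (simp add: algebra_simps)
  qed
  have c: "coeff j f = (\<lambda>s. sigma s * I f s)" by (rule ext) (simp add: coeff_def I_def)
  have "solves wgt (mode_coeff (nat \<bar>j\<bar>) \<mu>) (coeff j f) (\<lambda>s. I (pd 1 f) s / speed s + eta s * I f s)"
    unfolding c by (rule mode_from_ode[OF S Id Id ode]) (intro sm sm1)+
  moreover have "coeff j f (s + T) = coeff j f s" for s
    by (simp add: c I_def per_sigma per[OF dp])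
  moreover have "I (pd 1 f) (s + T) / speed (s + T) + eta (s + T) * I f (s + T) = I (pd 1 f) s / speed s + eta s * I f s" for s
    by (simp add: I_def per_speed per[OF dp] per[OF pd_periodic[OF dp]] eta_def per_r per_z per_rd per_zd)
  ultimately show ?thesis unfolding modes_def periodic_solutions_def by blast
qed

lemma fourier_expansion:
  assumes sm: "smooth f" and dp: "doubly_periodic P f"
    and z: "\<And>j. j \<notin> J \<Longrightarrow> coeff j f = (\<lambda>_. 0)" and J: "finite J"
  shows "f p = (\<Sum>j\<in>J. 1 / trig_norm2 j * lift j (coeff j f) p)"
proof -
  obtain s t where p: "p = vector [s, t]" by (metis vector2_eta)
  define c where "c j = integral {0..2 * pi} (\<lambda>t. f (vector [s, t]) * trig j t)" for j
  have c0: "c j = 0" if "j \<notin> J" for j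
    using fun_cong[OF z[OF that], of s] sigma_pos[of s] by (simp add: coeff_def c_def)
  define g where "g t = f (vector [s, t]) - (\<Sum>j\<in>J. c j / trig_norm2 j * trig j t)" for t
  have "g t = 0"
  proof (rule fourier_complete[of g])
    show "continuous_on UNIV g"
      unfolding g_def[abs_def] by (intro continuous_intros smooth_slice_cont sm)
    show "g (t + 2 * pi) = g t" for t
      using dp unfolding doubly_periodic_torus g_def by (simp add: trig_periodic)
    show "integral {0..2 * pi} (\<lambda>t. g t * trig i t) = 0" for i
    proof (rule integral_unique)
      have "((\<lambda>t. f (vector [s, t]) * trig i t - (\<Sum>j\<in>J. c j / trig_norm2 j * (trig j t * trig i t))) has_integral
         c i - (\<Sum>j\<in>J. c j / trig_norm2 j * (if j = i then trig_norm2 i else 0))) {0..2 * pi}"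
        unfolding c_def
        by (intro has_integral_diff has_integral_sum J has_integral_mult_right trig_orthogonal integrable_integral
            integrable_continuous_real continuous_intros smooth_slice_cont sm)
      moreover have "c i - (\<Sum>j\<in>J. c j / trig_norm2 j * (if j = i then trig_norm2 i else 0)) = 0"
        using J c0 trig_norm2_pos[of i] by (cases "i \<in> J") (simp_all add: if_distrib[of "\<lambda>x. _ * x"] sum.delta cong: if_cong)
      ultimately show "((\<lambda>t. g t * trig i t) has_integral 0) {0..2 * pi}"
        by (simp add: g_def left_diff_distrib sum_distrib_right mult.assoc)
    qed
  qed
  then show ?thesis
    using sigma_pos[of s] by (simp add: g_def p lift_def coeff_def c_def)
qed

end

lemma fun_sum_apply: "(sum f A :: 'a \<Rightarrow> real) x = (\<Sum>a\<in>A. f a x)"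
  by (induction A rule: infinite_finite_induct) auto

context profile begin

lemma coeff_sum_lift:
  assumes "finite A"
  shows "coeff i (\<Sum>a\<in>A. scale_fun (c a) (lift (fst a) (snd a))) s
    = trig_norm2 i * (\<Sum>a\<in>A. if fst a = i then c a * snd a s else 0)"
proof -
  have "((\<lambda>t. \<Sum>a\<in>A. c a * (snd a s / sigma s) * (trig (fst a) t * trig i t)) has_integral
     (\<Sum>a\<in>A. c a * (snd a s / sigma s) * (if fst a = i then trig_norm2 i else 0))) {0..2 * pi}"
    by (intro has_integral_sum assms has_integral_mult_right) (metis trig_orthogonal)
  moreover have "(\<Sum>a\<in>A. scale_fun (c a) (lift (fst a) (snd a))) (vector [s, t]) * trig i t
     = (\<Sum>a\<in>A. c a * (snd a s / sigma s) * (trig (fst a) t * trig i t))" for t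
    unfolding fun_sum_apply sum_distrib_right by (intro sum.cong refl) (simp add: lift_def)
  ultimately have "coeff i (\<Sum>a\<in>A. scale_fun (c a) (lift (fst a) (snd a))) s
     = sigma s * (\<Sum>a\<in>A. c a * (snd a s / sigma s) * (if fst a = i then trig_norm2 i else 0))"
    unfolding coeff_def by (simp add: integral_unique)
  also have "\<dots> = trig_norm2 i * (\<Sum>a\<in>A. if fst a = i then c a * snd a s else 0)"
    unfolding sum_distrib_left using sigma_pos[of s] by (intro sum.cong) auto
  finally show ?thesis .
qed

lemma coeff_lift: "coeff i (lift j y) s = (if j = i then trig_norm2 i * y s else 0)"
proof -
  have "scale_fun 1 f = f" for f :: "real^2 \<Rightarrow> real" by (simp add: fun_eq_iff)
  then show ?thesis using coeff_sum_lift[of "{(j, y)}" i "\<lambda>_. 1" s] by simp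
qed

text \<open>
  The eigenspaces of the modes \<open>j\<close> and \<open>- j\<close> enter separately; this is the factor two in the
  count of all eigenvalues.
\<close>

theorem eigenspace_edim:
  assumes S: "self_shrinker X" and J: "finite J"
    and b: "\<And>j. j \<in> J \<Longrightarrow> finite (b j) \<and> b j \<subseteq> modes (nat \<bar>j\<bar>) \<mu> \<and> fun_space.independent (b j)
        \<and> modes (nat \<bar>j\<bar>) \<mu> \<subseteq> fun_space.span (b j)"
    and z: "\<And>j. j \<notin> J \<Longrightarrow> modes (nat \<bar>j\<bar>) \<mu> \<subseteq> {\<lambda>_. 0}"
  shows "edim (eigenspace P X \<mu>) = enat (\<Sum>j\<in>J. card (b j))"
proof -
  define I where "I = Sigma J b"
  define \<phi> where "\<phi> a = lift (fst a) (snd a)" for a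
  have I: "finite I" unfolding I_def using J b by blast
  have nz: "y \<noteq> (\<lambda>_. 0)" if "j \<in> J" "y \<in> b j" for j y
  proof -
    have "y \<noteq> 0" using b[OF that(1)] that(2) fun_space.dependent_zero by blast
    then show ?thesis unfolding zero_fun_def .
  qed
  have inj: "inj_on \<phi> I"
  proof (rule inj_onI)
    fix a a' assume a: "a \<in> I" "a' \<in> I" "\<phi> a = \<phi> a'"
    have e: "(if fst a = i then trig_norm2 i * snd a s else 0) = (if fst a' = i then trig_norm2 i * snd a' s else 0)" for i s
      using a(3) coeff_lift by (metis \<phi>_def)
    have "snd a \<noteq> (\<lambda>_. 0)" using nz[of "fst a" "snd a"] a(1) by (auto simp: I_def)
    then obtain s where s: "snd a s \<noteq> 0" unfolding fun_eq_iff by blast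
    have "fst a' = fst a" using e[of "fst a" s] s trig_norm2_pos[of "fst a"] by (auto split: if_splits)
    moreover from this have "snd a = snd a'" using e[of "fst a"] trig_norm2_pos[of "fst a"] by (auto simp: fun_eq_iff)
    ultimately show "a = a'" by (simp add: prod_eq_iff)
  qed
  have indep: "fun_space.independent (\<phi> ` I)"
  proof (rule fun_space.independent_if_scalars_zero)
    show "finite (\<phi> ` I)" using I by simp
    fix f x assume s0: "(\<Sum>x\<in>\<phi> ` I. scale_fun (f x) x) = 0" and x: "x \<in> \<phi> ` I"
    obtain a where a: "a \<in> I" "x = \<phi> a" using x by blast
    then have aJ: "fst a \<in> J" "snd a \<in> b (fst a)" by (auto simp: I_def)
    have "(\<Sum>a\<in>I. scale_fun (f (\<phi> a)) (lift (fst a) (snd a))) = 0"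
      using s0 unfolding sum.reindex[OF inj] by (simp add: \<phi>_def)
    then have "trig_norm2 (fst a) * (\<Sum>c\<in>I. if fst c = fst a then f (\<phi> c) * snd c s else 0) = 0" for s
      using coeff_sum_lift[OF I, of "fst a" "\<lambda>a. f (\<phi> a)" s] by (simp add: coeff_def)
    then have 0: "(\<Sum>c\<in>I. if fst c = fst a then f (\<phi> c) * snd c s else 0) = 0" for s
      using trig_norm2_pos[of "fst a"] by auto
    have "(\<Sum>c\<in>I. if fst c = fst a then f (\<phi> c) * snd c s else 0)
        = (\<Sum>j\<in>J. \<Sum>y\<in>b j. if j = fst a then f (\<phi> (j, y)) * y s else 0)" for s
      unfolding I_def using J b by (subst sum.Sigma) (auto simp: case_prod_beta intro!: sum.cong)
    also have "(\<Sum>j\<in>J. \<Sum>y\<in>b j. if j = fst a then f (\<phi> (j, y)) * y s else 0)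
        = (\<Sum>j\<in>J. if j = fst a then \<Sum>y\<in>b j. f (\<phi> (j, y)) * y s else 0)" for s
      by (intro sum.cong) auto
    also have "(\<Sum>j\<in>J. if j = fst a then \<Sum>y\<in>b j. f (\<phi> (j, y)) * y s else 0)
        = (\<Sum>y\<in>b (fst a). f (\<phi> (fst a, y)) * y s)" for s
      using J aJ by simp
    finally have "(\<Sum>y\<in>b (fst a). f (\<phi> (fst a, y)) * y s) = 0" for s using 0 by simp
    then have "(\<Sum>y\<in>b (fst a). scale_fun (f (\<phi> (fst a, y))) y) = 0"
      by (simp add: fun_eq_iff fun_sum_apply)
    then have "f (\<phi> (fst a, snd a)) = 0"
      using fun_space.independentD[of "b (fst a)" "b (fst a)" "\<lambda>y. f (\<phi> (fst a, y))" "snd a"] b[OF aJ(1)] aJ(2) by simp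
    then show "f x = 0" using a by simp
  qed
  have sub: "\<phi> ` I \<subseteq> eigenspace P X \<mu>"
    using modes_lift[OF S] b unfolding I_def \<phi>_def by fastforce
  have lin: "lift j y \<in> fun_space.span (\<phi> ` I)" if j: "j \<in> J" and y: "y \<in> fun_space.span (b j)" for j y
    using y
  proof (induction rule: fun_space.span_induct_alt)
    case base
    have "lift j 0 = 0" by (rule ext) (simp add: lift_def)
    then show ?case by (simp only: fun_space.span_zero)
  next
    case (step c x w)
    have "lift j (scale_fun c x + w) = scale_fun c (lift j x) + lift j w"
      by (rule ext) (simp add: lift_def add_divide_distrib algebra_simps)
    moreover have "lift j x \<in> \<phi> ` I"
      using step j unfolding I_def \<phi>_def by (intro image_eqI[of _ _ "(j, x)"]) auto
    ultimately show ?case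
      using step by (simp only: fun_space.span_add fun_space.span_scale fun_space.span_base)
  qed
  have span: "eigenspace P X \<mu> \<subseteq> fun_space.span (\<phi> ` I)"
  proof
    fix f assume f: "f \<in> eigenspace P X \<mu>"
    then have sm: "smooth f" and dp: "doubly_periodic P f" by (auto simp: eigenspace_def)
    have m: "coeff j f \<in> modes (nat \<bar>j\<bar>) \<mu>" for j by (rule coeff_modes[OF S f])
    have "coeff j f = (\<lambda>_. 0)" if "j \<notin> J" for j using m[of j] z[OF that] by blast
    from fourier_expansion[OF sm dp this J]
    have "f = (\<Sum>j\<in>J. scale_fun (1 / trig_norm2 j) (lift j (coeff j f)))"
      by (simp add: fun_eq_iff fun_sum_apply)
    also have "\<dots> \<in> fun_space.span (\<phi> ` I)"
      using b m by (intro fun_space.span_sum fun_space.span_scale lin) auto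
    finally show "f \<in> fun_space.span (\<phi> ` I)" .
  qed
  have "fun_space.dim (eigenspace P X \<mu>) = card (\<phi> ` I)"
    using fun_space.basis_card_eq_dim[OF sub span indep] by simp
  also have "\<dots> = card I" by (rule card_image[OF inj])
  also have "\<dots> = (\<Sum>j\<in>J. card (b j))" unfolding I_def using J b by (intro card_SigmaI) auto
  finally show ?thesis
    unfolding edim_def using span I by (metis finite_imageI)
qed

end

section \<open>Counting the negative eigenvalues\<close>

text \<open>
  The scale of \<open>p\<close> is free. Choosing it according to a bound of the potential makes the comparison
  rotation uniform with respect to arc length.
\<close>

lemma periodic_solutions_rescale:
  assumes "c \<noteq> 0"
  shows "periodic_solutions T (\<lambda>s. c * A s) (\<lambda>s. B s / c) = periodic_solutions T A B"
proof -
  have "solves A B y (\<lambda>s. c * p s)" if "solves (\<lambda>s. c * A s) (\<lambda>s. B s / c) y p" for y p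
    unfolding solves_def
  proof (intro allI conjI)
    fix s
    have d: "(y has_real_derivative c * A s * p s) (at s)" "(p has_real_derivative - (B s / c) * y s) (at s)"
      using that by (auto simp: solves_def)
    show "(y has_real_derivative A s * (c * p s)) (at s)" using d(1) by (simp add: mult_ac)
    show "((\<lambda>s. c * p s) has_real_derivative - B s * y s) (at s)"
      using DERIV_cmult[OF d(2), of c] assms by simp
  qed
  moreover have "solves (\<lambda>s. c * A s) (\<lambda>s. B s / c) y (\<lambda>s. p s / c)" if "solves A B y p" for y p
    unfolding solves_def
  proof (intro allI conjI)
    fix s
    have d: "(y has_real_derivative A s * p s) (at s)" "(p has_real_derivative - B s * y s) (at s)"
      using that by (auto simp: solves_def)
    show "(y has_real_derivative c * A s * (p s / c)) (at s)" using d(1) assms by simp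
    show "((\<lambda>s. p s / c) has_real_derivative - (B s / c) * y s) (at s)"
      using DERIV_cdivide[OF d(2), of c] by simp
  qed
  ultimately show ?thesis
    unfolding periodic_solutions_def by (auto; metis)
qed

context profile begin

definition mode_dim :: "nat \<Rightarrow> real \<Rightarrow> nat" where
  "mode_dim k \<mu> = fun_space.dim (modes k \<mu>)"

definition profile_length :: real where
  "profile_length = integral {0..T} wgt"

lemma cont_wgt: "continuous_on S wgt"
  by (rule smooth1_cont[OF smooth_wgt])

lemma smooth_modepot: "smooth1 (modepot k)"
proof -
  have "(r s)\<^sup>2 \<noteq> 0" "(sigma s)\<^sup>2 \<noteq> 0" for s using r_pos[of s] sigma_pos[of s] by auto
  then show ?thesis
    unfolding modepot_def[abs_def] by (intro smooth1_intros smooth_r smooth_sigma) auto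
qed

lemma per_modepot: "modepot k (s + T) = modepot k s"
  by (simp add: modepot_def per_r per_sigma)

lemma family:
  assumes "c > 0"
  shows "periodic_family T (\<lambda>s. c * wgt s) (\<lambda>s. wgt s * modepot k s / c) (\<lambda>s. wgt s / (sigma s)\<^sup>2 / c)"
proof
  have s2: "smooth1 (\<lambda>s. wgt s / (sigma s)\<^sup>2)"
  proof -
    have "(sigma s)\<^sup>2 \<noteq> 0" for s using sigma_pos[of s] by auto
    then show ?thesis by (intro smooth1_intros smooth_wgt smooth_sigma)
  qed
  show "continuous_on UNIV (\<lambda>s. c * wgt s)" "continuous_on UNIV (\<lambda>s. wgt s * modepot k s / c)"
    "continuous_on UNIV (\<lambda>s. wgt s / (sigma s)\<^sup>2 / c)"
    using assms by (intro smooth1_cont smooth1_intros smooth_wgt smooth_modepot s2; simp)+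
  show "0 < c * wgt s" "0 < wgt s / (sigma s)\<^sup>2 / c" for s
    using assms wgt_pos[of s] sigma_pos[of s] by simp_all
qed (simp_all add: T_pos per_wgt per_modepot per_sigma)

lemma modes_family:
  assumes "c > 0"
  shows "periodic_solutions T (\<lambda>s. c * wgt s) (\<lambda>s. wgt s * modepot k s / c + \<mu> * (wgt s / (sigma s)\<^sup>2 / c)) = modes k \<mu>"
proof -
  have "(\<lambda>s. wgt s * modepot k s / c + \<mu> * (wgt s / (sigma s)\<^sup>2 / c)) = (\<lambda>s. mode_coeff k \<mu> s / c)"
    using assms by (simp add: fun_eq_iff mode_coeff_def add_divide_distrib algebra_simps)
  then show ?thesis using assms by (simp add: periodic_solutions_rescale modes_def)
qed

lemma mode_dim_mult:
  assumes "c > 0"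
  shows "mode_dim k \<mu> = periodic_family.mult T (\<lambda>s. c * wgt s) (\<lambda>s. wgt s * modepot k s / c) (\<lambda>s. wgt s / (sigma s)\<^sup>2 / c) \<mu>"
proof (rule periodic_family.multiplicity_basis[OF family[OF assms], of k \<mu>])
  fix Y assume Y: "Y \<subseteq> periodic_solutions T (\<lambda>s. c * wgt s) (\<lambda>s. wgt s * modepot k s / c + \<mu> * (wgt s / (sigma s)\<^sup>2 / c))"
    "fun_space.independent Y"
    "periodic_solutions T (\<lambda>s. c * wgt s) (\<lambda>s. wgt s * modepot k s / c + \<mu> * (wgt s / (sigma s)\<^sup>2 / c)) \<subseteq> fun_space.span Y"
    "card Y = periodic_family.mult T (\<lambda>s. c * wgt s) (\<lambda>s. wgt s * modepot k s / c) (\<lambda>s. wgt s / (sigma s)\<^sup>2 / c) \<mu>"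
  show ?thesis
    using fun_space.basis_card_eq_dim[of Y "modes k \<mu>"] Y unfolding modes_family[OF assms] mode_dim_def by simp
qed

lemma modes_basis:
  obtains Y where "finite Y" "Y \<subseteq> modes k \<mu>" "fun_space.independent Y" "modes k \<mu> \<subseteq> fun_space.span Y"
    "card Y = mode_dim k \<mu>"
proof (rule periodic_family.multiplicity_basis[OF family[OF zero_less_one], of k \<mu>])
  fix Y assume "finite Y" "Y \<subseteq> periodic_solutions T (\<lambda>s. 1 * wgt s) (\<lambda>s. wgt s * modepot k s / 1 + \<mu> * (wgt s / (sigma s)\<^sup>2 / 1))"
    "fun_space.independent Y"
    "periodic_solutions T (\<lambda>s. 1 * wgt s) (\<lambda>s. wgt s * modepot k s / 1 + \<mu> * (wgt s / (sigma s)\<^sup>2 / 1)) \<subseteq> fun_space.span Y"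
    "card Y = periodic_family.mult T (\<lambda>s. 1 * wgt s) (\<lambda>s. wgt s * modepot k s / 1) (\<lambda>s. wgt s / (sigma s)\<^sup>2 / 1) \<mu>"
  then show ?thesis
    unfolding modes_family[OF zero_less_one] mode_dim_mult[OF zero_less_one, symmetric] by (rule that)
qed

lemma integral_scaled_wgt: "integral {0..T} (\<lambda>s. c * wgt s) = c * profile_length"
  by (simp add: profile_length_def)

text \<open>
  Scaled with \<open>M\<close>, the system rotates at most as fast as uniform rotation with velocity \<open>M\<close>, hence by at
  most \<open>M * profile_length\<close>.
\<close>

theorem mode_count_le:
  assumes M: "M > 0" "\<And>s. modepot k s \<le> M\<^sup>2" and N: "N \<ge> 1" "M * profile_length \<le> 2 * pi * real N"
    and S: "finite S" "S \<subseteq> {..<0}"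
  shows "(\<Sum>l\<in>S. mode_dim k l) \<le> 2 * N - 1"
proof -
  interpret family: periodic_family T "\<lambda>s. M * wgt s" "\<lambda>s. wgt s * modepot k s / M" "\<lambda>s. wgt s / (sigma s)\<^sup>2 / M"
    by (rule family[OF M(1)])
  have le: "wgt s * modepot k s / M \<le> M * wgt s" for s
    using mult_left_mono[OF M(2)[of s] less_imp_le[OF wgt_pos[of s]]] M(1)
    by (simp add: pos_divide_le_eq power2_eq_square mult_ac)
  have "family.greatest_turn 0 \<le> integral {0..T} (\<lambda>s. M * wgt s)"
    unfolding family.greatest_turn_def by (rule periodic_system.turn_le_integral[OF family.sys]) (simp add: le)
  then have "family.greatest_turn 0 \<le> 2 * pi * real N" using N(2) unfolding integral_scaled_wgt by linarith
  then show ?thesis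
    using family.sum_mult_le[OF S _ N(1)] unfolding mode_dim_mult[OF M(1)] by simp
qed

text \<open>
  If the potential exceeds \<open>m\<^sup>2\<close> somewhere, the least turn is strictly greater than
  \<open>m * profile_length\<close>; this gains the eigenvalue in the case of equality.
\<close>

theorem mode_count_ge:
  assumes m: "m > 0" "\<And>s. m\<^sup>2 \<le> modepot k s"
    and n: "2 * pi * real n < m * profile_length \<or> 2 * pi * real n \<le> m * profile_length \<and> (\<exists>s. m\<^sup>2 < modepot k s)"
  obtains S where "finite S" "S \<subseteq> {..<0}" "2 * n + 1 \<le> (\<Sum>l\<in>S. mode_dim k l)"
proof -
  interpret family: periodic_family T "\<lambda>s. m * wgt s" "\<lambda>s. wgt s * modepot k s / m" "\<lambda>s. wgt s / (sigma s)\<^sup>2 / m"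
    by (rule family[OF m(1)])
  have le: "m * wgt s \<le> wgt s * modepot k s / m" for s
    using mult_left_mono[OF m(2)[of s] less_imp_le[OF wgt_pos[of s]]] m(1)
    by (simp add: pos_le_divide_eq power2_eq_square mult_ac)
  have lt: "m * wgt s < wgt s * modepot k s / m" if "m\<^sup>2 < modepot k s" for s
    using mult_strict_left_mono[OF that wgt_pos[of s]] m(1)
    by (simp add: pos_less_divide_eq power2_eq_square mult_ac)
  have least_turn: "m * profile_length \<le> family.least_turn 0"
    unfolding family.least_turn_def integral_scaled_wgt[symmetric]
    by (rule periodic_system.integral_le_turn(1)[OF family.sys]) (simp add: le)
  have least_turn': "m * profile_length < family.least_turn 0" if "\<exists>s. m\<^sup>2 < modepot k s"
    unfolding family.least_turn_def integral_scaled_wgt[symmetric]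
    by (rule periodic_system.integral_le_turn(2)[OF family.sys]) (use that le lt in auto)
  have "2 * pi * real n < family.least_turn 0" using n
  proof
    assume "2 * pi * real n \<le> m * profile_length \<and> (\<exists>s. m\<^sup>2 < modepot k s)"
    then show ?thesis using least_turn' by (elim conjE) (rule order_le_less_trans)
  qed (use least_turn in linarith)
  then obtain S where "finite S" "S \<subseteq> {..<0}" "2 * n + 1 \<le> (\<Sum>l\<in>S. family.mult l)"
    by (rule family.sum_mult_ge)
  then show ?thesis using that unfolding mode_dim_mult[OF m(1)] by blast
qed

text \<open>
  The counterpart for the bound \<open>m = 0\<close>, which does not define a scale.
\<close>

lemma mode_count_ge_1:
  assumes "\<And>s. modepot k s \<ge> 0" "modepot k s0 > 0"
  obtains S where "finite S" "S \<subseteq> {..<0}" "1 \<le> (\<Sum>l\<in>S. mode_dim k l)"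
proof -
  interpret family: periodic_family T "\<lambda>s. 1 * wgt s" "\<lambda>s. wgt s * modepot k s / 1" "\<lambda>s. wgt s / (sigma s)\<^sup>2 / 1"
    by (rule family) simp
  have "family.least_turn 0 > 0"
    unfolding family.least_turn_def
  proof (rule periodic_system.min_turn_pos[OF family.sys, of _ s0])
    show "wgt s * modepot k s / 1 + 0 * (wgt s / (sigma s)\<^sup>2 / 1) \<ge> 0" for s
      using mult_nonneg_nonneg[OF less_imp_le[OF wgt_pos[of s]] assms(1)[of s]] by simp
    show "wgt s0 * modepot k s0 / 1 + 0 * (wgt s0 / (sigma s0)\<^sup>2 / 1) > 0"
      using mult_pos_pos[OF wgt_pos[of s0] assms(2)] by simp
  qed
  then have "2 * pi * real 0 < family.least_turn 0" by simp
  then obtain S where "finite S" "S \<subseteq> {..<0}" "2 * 0 + 1 \<le> (\<Sum>l\<in>S. family.mult l)"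
    by (rule family.sum_mult_ge)
  then show ?thesis using that unfolding mode_dim_mult[OF zero_less_one] by simp
qed

lemma no_modes:
  assumes "\<And>s. modepot k s \<le> 0" "\<mu> < 0"
  shows "mode_dim k \<mu> = 0" "modes k \<mu> \<subseteq> {\<lambda>_. 0}"
proof -
  interpret family: periodic_family T "\<lambda>s. 1 * wgt s" "\<lambda>s. wgt s * modepot k s / 1" "\<lambda>s. wgt s / (sigma s)\<^sup>2 / 1"
    by (rule family) simp
  have le: "wgt s * modepot k s / 1 + 0 * (wgt s / (sigma s)\<^sup>2 / 1) \<le> 0" for s
    using mult_left_mono[OF assms(1)[of s] less_imp_le[OF wgt_pos[of s]]] by simp
  have "family.greatest_turn 0 < pi" "family.least_turn 0 \<le> 0"
    unfolding family.greatest_turn_def family.least_turn_def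
    by (rule periodic_system.turns_nonpositive_potential[OF family.sys le])+
  then have "family.mult \<mu> = 0" using assms(2) pi_gt_zero by (intro family.no_negative_mult) linarith+
  then show d: "mode_dim k \<mu> = 0" unfolding mode_dim_mult[OF zero_less_one] .
  obtain Y where "finite Y" "card Y = 0" "modes k \<mu> \<subseteq> fun_space.span Y" using modes_basis d by metis
  then show "modes k \<mu> \<subseteq> {\<lambda>_. 0}" by (simp add: fun_space.span_empty zero_fun_def)
qed

text \<open>
  The frequency \<open>k > 0\<close> belongs to the two indices \<open>k\<close> and \<open>- k\<close>.
\<close>

lemma sum_symmetric_modes:
  fixes g :: "nat \<Rightarrow> nat"
  assumes "finite K" "0 \<notin> K"
  shows "(\<Sum>j | nat \<bar>j\<bar> \<in> insert 0 K. g (nat \<bar>j\<bar>)) = g 0 + 2 * (\<Sum>k\<in>K. g k)"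
    and "finite {j::int. nat \<bar>j\<bar> \<in> insert 0 K}"
proof -
  have eq: "{j::int. nat \<bar>j\<bar> \<in> insert 0 K} = insert 0 (int ` K \<union> (\<lambda>k. - int k) ` K)"
  proof (rule set_eqI)
    fix j :: int
    show "j \<in> {j. nat \<bar>j\<bar> \<in> insert 0 K} \<longleftrightarrow> j \<in> insert 0 (int ` K \<union> (\<lambda>k. - int k) ` K)"
      by (cases j rule: int_cases2) (auto simp: image_iff)
  qed
  show "finite {j::int. nat \<bar>j\<bar> \<in> insert 0 K}" unfolding eq using assms by simp
  have disj: "int ` K \<inter> (\<lambda>k. - int k) ` K = {}" "0 \<notin> int ` K \<union> (\<lambda>k. - int k) ` K"
  proof -
    have "int a = - int b \<longleftrightarrow> a = 0 \<and> b = 0" for a b :: nat by linarith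
    then show "int ` K \<inter> (\<lambda>k. - int k) ` K = {}" "0 \<notin> int ` K \<union> (\<lambda>k. - int k) ` K"
      using assms(2) by auto
  qed
  have "(\<Sum>j | nat \<bar>j\<bar> \<in> insert 0 K. g (nat \<bar>j\<bar>)) = g 0 + ((\<Sum>j\<in>int ` K. g (nat \<bar>j\<bar>)) + (\<Sum>j\<in>(\<lambda>k. - int k) ` K. g (nat \<bar>j\<bar>)))"
    unfolding eq using assms disj by (simp add: sum.union_disjoint)
  also have "(\<Sum>j\<in>int ` K. g (nat \<bar>j\<bar>)) = (\<Sum>k\<in>K. g k)" by (subst sum.reindex) (auto simp: inj_on_def)
  also have "(\<Sum>j\<in>(\<lambda>k. - int k) ` K. g (nat \<bar>j\<bar>)) = (\<Sum>k\<in>K. g k)" by (subst sum.reindex) (auto simp: inj_on_def)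
  finally show "(\<Sum>j | nat \<bar>j\<bar> \<in> insert 0 K. g (nat \<bar>j\<bar>)) = g 0 + 2 * (\<Sum>k\<in>K. g k)" by simp
qed

lemma edim_eigenspace:
  assumes S: "self_shrinker X" and K: "finite K" "0 \<notin> K" "\<And>k s. k \<notin> insert 0 K \<Longrightarrow> modepot k s \<le> 0"
    and \<mu>: "\<mu> < 0"
  shows "edim (eigenspace P X \<mu>) = enat (mode_dim 0 \<mu> + 2 * (\<Sum>k\<in>K. mode_dim k \<mu>))"
proof -
  have "\<exists>Y. finite Y \<and> Y \<subseteq> modes k \<mu> \<and> fun_space.independent Y \<and> modes k \<mu> \<subseteq> fun_space.span Y
      \<and> card Y = mode_dim k \<mu>" for k
    using modes_basis by metis
  then obtain Y where Y: "\<And>k. finite (Y k) \<and> Y k \<subseteq> modes k \<mu> \<and> fun_space.independent (Y k) \<and> modes k \<mu> \<subseteq> fun_space.span (Y k)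
      \<and> card (Y k) = mode_dim k \<mu>" by metis
  have "edim (eigenspace P X \<mu>) = enat (\<Sum>j | nat \<bar>j\<bar> \<in> insert 0 K. card (Y (nat \<bar>j\<bar>)))"
  proof (rule eigenspace_edim[OF S sum_symmetric_modes(2)[OF K(1,2)]])
    show "modes (nat \<bar>j\<bar>) \<mu> \<subseteq> {\<lambda>_. 0}" if "j \<notin> {j. nat \<bar>j\<bar> \<in> insert 0 K}" for j
      using that by (intro no_modes(2)[OF K(3) \<mu>]) simp
  qed (use Y in blast)
  then show ?thesis using Y sum_symmetric_modes(1)[OF K(1,2), of "\<lambda>k. mode_dim k \<mu>"] by simp
qed

lemma sum_edim_eigenspaces:
  assumes S: "self_shrinker X" and K: "finite K" "0 \<notin> K" "\<And>k s. k \<notin> insert 0 K \<Longrightarrow> modepot k s \<le> 0"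
    and R: "finite R" "R \<subseteq> {..<0}"
  shows "(\<Sum>\<mu>\<in>R. edim (eigenspace P X \<mu>)) = enat ((\<Sum>\<mu>\<in>R. mode_dim 0 \<mu>) + 2 * (\<Sum>k\<in>K. \<Sum>\<mu>\<in>R. mode_dim k \<mu>))"
proof -
  have "(\<Sum>\<mu>\<in>R. edim (eigenspace P X \<mu>)) = (\<Sum>\<mu>\<in>R. enat (mode_dim 0 \<mu> + 2 * (\<Sum>k\<in>K. mode_dim k \<mu>)))"
    by (rule sum.cong[OF refl edim_eigenspace[OF S K]]) (use R in auto)
  also have "\<dots> = enat (\<Sum>\<mu>\<in>R. mode_dim 0 \<mu> + 2 * (\<Sum>k\<in>K. mode_dim k \<mu>))"
    using R(1) by (induction R rule: finite_induct) (auto simp: zero_enat_def)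
  also have "(\<Sum>\<mu>\<in>R. mode_dim 0 \<mu> + 2 * (\<Sum>k\<in>K. mode_dim k \<mu>)) = (\<Sum>\<mu>\<in>R. mode_dim 0 \<mu>) + 2 * (\<Sum>k\<in>K. \<Sum>\<mu>\<in>R. mode_dim k \<mu>)"
    by (simp add: sum.distrib sum_distrib_left[symmetric] sum.swap[of _ K R])
  finally show ?thesis .
qed

theorem num_negative_le:
  assumes S: "self_shrinker X" and K: "finite K" "0 \<notin> K" "\<And>k s. k \<notin> insert 0 K \<Longrightarrow> modepot k s \<le> 0"
    and U: "\<And>k R. k \<in> insert 0 K \<Longrightarrow> finite R \<Longrightarrow> R \<subseteq> {..<0} \<Longrightarrow> (\<Sum>\<mu>\<in>R. mode_dim k \<mu>) \<le> U k"
  shows "num_negative_eigenvalues P X \<le> enat (U 0 + 2 * (\<Sum>k\<in>K. U k))"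
  unfolding num_negative_eigenvalues_def
proof (rule SUP_least)
  fix R assume "R \<in> {S. finite S \<and> S \<subseteq> {..<(0::real)}}"
  then have R: "finite R" "R \<subseteq> {..<0}" by auto
  have "(\<Sum>\<mu>\<in>R. mode_dim 0 \<mu>) + 2 * (\<Sum>k\<in>K. \<Sum>\<mu>\<in>R. mode_dim k \<mu>) \<le> U 0 + 2 * (\<Sum>k\<in>K. U k)"
    using U R by (intro add_mono mult_left_mono sum_mono) auto
  then show "(\<Sum>\<mu>\<in>R. edim (eigenspace P X \<mu>)) \<le> enat (U 0 + 2 * (\<Sum>k\<in>K. U k))"
    by (subst sum_edim_eigenspaces[OF S K(1,2) _ R]) (auto intro: K(3))
qed

theorem num_negative_ge:
  assumes S: "self_shrinker X" and K: "finite K" "0 \<notin> K" "\<And>k s. k \<notin> insert 0 K \<Longrightarrow> modepot k s \<le> 0"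
    and L: "\<And>k. k \<in> insert 0 K \<Longrightarrow> \<exists>R. finite R \<and> R \<subseteq> {..<0} \<and> L k \<le> (\<Sum>\<mu>\<in>R. mode_dim k \<mu>)"
  shows "enat (L 0 + 2 * (\<Sum>k\<in>K. L k)) \<le> num_negative_eigenvalues P X"
proof -
  obtain R where R: "\<And>k. k \<in> insert 0 K \<Longrightarrow> finite (R k) \<and> R k \<subseteq> {..<0} \<and> L k \<le> (\<Sum>\<mu>\<in>R k. mode_dim k \<mu>)"
    using L by metis
  define A where "A = (\<Union>k\<in>insert 0 K. R k)"
  have A: "finite A" "A \<subseteq> {..<0}" unfolding A_def using R K(1) by blast+
  have l: "L k \<le> (\<Sum>\<mu>\<in>A. mode_dim k \<mu>)" if "k \<in> insert 0 K" for k
  proof -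
    have "L k \<le> (\<Sum>\<mu>\<in>R k. mode_dim k \<mu>)" using R[OF that] by blast
    also have "\<dots> \<le> (\<Sum>\<mu>\<in>A. mode_dim k \<mu>)" by (rule sum_mono2[OF A(1)]) (use that in \<open>auto simp: A_def\<close>)
    finally show ?thesis .
  qed
  have "L 0 + 2 * (\<Sum>k\<in>K. L k) \<le> (\<Sum>\<mu>\<in>A. mode_dim 0 \<mu>) + 2 * (\<Sum>k\<in>K. \<Sum>\<mu>\<in>A. mode_dim k \<mu>)"
    using l by (intro add_mono mult_left_mono sum_mono) auto
  then have "enat (L 0 + 2 * (\<Sum>k\<in>K. L k)) \<le> (\<Sum>\<mu>\<in>A. edim (eigenspace P X \<mu>))"
    by (subst sum_edim_eigenspaces[OF S K(1,2) _ A]) (auto intro: K(3))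
  also have "\<dots> \<le> num_negative_eigenvalues P X"
    unfolding num_negative_eigenvalues_def by (rule SUP_upper) (use A in simp)
  finally show ?thesis .
qed

end

section \<open>The excluded variations\<close>

context profile begin

lemma periodic_critical_point:
  assumes d: "\<And>s. (f has_real_derivative f' s) (at s)" and "\<And>s. f (s + T) = f s"
  obtains s where "f' s = 0"
proof -
  have "continuous_on UNIV f" using d by (meson DERIV_isCont continuous_at_imp_continuous_on)
  then obtain s where s: "\<And>x. f x \<le> f s" using periodic_attains_sup[of f T] assms(2) T_pos by metis
  have "f' s = 0" by (rule DERIV_local_max[OF d zero_less_one]) (use s in blast)
  then show ?thesis by (rule that)
qed

lemma axial_direction: obtains s where "rd s = 0" "zd s \<noteq> 0"
  using periodic_critical_point[OF r_deriv per_r] regular by metis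

lemma radial_direction: obtains s where "zd s = 0" "rd s \<noteq> 0"
  using periodic_critical_point[OF z_deriv per_z] regular by metis

text \<open>
  The closed profile has points with axial and with radial tangent; their normals, rotated about the
  axis, span the space.
\<close>

lemma normal_part_zero:
  assumes "\<And>p. normal_part X w p = 0" shows "w = 0"
proof -
  have n: "w $ 1 * (- zd s / speed s * cos t) + w $ 2 * (- zd s / speed s * sin t) + w $ 3 * (rd s / speed s) = 0" for s t
    using assms[of "vector [s, t]"] by (simp add: normal_part_def unit_normal_X inner3 revolve_nth)
  obtain a where a: "rd a = 0" "zd a \<noteq> 0" by (rule axial_direction)
  obtain b where b: "zd b = 0" "rd b \<noteq> 0" by (rule radial_direction)
  have v: "speed s \<noteq> 0" for s using speed_pos[of s] by simp
  have "w $ 1 = 0" using n[of a 0] a v[of a] by simp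
  moreover have "w $ 2 = 0" using n[of a "pi / 2"] a v[of a] by simp
  moreover have "w $ 3 = 0" using n[of b 0] b v[of b] by simp
  ultimately show ?thesis by (simp add: vec_eq_iff forall_3)
qed

lemma edim_basis:
  assumes "finite B" "B \<subseteq> V" "V \<subseteq> fun_space.span B" "fun_space.independent B"
  shows "edim V = enat (card B)"
  using assms fun_space.basis_card_eq_dim[of B V] unfolding edim_def by metis

lemma edim_translation: "edim (translation_variations X) = 3"
proof -
  define N where "N i = normal_part X (axis i 1)" for i :: 3
  have expand: "normal_part X w = (\<Sum>i\<in>UNIV. scale_fun (w $ i) (N i))" for w
  proof (rule ext)
    fix p
    have "w = (\<Sum>i\<in>UNIV. (w $ i) *\<^sub>R axis i 1)" using basis_expansion[of w] by (simp add: scalar_mult_eq_scaleR)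
    then have "w \<bullet> unit_normal X p = (\<Sum>i\<in>UNIV. (w $ i) *\<^sub>R axis i 1) \<bullet> unit_normal X p" by simp
    then show "normal_part X w p = (\<Sum>i\<in>UNIV. scale_fun (w $ i) (N i)) p"
      by (simp add: normal_part_def fun_sum_apply N_def inner_sum_left)
  qed
  have inj: "inj N"
  proof (rule injI)
    fix i j assume "N i = N j"
    then have "normal_part X (axis i 1 - axis j 1) p = 0" for p
      by (simp add: N_def normal_part_def inner_diff_left fun_eq_iff)
    then have "axis i 1 - axis j 1 = (0 :: real^3)" by (rule normal_part_zero)
    then show "i = j" by (simp add: axis_eq_axis)
  qed
  have "edim (translation_variations X) = enat (card (range N))"
  proof (rule edim_basis)
    show "range N \<subseteq> translation_variations X" by (auto simp: N_def translation_variations_def)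
    have "scale_fun (w $ i) (N i) \<in> fun_space.span (range N)" for w i
      by (intro fun_space.span_scale fun_space.span_base) simp
    then show "translation_variations X \<subseteq> fun_space.span (range N)"
      unfolding translation_variations_def expand[abs_def] by (auto intro: fun_space.span_sum)
    show "fun_space.independent (range N)"
    proof (rule fun_space.independent_if_scalars_zero)
      fix f x assume z: "(\<Sum>x\<in>range N. scale_fun (f x) x) = 0" and "x \<in> range N"
      then obtain i where i: "x = N i" by blast
      have "normal_part X (\<chi> i. f (N i)) = 0"
        using z unfolding sum.reindex[OF inj] expand by simp
      then have "(\<chi> i. f (N i)) = 0" by (intro normal_part_zero) simp
      then show "f x = 0" unfolding i by (simp add: vec_eq_iff)
    qed simp
  qed simp
  also have "card (range N) = 3" using inj by (simp add: card_image)
  finally show ?thesis by (simp add: numeral_eq_enat)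
qed

text \<open>
  By the shrinker equation, a profile without mean curvature would be a ray from the origin.
\<close>

lemma mean_curvature_nonzero:
  assumes "self_shrinker X" shows "mean_curvature X \<noteq> 0"
proof
  assume z: "mean_curvature X = 0"
  have q: "zd s * r s - z s * rd s = 0" for s
  proof -
    have "mean_curvature X (vector [s, 0]) = 0" using z by simp
    then have "(z s * rd s - r s * zd s) / speed s / 2 = 0"
      using assms unfolding self_shrinker_def normal_part_X by (metis vector_2(1))
    then show ?thesis using speed_pos[of s] by (simp add: mult.commute)
  qed
  have rn: "r s \<noteq> 0" for s using r_pos[of s] by simp
  have "((\<lambda>s. z s / r s) has_real_derivative 0) (at s)" for s
    using DERIV_divide[OF z_deriv r_deriv rn, of s] q[of s] by simp
  then obtain c where c: "z s / r s = c" for s using DERIV_isconst_all by blast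
  then have "z = (\<lambda>s. c * r s)" using rn by (auto simp: field_simps)
  then have "zd s = c * rd s" for s
    using DERIV_unique[OF z_deriv] DERIV_cmult[OF r_deriv, of c] by metis
  moreover obtain a where "rd a = 0" "zd a \<noteq> 0" by (rule axial_direction)
  ultimately show False by simp
qed

lemma edim_dilation:
  assumes "self_shrinker X" shows "edim (dilation_variations X) = 1"
proof -
  have "edim (dilation_variations X) = enat (card {mean_curvature X})"
    unfolding dilation_variations_def
    by (rule edim_basis) (use mean_curvature_nonzero[OF assms] in \<open>auto simp: fun_space.dependent_single intro: fun_space.span_base\<close>)
  then show ?thesis by (simp add: one_enat_def)
qed

lemma surface_index_eq:
  assumes "self_shrinker X"
  shows "surface_index P X = ereal_of_enat (num_negative_eigenvalues P X) - 4"
proof -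
  have "ereal_of_enat (3 + 1) = 4" by (simp add: numeral_eq_enat one_enat_def)
  then show ?thesis
    unfolding surface_index_def edim_translation edim_dilation[OF assms] by simp
qed

end

section \<open>The entropy of a self-shrinker\<close>

lemma torus_fubini:
  fixes f :: "real^2 \<Rightarrow> real"
  assumes T: "T > 0" and f: "continuous_on UNIV f"
  shows "integral (cbox 0 (torus_periods T)) f = integral {0..T} (\<lambda>s. integral {0..2 * pi} (\<lambda>t. f (vector [s, t])))"
    and "integral (cbox 0 (torus_periods T)) f = integral {0..2 * pi} (\<lambda>t. integral {0..T} (\<lambda>s. f (vector [s, t])))"
proof -
  have vec: "vector [s, t] = s *\<^sub>R axis 1 1 + t *\<^sub>R axis (2::2) (1::real)" for s t
    by (simp add: vec_eq_iff forall_2)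
  have "continuous_on UNIV (\<lambda>(s, t). vector [s, t] :: real^2)"
    unfolding vec case_prod_beta by (intro continuous_intros)
  from continuous_on_compose2[OF f this]
  have c: "continuous_on S (\<lambda>(s, t). f (vector [s, t]))" for S
    by (auto simp: case_prod_beta intro: continuous_on_subset)
  define g where "g q = (q $ 1, q $ 2)" for q :: "real^2"
  define h where "h = (\<lambda>(s, t). vector [s, t] :: real^2)"
  have hg: "h (g q) = q" for q by (simp add: h_def g_def vector2_eta)
  have gh: "g (h x) = x" for x by (cases x) (simp add: h_def g_def)
  have gbox: "g ` cbox u v = cbox (u $ 1, u $ 2) (v $ 1, v $ 2)" for u v
  proof (intro equalityI subsetI)
    fix x assume x: "x \<in> cbox (u $ 1, u $ 2) (v $ 1, v $ 2)"
    have "h x \<in> cbox u v" using x by (cases x) (auto simp: h_def mem_box_cart forall_2 cbox_Pair_eq)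
    then show "x \<in> g ` cbox u v" using gh[of x] by (metis imageI)
  qed (auto simp: g_def mem_box_cart cbox_Pair_eq)
  have hbox: "h ` cbox u v = cbox (h u) (h v)" for u v
  proof -
    have "g ` cbox (h u) (h v) = cbox u v" unfolding gbox by (cases u; cases v) (simp add: h_def)
    then have "h ` g ` cbox (h u) (h v) = h ` cbox u v" by simp
    then show ?thesis by (simp add: image_image hg)
  qed
  have content: "measure lborel (g ` cbox u v) = 1 * measure lborel (cbox u v)" for u v :: "real^2"
  proof -
    have "measure lborel (cbox u v) = (if cbox u v = {} then 0 else (v $ 1 - u $ 1) * (v $ 2 - u $ 2))"
      using content_cbox_cart[of u v] by (auto simp: prod_2 UNIV_2)
    moreover have "cbox u v \<noteq> {} \<longleftrightarrow> u $ 1 \<le> v $ 1 \<and> u $ 2 \<le> v $ 2"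
      by (auto simp: interval_ne_empty_cart forall_2)
    ultimately show ?thesis
      unfolding gbox content_Pair by (auto simp: content_real_if)
  qed
  have int: "((\<lambda>(s, t). f (vector [s, t])) has_integral integral (cbox (0, 0) (T, 2 * pi)) (\<lambda>(s, t). f (vector [s, t]))) (cbox (0, 0) (T, 2 * pi))"
    by (intro integrable_integral integrable_continuous c)
  have "((\<lambda>q. (\<lambda>(s, t). f (vector [s, t])) (g q)) has_integral (1 / 1) *\<^sub>R integral (cbox (0, 0) (T, 2 * pi)) (\<lambda>(s, t). f (vector [s, t])))
      (h ` cbox (0, 0) (T, 2 * pi))"
  proof (rule has_integral_twiddle[OF _ hg gh _ _ _ content int])
    show "continuous (at x) g" for x
      unfolding g_def[abs_def] by (intro continuous_intros)
  qed (use gbox hbox in auto)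
  moreover have "h ` cbox (0, 0) (T, 2 * pi) = cbox 0 (torus_periods T)"
  proof -
    have "vector [0, 0] = (0 :: real^2)" by (simp add: vec_eq_iff forall_2)
    then show ?thesis unfolding hbox by (simp add: h_def torus_periods_def)
  qed
  ultimately have e: "integral (cbox 0 (torus_periods T)) f = integral (cbox (0, 0) (T, 2 * pi)) (\<lambda>(s, t). f (vector [s, t]))"
    by (intro integral_unique) (simp add: g_def vector2_eta)
  show "integral (cbox 0 (torus_periods T)) f = integral {0..T} (\<lambda>s. integral {0..2 * pi} (\<lambda>t. f (vector [s, t])))"
    unfolding e using integral_prod_continuous[OF c, of 0 0 T "2 * pi"] by simp
  then show "integral (cbox 0 (torus_periods T)) f = integral {0..2 * pi} (\<lambda>t. integral {0..T} (\<lambda>s. f (vector [s, t])))"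
    using integral_swap_continuous[of 0 0 T "2 * pi" "\<lambda>s t. f (vector [s, t])", OF c] by simp
qed

lemma continuous_on_vector3:
  assumes "continuous_on S a" "continuous_on S b" "continuous_on S c"
  shows "continuous_on S (\<lambda>q. vector [a q, b q, c q] :: real^3)"
proof -
  have v: "vector [x, y, w] = x *\<^sub>R axis 1 1 + y *\<^sub>R axis 2 1 + w *\<^sub>R axis (3::3) (1::real)" for x y w :: real
    by (simp add: vec_eq_iff forall_3 axis_def)
  show ?thesis unfolding v using assms by (intro continuous_intros)
qed

lemma cont_component:
  fixes h :: "real \<Rightarrow> real"
  assumes "continuous_on UNIV h" shows "continuous_on S (\<lambda>q::real^2. h (q $ i))"
  by (rule continuous_on_compose2[OF assms]) (auto intro!: continuous_intros)

lemma cont_revolve: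
  assumes "continuous_on UNIV a" "continuous_on UNIV b"
  shows "continuous_on S (revolve a b)"
  unfolding revolve_def[abs_def]
  by (intro continuous_on_vector3 continuous_intros cont_component assms)

lemma cont_rotate_tangent:
  assumes "continuous_on UNIV a"
  shows "continuous_on S (rotate_tangent a)"
  unfolding rotate_tangent_def[abs_def]
  by (intro continuous_on_vector3 continuous_intros cont_component assms)

lemma revolve_slice:
  assumes "\<And>s. (a has_real_derivative a' s) (at s)" "\<And>s. (b has_real_derivative b' s) (at s)"
  shows "((\<lambda>s. revolve a b (vector [s, t])) has_vector_derivative revolve a' b' (vector [s, t])) (at s)"
    and "((\<lambda>t. revolve a b (vector [s, t])) has_vector_derivative rotate_tangent a (vector [s, t])) (at t)"
    and "((\<lambda>t. rotate_tangent a (vector [s, t])) has_vector_derivative revolve (\<lambda>s. - a s) (\<lambda>_. 0) (vector [s, t])) (at t)"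
  unfolding revolve_def rotate_tangent_def vector_2
  by (rule has_vector_derivative_vector3; auto intro!: derivative_eq_intros assms)+

context profile begin

definition nrm :: "real^2 \<Rightarrow> real^3" where
  "nrm = revolve (\<lambda>s. - zd s / speed s) (\<lambda>s. rd s / speed s)"

abbreviation Xs where "Xs \<equiv> revolve rd zd"
abbreviation Xt where "Xt \<equiv> rotate_tangent r"

text \<open>
  The coordinate vectors and the unit normal form an orthogonal frame.
\<close>

lemma frame:
  "a \<bullet> b = (a \<bullet> Xs p) * (b \<bullet> Xs p) / (speed (p $ 1))\<^sup>2 + (a \<bullet> Xt p) * (b \<bullet> Xt p) / (r (p $ 1))\<^sup>2
     + (a \<bullet> nrm p) * (b \<bullet> nrm p)"
proof -
  define c d where "c = cos (p $ 2)" and "d = sin (p $ 2)"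
  define x y where "x = rd (p $ 1)" and "y = zd (p $ 1)"
  define v where "v = speed (p $ 1)"
  have cd: "d * d + c * c = 1" by (simp add: c_def d_def sin_cos_sq)
  have v: "v\<^sup>2 = x\<^sup>2 + y\<^sup>2" "v \<noteq> 0" using speed_sq[of "p $ 1"] speed_pos[of "p $ 1"] by (auto simp: v_def x_def y_def)
  define r0 where "r0 = r (p $ 1)"
  have r: "r0 \<noteq> 0" using r_pos[of "p $ 1"] by (simp add: r0_def)
  have t: "(a \<bullet> Xt p) * (b \<bullet> Xt p) / (r (p $ 1))\<^sup>2 = (- a $ 1 * d + a $ 2 * c) * (- b $ 1 * d + b $ 2 * c)"
    unfolding inner3 rotate_tangent_nth r0_def[symmetric] c_def[symmetric] d_def[symmetric]
    using r by (simp add: power2_eq_square field_simps)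
  have sn: "(a \<bullet> Xs p) * (b \<bullet> Xs p) / (speed (p $ 1))\<^sup>2 + (a \<bullet> nrm p) * (b \<bullet> nrm p)
     = (((a $ 1 * c + a $ 2 * d) * x + a $ 3 * y) * ((b $ 1 * c + b $ 2 * d) * x + b $ 3 * y)
       + (- (a $ 1 * c + a $ 2 * d) * y + a $ 3 * x) * (- (b $ 1 * c + b $ 2 * d) * y + b $ 3 * x)) / v\<^sup>2"
    unfolding inner3 nrm_def revolve_nth x_def[symmetric] y_def[symmetric] v_def[symmetric] c_def[symmetric] d_def[symmetric]
    using v(2) by (simp add: power2_eq_square field_simps)
  have "((a $ 1 * c + a $ 2 * d) * x + a $ 3 * y) * ((b $ 1 * c + b $ 2 * d) * x + b $ 3 * y)
       + (- (a $ 1 * c + a $ 2 * d) * y + a $ 3 * x) * (- (b $ 1 * c + b $ 2 * d) * y + b $ 3 * x)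
     = ((a $ 1 * c + a $ 2 * d) * (b $ 1 * c + b $ 2 * d) + a $ 3 * b $ 3) * v\<^sup>2"
    unfolding v(1) by (simp add: power2_eq_square algebra_simps)
  then have "(a \<bullet> Xs p) * (b \<bullet> Xs p) / (speed (p $ 1))\<^sup>2 + (a \<bullet> nrm p) * (b \<bullet> nrm p)
     = (a $ 1 * c + a $ 2 * d) * (b $ 1 * c + b $ 2 * d) + a $ 3 * b $ 3"
    unfolding sn using v(2) by simp
  moreover have "(a $ 1 * c + a $ 2 * d) * (b $ 1 * c + b $ 2 * d) + (- a $ 1 * d + a $ 2 * c) * (- b $ 1 * d + b $ 2 * c)
      = a $ 1 * b $ 1 + a $ 2 * b $ 2"
    using cd by algebra
  ultimately show ?thesis using t inner3[of a b] by linarith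
qed

text \<open>
  The Laplacian of the position vector, multiplied by the area density. It is minus the mean curvature
  times the unit normal, and the shrinker equation expresses the mean curvature by the position.
\<close>

definition lap_X :: "real^2 \<Rightarrow> real^3" where
  "lap_X = revolve (\<lambda>s. rd s * (rd s / speed s) + - (curv s * zd s) * r s - speed s)
     (\<lambda>s. rd s * (zd s / speed s) + curv s * rd s * r s)"

lemma lap_X_eq:
  assumes "self_shrinker X"
  shows "lap_X p = (- (r (p $ 1) * speed (p $ 1) / 2) * (X p \<bullet> nrm p)) *\<^sub>R nrm p"
proof -
  let ?s = "p $ 1"
  have v: "speed ?s > 0" "r ?s > 0" by (rule speed_pos r_pos)+
  have H: "- (curv ?s + par_curv ?s) = (X p \<bullet> nrm p) / 2"
    using assms unfolding self_shrinker_iff by (simp add: nrm_def inner_revolve diff_divide_distrib)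
  have c: "- (r ?s * speed ?s / 2) * (X p \<bullet> nrm p) = r ?s * speed ?s * (curv ?s + par_curv ?s)"
  proof -
    have W: "X p \<bullet> nrm p = - (2 * (curv ?s + par_curv ?s))" using H by (simp add: field_simps)
    show ?thesis unfolding W by (simp add: algebra_simps)
  qed
  have 1: "rd ?s * (rd ?s / speed ?s) + - (curv ?s * zd ?s) * r ?s - speed ?s
      = r ?s * speed ?s * (curv ?s + par_curv ?s) * (- zd ?s / speed ?s)"
  proof -
    have A: "rd ?s * (rd ?s / speed ?s) - speed ?s = - (zd ?s)\<^sup>2 / speed ?s"
    proof -
      have "(rd ?s * (rd ?s / speed ?s) - speed ?s) * speed ?s = rd ?s * rd ?s - (speed ?s)\<^sup>2"
        using v by (simp add: power2_eq_square field_simps)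
      also have "\<dots> = - (zd ?s)\<^sup>2" unfolding speed_sq by (simp add: power2_eq_square)
      finally have "(rd ?s * (rd ?s / speed ?s) - speed ?s) * speed ?s = - (zd ?s)\<^sup>2" .
      then show ?thesis by (rule eq_divide_imp[rotated]) (use v in simp)
    qed
    have "r ?s * speed ?s * (curv ?s + par_curv ?s) * (- zd ?s / speed ?s) = - (curv ?s * zd ?s) * r ?s + - (zd ?s)\<^sup>2 / speed ?s"
      using v by (simp add: par_curv_def power2_eq_square field_simps)
    with A show ?thesis by linarith
  qed
  have 2: "rd ?s * (zd ?s / speed ?s) + curv ?s * rd ?s * r ?s
      = r ?s * speed ?s * (curv ?s + par_curv ?s) * (rd ?s / speed ?s)"
    using v by (simp add: par_curv_def power2_eq_square field_simps)
  show ?thesis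
    unfolding c unfolding lap_X_def nrm_def vec_eq_iff forall_3 vector_scaleR_component revolve_nth 1 2
    by simp
qed

definition gauss :: "real^3 \<Rightarrow> real \<Rightarrow> real^3 \<Rightarrow> real" where
  "gauss c t x = exp (- ((x - c) \<bullet> (x - c)) / (4 * t))"

text \<open>
  The two summands of the divergence, multiplied by the area density, of the tangential part of the field
  \<open>b *\<^sub>R X + y\<close> weighted by a Gaussian of centre \<open>c\<close> and scale \<open>t\<close>. Each is the derivative of a
  periodic function of one coordinate.
\<close>

definition div_s :: "real^3 \<Rightarrow> real \<Rightarrow> real \<Rightarrow> real^3 \<Rightarrow> real^2 \<Rightarrow> real" where
  "div_s c t b y p = gauss c t (X p) * (- ((X p - c) \<bullet> Xs p) / (2 * t)) * ((b *\<^sub>R X p + y) \<bullet> revolve (\<lambda>s. r s * (rd s / speed s)) (\<lambda>s. r s * (zd s / speed s)) p)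
    + gauss c t (X p) * (b *\<^sub>R Xs p \<bullet> revolve (\<lambda>s. r s * (rd s / speed s)) (\<lambda>s. r s * (zd s / speed s)) p
      + (b *\<^sub>R X p + y) \<bullet> revolve (\<lambda>s. rd s * (rd s / speed s) + - (curv s * zd s) * r s) (\<lambda>s. rd s * (zd s / speed s) + curv s * rd s * r s) p)"

definition div_t :: "real^3 \<Rightarrow> real \<Rightarrow> real \<Rightarrow> real^3 \<Rightarrow> real^2 \<Rightarrow> real" where
  "div_t c t b y p = gauss c t (X p) * (- ((X p - c) \<bullet> Xt p) / (2 * t)) * ((b *\<^sub>R X p + y) \<bullet> rotate_tangent speed p)
    + gauss c t (X p) * (b *\<^sub>R Xt p \<bullet> rotate_tangent speed p + (b *\<^sub>R X p + y) \<bullet> revolve (\<lambda>s. - speed s) (\<lambda>_. 0) p)"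

lemma gauss_deriv:
  assumes "(x has_vector_derivative x') (at s)"
  shows "((\<lambda>s. gauss c t (x s)) has_real_derivative gauss c t (x s) * (- ((x s - c) \<bullet> x') / (2 * t))) (at s)"
proof -
  have d: "((\<lambda>s. x s - c) has_vector_derivative x') (at s)"
    using has_vector_derivative_diff[OF assms has_vector_derivative_const[of c]] by simp
  have "((\<lambda>s. (x s - c) \<bullet> (x s - c)) has_vector_derivative (x s - c) \<bullet> x' + x' \<bullet> (x s - c)) (at s)"
    by (rule bounded_bilinear.has_vector_derivative[OF bounded_bilinear_inner d d])
  then have "((\<lambda>s. (x s - c) \<bullet> (x s - c)) has_real_derivative 2 * ((x s - c) \<bullet> x')) (at s)"
    by (simp add: has_real_derivative_iff_has_vector_derivative inner_commute)
  then show ?thesis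
    unfolding gauss_def
    by (rule DERIV_cong[OF DERIV_chain2[OF DERIV_exp DERIV_cdivide[OF DERIV_minus]]]) simp
qed

lemma weighted_inner_deriv:
  assumes x: "(x has_vector_derivative x') (at s)" and w: "(w has_vector_derivative w') (at s)"
  shows "((\<lambda>s. gauss c t (x s) * ((b *\<^sub>R x s + y) \<bullet> w s)) has_real_derivative
     gauss c t (x s) * (- ((x s - c) \<bullet> x') / (2 * t)) * ((b *\<^sub>R x s + y) \<bullet> w s)
     + gauss c t (x s) * (b *\<^sub>R x' \<bullet> w s + (b *\<^sub>R x s + y) \<bullet> w')) (at s)"
proof -
  have "((\<lambda>s. b *\<^sub>R x s + y) has_vector_derivative b *\<^sub>R x') (at s)"
    using x by (auto intro!: derivative_eq_intros)
  from bounded_bilinear.has_vector_derivative[OF bounded_bilinear_inner this w]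
  have "((\<lambda>s. (b *\<^sub>R x s + y) \<bullet> w s) has_real_derivative (b *\<^sub>R x s + y) \<bullet> w' + b *\<^sub>R x' \<bullet> w s) (at s)"
    by (simp add: has_real_derivative_iff_has_vector_derivative)
  from DERIV_mult[OF gauss_deriv[OF x] this] show ?thesis
    by (rule DERIV_cong) (simp add: algebra_simps)
qed


lemma div_s_deriv:
  "((\<lambda>s. gauss c t (X (vector [s, a])) * ((b *\<^sub>R X (vector [s, a]) + y)
      \<bullet> revolve (\<lambda>s. r s * (rd s / speed s)) (\<lambda>s. r s * (zd s / speed s)) (vector [s, a])))
    has_real_derivative div_s c t b y (vector [s, a])) (at s)"
  unfolding div_s_def
  by (rule weighted_inner_deriv revolve_slice DERIV_mult r_deriv z_deriv tangent_deriv)+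

lemma div_t_deriv:
  "((\<lambda>a. gauss c t (X (vector [s, a])) * ((b *\<^sub>R X (vector [s, a]) + y) \<bullet> rotate_tangent speed (vector [s, a])))
    has_real_derivative div_t c t b y (vector [s, a])) (at a)"
  unfolding div_t_def
  by (rule weighted_inner_deriv revolve_slice[OF r_deriv z_deriv] revolve_slice(3)[OF speed_deriv z_deriv])+

lemma div_sum:
  assumes S: "self_shrinker X"
  shows "div_s c t b y p + div_t c t b y p = r (p $ 1) * speed (p $ 1) * gauss c t (X p) *
     (2 * b - (X p \<bullet> nrm p) * ((b *\<^sub>R X p + y) \<bullet> nrm p) / 2
      - ((X p - c) \<bullet> (b *\<^sub>R X p + y) - ((X p - c) \<bullet> nrm p) * ((b *\<^sub>R X p + y) \<bullet> nrm p)) / (2 * t))"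
proof -
  let ?s = "p $ 1"
  define U where "U = b *\<^sub>R X p + y"
  define v where "v = speed ?s"
  define q where "q = r ?s"
  have pos: "v > 0" "q > 0" unfolding v_def q_def by (rule speed_pos r_pos)+
  have Rs: "revolve (\<lambda>s. r s * (rd s / speed s)) (\<lambda>s. r s * (zd s / speed s)) p = (q / v) *\<^sub>R Xs p"
    unfolding vec_eq_iff forall_3 vector_scaleR_component revolve_nth v_def q_def by simp
  have Rt: "rotate_tangent speed p = (v / q) *\<^sub>R Xt p"
    unfolding vec_eq_iff forall_3 vector_scaleR_component rotate_tangent_nth v_def q_def using r_pos[of ?s] by simp
  have L: "revolve (\<lambda>s. rd s * (rd s / speed s) + - (curv s * zd s) * r s) (\<lambda>s. rd s * (zd s / speed s) + curv s * rd s * r s) p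
      + revolve (\<lambda>s. - speed s) (\<lambda>_. 0) p = (- (q * v / 2) * (X p \<bullet> nrm p)) *\<^sub>R nrm p"
    unfolding lap_X_eq[OF S, symmetric] v_def q_def
    unfolding vec_eq_iff forall_3 vector_add_component revolve_nth lap_X_def by (simp add: algebra_simps)
  have ss: "Xs p \<bullet> Xs p = v\<^sup>2" and tt: "Xt p \<bullet> Xt p = q\<^sup>2"
    unfolding v_def q_def speed_sq by (simp_all add: inner_revolve power2_eq_square)
  define g where "g = gauss c t (X p)"
  define xs xt us ut where "xs = (X p - c) \<bullet> Xs p" and "xt = (X p - c) \<bullet> Xt p" and "us = U \<bullet> Xs p" and "ut = U \<bullet> Xt p"
  have LU: "U \<bullet> revolve (\<lambda>s. rd s * (rd s / speed s) + - (curv s * zd s) * r s) (\<lambda>s. rd s * (zd s / speed s) + curv s * rd s * r s) p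
      + U \<bullet> revolve (\<lambda>s. - speed s) (\<lambda>_. 0) p = - (q * v / 2) * (X p \<bullet> nrm p) * (U \<bullet> nrm p)"
    unfolding inner_add_right[symmetric] L by simp
  have fr: "(X p - c) \<bullet> U - ((X p - c) \<bullet> nrm p) * (U \<bullet> nrm p) = xs * us / v\<^sup>2 + xt * ut / q\<^sup>2"
    unfolding frame[of "X p - c" U p] xs_def xt_def us_def ut_def v_def q_def by simp
  have ds: "div_s c t b y p = g * (- xs / (2 * t)) * (q / v * us) + g * (b * (q / v * v\<^sup>2)
      + U \<bullet> revolve (\<lambda>s. rd s * (rd s / speed s) + - (curv s * zd s) * r s) (\<lambda>s. rd s * (zd s / speed s) + curv s * rd s * r s) p)"
    unfolding div_s_def Rs U_def[symmetric] g_def[symmetric] inner_scaleR_right inner_scaleR_left ss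
      xs_def[symmetric] us_def[symmetric] by simp
  have dt: "div_t c t b y p = g * (- xt / (2 * t)) * (v / q * ut) + g * (b * (v / q * q\<^sup>2)
      + U \<bullet> revolve (\<lambda>s. - speed s) (\<lambda>_. 0) p)"
    unfolding div_t_def Rt U_def[symmetric] g_def[symmetric] inner_scaleR_right inner_scaleR_left tt
      xt_def[symmetric] ut_def[symmetric] by simp
  have "div_s c t b y p + div_t c t b y p =
      - (g / (2 * t)) * (q / v * (xs * us) + v / q * (xt * ut)) + g * (b * (q / v * v\<^sup>2) + b * (v / q * q\<^sup>2))
      + g * (- (q * v / 2) * (X p \<bullet> nrm p) * (U \<bullet> nrm p))"
    unfolding ds dt LU[symmetric] by (simp add: algebra_simps)
  also have "q / v * (xs * us) + v / q * (xt * ut) = q * v * (xs * us / v\<^sup>2 + xt * ut / q\<^sup>2)"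
    using pos by (simp add: power2_eq_square field_simps)
  also have "b * (q / v * v\<^sup>2) + b * (v / q * q\<^sup>2) = q * v * (2 * b)"
    using pos by (simp add: power2_eq_square field_simps)
  finally have sum: "div_s c t b y p + div_t c t b y p =
      - (g / (2 * t)) * (q * v * (xs * us / v\<^sup>2 + xt * ut / q\<^sup>2)) + g * (q * v * (2 * b))
      + g * (- (q * v / 2) * (X p \<bullet> nrm p) * (U \<bullet> nrm p))" .
  have "- (g / (2 * t)) * (q * v * w) + g * (q * v * (2 * b)) + g * (- (q * v / 2) * m * n)
      = q * v * g * (2 * b - m * n / 2 - w / (2 * t))" for w m n
    by (simp add: algebra_simps)
  then show ?thesis
    unfolding sum U_def[symmetric] g_def[symmetric] v_def[symmetric] q_def[symmetric] fr .
qed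

end

lemma gauss_expand:
  "(x - \<tau> *\<^sub>R y) \<bullet> (x - \<tau> *\<^sub>R y) = x \<bullet> x - 2 * \<tau> * (x \<bullet> y) + \<tau>\<^sup>2 * (y \<bullet> y)" for x y :: "real^3"
  by (simp add: inner_diff_left inner_diff_right inner_commute power2_eq_square algebra_simps)

context profile begin

lemma gauss_path_deriv:
  assumes t: "1 + b * \<tau>\<^sup>2 \<noteq> 0"
  shows "((\<lambda>\<tau>. gauss (\<tau> *\<^sub>R y) (1 + b * \<tau>\<^sup>2) x / (1 + b * \<tau>\<^sup>2)) has_real_derivative
     gauss (\<tau> *\<^sub>R y) (1 + b * \<tau>\<^sup>2) x * (- (2 * b * \<tau>) / (1 + b * \<tau>\<^sup>2)\<^sup>2
       + ((x - \<tau> *\<^sub>R y) \<bullet> ((b * \<tau>) *\<^sub>R x + y)) / (2 * (1 + b * \<tau>\<^sup>2) ^ 3))) (at \<tau>)"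
proof -
  define t where "t = 1 + b * \<tau>\<^sup>2"
  define xx xy yy where "xx = x \<bullet> x" and "xy = x \<bullet> y" and "yy = y \<bullet> y"
  define Q where "Q \<tau> = xx - 2 * \<tau> * xy + \<tau>\<^sup>2 * yy" for \<tau> :: real
  have t0: "t \<noteq> 0" using t by (simp add: t_def)
  have g: "gauss (\<tau> *\<^sub>R y) t x = exp (- Q \<tau> / (4 * t))" for \<tau> t
    by (simp add: gauss_def gauss_expand Q_def xx_def xy_def yy_def)
  have Q: "(Q has_real_derivative - 2 * xy + 2 * \<tau> * yy) (at \<tau>)"
    unfolding Q_def[abs_def] by (auto intro!: derivative_eq_intros)
  have T: "((\<lambda>\<tau>. 1 + b * \<tau>\<^sup>2) has_real_derivative 2 * b * \<tau>) (at \<tau>)"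
    by (auto intro!: derivative_eq_intros)
  have T4: "((\<lambda>\<tau>. 4 * (1 + b * \<tau>\<^sup>2)) has_real_derivative 4 * (2 * b * \<tau>)) (at \<tau>)"
    by (rule DERIV_cmult[OF T])
  have "((\<lambda>\<tau>. - Q \<tau> / (4 * (1 + b * \<tau>\<^sup>2))) has_real_derivative
      (- (- 2 * xy + 2 * \<tau> * yy) * (4 * t) - - Q \<tau> * (4 * (2 * b * \<tau>))) / ((4 * t) * (4 * t))) (at \<tau>)"
    unfolding t_def by (rule DERIV_divide[OF DERIV_minus[OF Q] T4]) (use t in simp)
  from DERIV_divide[OF DERIV_chain2[OF DERIV_exp this] T t]
  have d: "((\<lambda>\<tau>. exp (- Q \<tau> / (4 * (1 + b * \<tau>\<^sup>2))) / (1 + b * \<tau>\<^sup>2)) has_real_derivative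
     (exp (- Q \<tau> / (4 * t)) * ((- (- 2 * xy + 2 * \<tau> * yy) * (4 * t) - - Q \<tau> * (4 * (2 * b * \<tau>))) / ((4 * t) * (4 * t))) * t
       - exp (- Q \<tau> / (4 * t)) * (2 * b * \<tau>)) / (t * t)) (at \<tau>)"
    unfolding t_def .
  have e: "(x - \<tau> *\<^sub>R y) \<bullet> ((b * \<tau>) *\<^sub>R x + y) = b * \<tau> * xx + xy - \<tau> * (b * \<tau>) * xy - \<tau> * yy"
    by (simp add: inner_diff_left inner_add_right inner_commute xx_def xy_def yy_def algebra_simps)
  have num: "(xy - \<tau> * yy) * t + Q \<tau> * (b * \<tau>) = b * \<tau> * xx + xy - \<tau> * (b * \<tau>) * xy - \<tau> * yy"
    by (simp add: Q_def t_def power2_eq_square algebra_simps)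
  have "(E * ((- (- 2 * xy + 2 * \<tau> * yy) * (4 * t) - - Q \<tau> * (4 * (2 * b * \<tau>))) / ((4 * t) * (4 * t))) * t
       - E * (2 * b * \<tau>)) / (t * t) = E * (- (2 * b * \<tau>) / t\<^sup>2 + ((xy - \<tau> * yy) * t + Q \<tau> * (b * \<tau>)) / (2 * t ^ 3))" for E
    using t0 by (simp add: power2_eq_square power3_eq_cube field_simps)
  then show ?thesis
    using d unfolding g t_def[symmetric] e num by simp
qed

text \<open>
  The Gaussian area element with the centre \<open>\<tau> *\<^sub>R y\<close> and the scale \<open>1 + b * \<tau>\<^sup>2\<close>; at \<open>\<tau> = 0\<close> it is that of
  the \<open>F\<close>-functional, and every centre and scale is reached at \<open>\<tau> = 1\<close>.
\<close>

definition heat :: "real \<Rightarrow> real^3 \<Rightarrow> real \<Rightarrow> real^2 \<Rightarrow> real" where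
  "heat b y \<tau> p = speed (p $ 1) * r (p $ 1) * (gauss (\<tau> *\<^sub>R y) (1 + b * \<tau>\<^sup>2) (X p) / (1 + b * \<tau>\<^sup>2))"

definition heat' :: "real \<Rightarrow> real^3 \<Rightarrow> real \<Rightarrow> real^2 \<Rightarrow> real" where
  "heat' b y \<tau> p = speed (p $ 1) * r (p $ 1) * (gauss (\<tau> *\<^sub>R y) (1 + b * \<tau>\<^sup>2) (X p) * (- (2 * b * \<tau>) / (1 + b * \<tau>\<^sup>2)\<^sup>2
       + ((X p - \<tau> *\<^sub>R y) \<bullet> ((b * \<tau>) *\<^sub>R X p + y)) / (2 * (1 + b * \<tau>\<^sup>2) ^ 3)))"

text \<open>
  The choice of the path: the derivative of the exponent in \<open>\<tau>\<close> pairs \<open>X - \<tau> *\<^sub>R y\<close> with the field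
  \<open>(b * \<tau>) *\<^sub>R X + y\<close>. Subtracting the divergence of this field leaves only normal components, and
  there the shrinker equation completes the square.
\<close>

lemma heat'_eq:
  assumes S: "self_shrinker X" and t: "1 + b * \<tau>\<^sup>2 \<noteq> 0"
  shows "heat' b y \<tau> p = - (1 / (1 + b * \<tau>\<^sup>2)\<^sup>2) * (div_s (\<tau> *\<^sub>R y) (1 + b * \<tau>\<^sup>2) (b * \<tau>) y p + div_t (\<tau> *\<^sub>R y) (1 + b * \<tau>\<^sup>2) (b * \<tau>) y p)
     - speed (p $ 1) * r (p $ 1) * gauss (\<tau> *\<^sub>R y) (1 + b * \<tau>\<^sup>2) (X p) * (\<tau> * (((b * \<tau>) *\<^sub>R X p + y) \<bullet> nrm p)\<^sup>2 / (2 * (1 + b * \<tau>\<^sup>2) ^ 3))"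
proof -
  define t where "t = 1 + b * \<tau>\<^sup>2"
  have t0: "t \<noteq> 0" using t by (simp add: t_def)
  define m where "m = X p \<bullet> nrm p"
  define n where "n = y \<bullet> nrm p"
  define W where "W = (X p - \<tau> *\<^sub>R y) \<bullet> ((b * \<tau>) *\<^sub>R X p + y)"
  define g where "g = gauss (\<tau> *\<^sub>R y) t (X p)"
  define f where "f = speed (p $ 1) * r (p $ 1)"
  have u: "((b * \<tau>) *\<^sub>R X p + y) \<bullet> nrm p = b * \<tau> * m + n" "(X p - \<tau> *\<^sub>R y) \<bullet> nrm p = m - \<tau> * n"
    by (simp_all add: inner_add_left inner_diff_left m_def n_def)
  have D: "div_s (\<tau> *\<^sub>R y) t (b * \<tau>) y p + div_t (\<tau> *\<^sub>R y) t (b * \<tau>) y p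
     = f * g * (2 * (b * \<tau>) - m * (b * \<tau> * m + n) / 2 - (W - (m - \<tau> * n) * (b * \<tau> * m + n)) / (2 * t))"
    unfolding div_sum[OF S] u W_def[symmetric] m_def[symmetric] g_def[symmetric] by (simp add: f_def mult.commute)
  have k: "t * m - (m - \<tau> * n) = \<tau> * (b * \<tau> * m + n)"
    by (simp add: t_def power2_eq_square algebra_simps)
  have "- (1 / t\<^sup>2) * (f * g * (2 * (b * \<tau>) - m * v / 2 - (W - k * v) / (2 * t))) - f * g * ((t * m - k) * v / (2 * t ^ 3))
      = f * (g * (- (2 * b * \<tau>) / t\<^sup>2 + W / (2 * t ^ 3)))" for v k
    using t0 by (simp add: power2_eq_square power3_eq_cube field_simps)
  from this[of "b * \<tau> * m + n" "m - \<tau> * n"] show ?thesis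
    unfolding heat'_def t_def[symmetric] W_def[symmetric] g_def[symmetric] f_def[symmetric] u D k
    by (simp add: power2_eq_square mult.assoc)
qed

lemma cont_profile:
  "continuous_on S r" "continuous_on S z" "continuous_on S rd" "continuous_on S zd" "continuous_on S rdd"
  "continuous_on S zdd" "continuous_on S speed" "continuous_on S curv"
proof -
  show "continuous_on S r" "continuous_on S z" "continuous_on S rd" "continuous_on S zd" "continuous_on S rdd"
    "continuous_on S zdd" "continuous_on S speed"
    by (rule smooth1_cont smooth_r smooth_z smooth_rd smooth_zd smooth_rdd smooth_zdd smooth_speed)+
  then show "continuous_on S curv"
    unfolding curv_def[abs_def] using speed_pos by (intro continuous_intros) (auto simp: less_imp_neq[symmetric])
qed

lemma speed_nz: "speed s \<noteq> 0"
  using speed_pos[of s] by simp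

lemma cont_surface:
  "continuous_on S X" "continuous_on S Xs" "continuous_on S Xt"
  "continuous_on S (\<lambda>q::real^2. speed (q $ 1))" "continuous_on S (\<lambda>q::real^2. r (q $ 1))"
proof -
  show "continuous_on S X" "continuous_on S Xs" "continuous_on S Xt"
    by (rule cont_revolve cont_rotate_tangent cont_profile)+
  show "continuous_on S (\<lambda>q::real^2. speed (q $ 1))" "continuous_on S (\<lambda>q::real^2. r (q $ 1))"
    by (rule cont_component cont_profile)+
qed

lemma cont_gauss:
  assumes "continuous_on S x" "continuous_on S c" "continuous_on S t" "\<And>q. q \<in> S \<Longrightarrow> t q \<noteq> 0"
  shows "continuous_on S (\<lambda>q. gauss (c q) (t q) (x q))"
  unfolding gauss_def using assms by (intro continuous_intros) auto

lemma cont_div: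
  assumes "t \<noteq> 0"
  shows "continuous_on S (div_s c t b y)" "continuous_on S (div_t c t b y)"
proof -
  have g: "continuous_on S (\<lambda>p. gauss c t (X p))"
    by (intro cont_gauss cont_surface continuous_on_const) (use assms in simp)
  have a: "continuous_on S (revolve (\<lambda>s. r s * (rd s / speed s)) (\<lambda>s. r s * (zd s / speed s)))"
    "continuous_on S (revolve (\<lambda>s. rd s * (rd s / speed s) + - (curv s * zd s) * r s) (\<lambda>s. rd s * (zd s / speed s) + curv s * rd s * r s))"
    "continuous_on S (rotate_tangent speed)" "continuous_on S (revolve (\<lambda>s. - speed s) (\<lambda>_. 0))"
    by (intro cont_revolve cont_rotate_tangent continuous_intros cont_profile; simp add: speed_nz)+
  show "continuous_on S (div_s c t b y)" "continuous_on S (div_t c t b y)"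
    unfolding div_s_def[abs_def] div_t_def[abs_def]
    by (intro continuous_intros g a cont_surface; use assms in simp)+
qed

lemma div_integral:
  assumes t: "t \<noteq> 0"
  shows "((\<lambda>p. div_s c t b y p + div_t c t b y p) has_integral 0) (cbox 0 P)"
proof -
  have per: "revolve f g (vector [s + T, a]) = revolve f g (vector [s, a])"
    if "\<And>s. f (s + T) = f s" "\<And>s. g (s + T) = g s" for f g s a
    using that by (simp add: revolve_def)
  have "((\<lambda>s. div_s c t b y (vector [s, a])) has_integral 0) {0..T}" for a
  proof -
    let ?W = "\<lambda>s. gauss c t (X (vector [s, a])) * ((b *\<^sub>R X (vector [s, a]) + y)
      \<bullet> revolve (\<lambda>s. r s * (rd s / speed s)) (\<lambda>s. r s * (zd s / speed s)) (vector [s, a]))"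
    have "((\<lambda>s. div_s c t b y (vector [s, a])) has_integral ?W T - ?W 0) {0..T}"
      by (rule fundamental_theorem_of_calculus)
        (use T_pos div_s_deriv in \<open>auto simp: has_real_derivative_iff_has_vector_derivative[symmetric] intro: has_field_derivative_at_within\<close>)
    moreover have "?W T = ?W 0"
      using per[of r z 0 a] per[of "\<lambda>s. r s * (rd s / speed s)" "\<lambda>s. r s * (zd s / speed s)" 0 a]
      by (simp add: per_r per_z per_rd per_zd per_speed)
    ultimately show ?thesis by simp
  qed
  then have "integral {0..T} (\<lambda>s. div_s c t b y (vector [s, a])) = 0" for a by (rule integral_unique)
  then have "integral (cbox 0 P) (div_s c t b y) = 0"
    unfolding torus_fubini(2)[OF T_pos cont_div(1)[OF t]] by simp
  then have s: "(div_s c t b y has_integral 0) (cbox 0 P)"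
    by (metis cont_div(1)[OF t] integrable_continuous integrable_integral)
  have "((\<lambda>a. div_t c t b y (vector [s, a])) has_integral 0) {0..2 * pi}" for s
  proof -
    let ?W = "\<lambda>a. gauss c t (X (vector [s, a])) * ((b *\<^sub>R X (vector [s, a]) + y) \<bullet> rotate_tangent speed (vector [s, a]))"
    have "((\<lambda>a. div_t c t b y (vector [s, a])) has_integral ?W (2 * pi) - ?W 0) {0..2 * pi}"
      by (rule fundamental_theorem_of_calculus)
        (use div_t_deriv in \<open>auto simp: has_real_derivative_iff_has_vector_derivative[symmetric] intro: has_field_derivative_at_within\<close>)
    moreover have "?W (2 * pi) = ?W 0" by (simp add: revolve_def rotate_tangent_def)
    ultimately show ?thesis by simp
  qed
  then have "integral {0..2 * pi} (\<lambda>a. div_t c t b y (vector [s, a])) = 0" for s by (rule integral_unique)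
  then have "integral (cbox 0 P) (div_t c t b y) = 0"
    unfolding torus_fubini(1)[OF T_pos cont_div(2)[OF t]] by simp
  then have "(div_t c t b y has_integral 0) (cbox 0 P)"
    by (metis cont_div(2)[OF t] integrable_continuous integrable_integral)
  from has_integral_add[OF s this] show ?thesis by simp
qed

lemma heat_decreasing:
  assumes S: "self_shrinker X" and b: "b > -1"
  shows "integral (cbox 0 P) (heat b y 1) \<le> integral (cbox 0 P) (heat b y 0)"
proof -
  have t: "1 + b * \<tau>\<^sup>2 > 0" if "\<tau> \<in> {0..1}" for \<tau>
  proof (cases "b \<ge> 0")
    case False
    have "\<tau>\<^sup>2 \<le> 1" using that by (simp add: abs_square_le_1)
    then have "b * 1 \<le> b * \<tau>\<^sup>2" using False by (intro mult_left_mono_neg) auto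
    then show ?thesis using b by linarith
  qed (simp add: add_pos_nonneg)
  have cont: "continuous_on ({0..1} \<times> cbox 0 P) (\<lambda>(\<tau>, p). heat' b y \<tau> p)"
  proof -
    have cX: "continuous_on A (\<lambda>q. X (snd q))" "continuous_on A (\<lambda>q. speed (snd q $ 1))" "continuous_on A (\<lambda>q. r (snd q $ 1))"
      for A :: "(real \<times> (real^2)) set"
      by (rule continuous_on_compose2[OF cont_surface(1)[of UNIV]] continuous_on_compose2[OF cont_surface(4)[of UNIV]]
          continuous_on_compose2[OF cont_surface(5)[of UNIV]]; auto intro!: continuous_intros)+
    have nz: "1 + b * (fst q)\<^sup>2 \<noteq> 0" if "q \<in> {0..1} \<times> cbox 0 P" for q
      using t[of "fst q"] that by auto
    show ?thesis
      unfolding heat'_def case_prod_beta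
      by (intro continuous_intros cont_gauss cX) (use nz in auto)
  qed
  have ch: "continuous_on (cbox 0 P) (heat b y \<tau>)" if "\<tau> \<in> {0..1}" for \<tau>
    unfolding heat_def[abs_def] using t[OF that] by (intro continuous_intros cont_gauss cont_surface) auto
  have d: "((\<lambda>\<tau>. integral (cbox 0 P) (heat b y \<tau>)) has_real_derivative integral (cbox 0 P) (heat' b y \<tau>)) (at \<tau> within {0..1})"
    if "\<tau> \<in> {0..1}" for \<tau>
  proof (rule leibniz_rule_field_derivative[OF _ _ cont that])
    fix \<tau> p assume \<tau>: "\<tau> \<in> {0..1::real}"
    have nz: "1 + b * \<tau>\<^sup>2 \<noteq> 0" using t[OF \<tau>] by simp
    show "((\<lambda>\<tau>. heat b y \<tau> p) has_real_derivative heat' b y \<tau> p) (at \<tau> within {0..1})"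
      unfolding heat_def heat'_def
      by (rule has_field_derivative_at_within[OF DERIV_cmult[OF gauss_path_deriv[OF nz]]])
  next
    fix \<tau> assume "\<tau> \<in> {0..1::real}"
    then show "heat b y \<tau> integrable_on cbox 0 P" by (intro integrable_continuous ch)
  qed simp
  have neg: "integral (cbox 0 P) (heat' b y \<tau>) \<le> 0" if "\<tau> \<in> {0..1}" for \<tau>
  proof -
    let ?t = "1 + b * \<tau>\<^sup>2"
    have tp: "?t > 0" by (rule t[OF that])
    let ?D = "\<lambda>p. div_s (\<tau> *\<^sub>R y) ?t (b * \<tau>) y p + div_t (\<tau> *\<^sub>R y) ?t (b * \<tau>) y p"
    have D: "((\<lambda>p. - (1 / ?t\<^sup>2) * ?D p) has_integral 0) (cbox 0 P)"
    proof -
      have "(?D has_integral 0) (cbox 0 P)" by (rule div_integral) (use tp in simp)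
      from has_integral_mult_right[OF this, of "- (1 / ?t\<^sup>2)"] show ?thesis by simp
    qed
    have "continuous_on (cbox 0 P) (heat' b y \<tau>)"
    proof -
      have c: "continuous_on (cbox 0 P) (\<lambda>p. (\<tau>, p))" by (intro continuous_intros)
      have "(\<lambda>p. (\<tau>, p)) ` cbox 0 P \<subseteq> {0..1} \<times> cbox 0 P" using that by blast
      from continuous_on_compose2[OF cont c this] show ?thesis by simp
    qed
    then have "(heat' b y \<tau> has_integral integral (cbox 0 P) (heat' b y \<tau>)) (cbox 0 P)"
      by (intro integrable_integral integrable_continuous)
    moreover have "heat' b y \<tau> p \<le> - (1 / ?t\<^sup>2) * ?D p" for p
    proof -
      have "speed (p $ 1) * r (p $ 1) * gauss (\<tau> *\<^sub>R y) ?t (X p) * (\<tau> * (((b * \<tau>) *\<^sub>R X p + y) \<bullet> nrm p)\<^sup>2 / (2 * ?t ^ 3)) \<ge> 0"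
        using speed_pos[of "p $ 1"] r_pos[of "p $ 1"] tp that by (simp add: gauss_def)
      then show ?thesis using heat'_eq[OF S, of b \<tau> y p] tp by linarith
    qed
    ultimately show ?thesis by (rule has_integral_le[OF _ D])
  qed
  have "continuous_on {0..1} (\<lambda>\<tau>. integral (cbox 0 P) (heat b y \<tau>))"
    by (rule DERIV_continuous_on[OF d])
  moreover have "\<exists>D. ((\<lambda>\<tau>. integral (cbox 0 P) (heat b y \<tau>)) has_real_derivative D) (at \<tau>) \<and> D \<le> 0"
    if "0 < \<tau>" "\<tau> < 1" for \<tau>
    using d[of \<tau>] neg[of \<tau>] that by (auto simp: at_within_Icc_at)
  ultimately show ?thesis
    by (intro DERIV_nonpos_imp_decreasing_open[of 0 1 "\<lambda>\<tau>. integral (cbox 0 P) (heat b y \<tau>)"]) auto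
qed

lemma pd_affine: "pd i (\<lambda>p. x0 + a *\<^sub>R X p) p = a *\<^sub>R pd i X p"
proof -
  have "((\<lambda>t. X (p + t *\<^sub>R axis i 1)) has_vector_derivative pd i X p) (at 0)"
  proof -
    have "((\<lambda>t. X (p + t *\<^sub>R axis 1 1)) has_vector_derivative Xs p) (at 0)"
      "((\<lambda>t. X (p + t *\<^sub>R axis 2 1)) has_vector_derivative Xt p) (at 0)"
      unfolding revolve_def[abs_def] rotate_tangent_def
      by (rule has_vector_derivative_vector3; auto intro!: derivative_eq_intros shift_deriv[OF r_deriv] shift_deriv[OF z_deriv])+
    then show ?thesis using exhaust_2[of i] pd_X by metis
  qed
  then have "((\<lambda>t. x0 + a *\<^sub>R X (p + t *\<^sub>R axis i 1)) has_vector_derivative a *\<^sub>R pd i X p) (at 0)"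
    by (auto intro!: derivative_eq_intros)
  then show ?thesis by (rule pd_eqI)
qed

lemma area_density_affine:
  assumes "a > 0"
  shows "area_density (\<lambda>p. x0 + a *\<^sub>R X p) p = a\<^sup>2 * (speed (p $ 1) * r (p $ 1))"
proof -
  have "metric (\<lambda>p. x0 + a *\<^sub>R X p) p = diag2 ((a * speed (p $ 1))\<^sup>2) ((a * r (p $ 1))\<^sup>2)"
    by (rule vec2_eqI) (simp_all add: metric_def pd_affine pd_X inner_revolve power_mult_distrib speed_sq, simp_all add: power2_eq_square)
  then show ?thesis
    using assms speed_pos[of "p $ 1"] r_pos[of "p $ 1"]
    by (simp add: area_density_def det_diag2 real_sqrt_mult power2_eq_square)
qed

lemma F_functional_affine:
  assumes "t0 > 0"
  shows "F_functional P (\<lambda>p. x0 + sqrt t0 *\<^sub>R X p)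
     = 1 / (4 * pi) * integral (cbox 0 P) (heat (1 / t0 - 1) (- (1 / sqrt t0) *\<^sub>R x0) 1)"
proof -
  let ?a = "sqrt t0"
  have a: "?a > 0" "?a\<^sup>2 = t0" using assms by simp_all
  have "exp (- (norm (x0 + ?a *\<^sub>R X p))\<^sup>2 / 4) * area_density (\<lambda>p. x0 + ?a *\<^sub>R X p) p
      = heat (1 / t0 - 1) (- (1 / ?a) *\<^sub>R x0) 1 p" for p
  proof -
    have "x0 + ?a *\<^sub>R X p = ?a *\<^sub>R (X p - - (1 / ?a) *\<^sub>R x0)"
      using assms by (simp add: scaleR_add_right add.commute)
    then have "(norm (x0 + ?a *\<^sub>R X p))\<^sup>2 = t0 * ((X p - - (1 / ?a) *\<^sub>R x0) \<bullet> (X p - - (1 / ?a) *\<^sub>R x0))"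
      using a by (simp add: power_mult_distrib power2_norm_eq_inner)
    then have "exp (- (norm (x0 + ?a *\<^sub>R X p))\<^sup>2 / 4) = gauss (1 *\<^sub>R (- (1 / ?a) *\<^sub>R x0)) (1 + (1 / t0 - 1) * 1\<^sup>2) (X p)"
      using assms by (simp add: gauss_def)
    then show ?thesis
      unfolding area_density_affine[OF a(1)] heat_def a(2) using assms by simp
  qed
  then show ?thesis unfolding F_functional_def by presburger
qed

lemma F_functional_X: "F_functional P X = profile_length"
proof -
  have e: "exp (- (norm (X p))\<^sup>2 / 4) * area_density X p = 2 * wgt (p $ 1)" for p
    unfolding norm_X area_density_X wgt_def sigma_def by simp
  have c: "continuous_on UNIV (\<lambda>p::real^2. 2 * wgt (p $ 1))"
    by (intro continuous_intros continuous_on_compose2[OF cont_wgt[of UNIV]]) auto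
  have "integral (cbox 0 P) (\<lambda>p. 2 * wgt (p $ 1)) = 4 * pi * profile_length"
    unfolding torus_fubini(1)[OF T_pos c] by (simp add: profile_length_def)
  then show ?thesis unfolding F_functional_def e by simp
qed

text \<open>
  Decrease along the paths shows that the supremum over centres and scales is attained by the surface
  itself.
\<close>

theorem entropy_eq_length:
  assumes S: "self_shrinker X"
  shows "surface_entropy P X = profile_length"
proof -
  have le: "F_functional P (\<lambda>p. x0 + sqrt t0 *\<^sub>R X p) \<le> F_functional P X" if "t0 > 0" for x0 t0
  proof -
    have b: "1 / t0 - 1 > -1" using that by simp
    have "heat (1 / t0 - 1) y 0 = (\<lambda>p. exp (- (norm (X p))\<^sup>2 / 4) * area_density X p)" for y
      by (rule ext) (simp add: heat_def gauss_def area_density_X power2_norm_eq_inner)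
    then have "F_functional P X = 1 / (4 * pi) * integral (cbox 0 P) (heat (1 / t0 - 1) (- (1 / sqrt t0) *\<^sub>R x0) 0)"
      unfolding F_functional_def by simp
    then show ?thesis
      unfolding F_functional_affine[OF that] using heat_decreasing[OF S b, of "- (1 / sqrt t0) *\<^sub>R x0"]
      by (simp add: divide_right_mono)
  qed
  have "surface_entropy P X = F_functional P X"
    unfolding surface_entropy_def
  proof (rule cSup_eq_maximum)
    have "F_functional P X = (\<lambda>(x0, t0). F_functional P (\<lambda>p. x0 + sqrt t0 *\<^sub>R X p)) (0, 1)" by simp
    then show "F_functional P X \<in> (\<lambda>(x0, t0). F_functional P (\<lambda>p. x0 + sqrt t0 *\<^sub>R X p)) ` (UNIV \<times> {0<..})"
      by (rule image_eqI) simp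
  qed (use le in auto)
  then show ?thesis by (simp add: F_functional_X)
qed

end

section \<open>The index bounds\<close>

context profile begin

lemma axis_dist_X: "axis_dist (X p) = r (p $ 1)"
proof -
  have "(X p $ 1)\<^sup>2 + (X p $ 2)\<^sup>2 = (r (p $ 1))\<^sup>2 * ((cos (p $ 2))\<^sup>2 + (sin (p $ 2))\<^sup>2)"
    unfolding revolve_nth by (simp only: power_mult_distrib distrib_left)
  then show ?thesis unfolding axis_dist_def using r_pos[of "p $ 1"] by simp
qed

lemma weight_X: "weight (X p) = sigma (p $ 1)"
  by (simp add: weight_def axis_dist_X norm_X sigma_def)

lemma modepot_radicand: "modepot k (p $ 1) = radicand k (X p) / (sigma (p $ 1))\<^sup>2"
  by (simp add: modepot_def radicand_def axis_dist_X)

lemma mode_fun_X: "mode_fun k (X p) = sqrt (modepot k (p $ 1))"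
  using sigma_pos[of "p $ 1"]
  by (simp add: mode_fun_def weight_X modepot_radicand real_sqrt_divide inverse_eq_divide)

lemma radicand_X_nonneg_iff: "radicand k (X p) \<ge> 0 \<longleftrightarrow> modepot k (p $ 1) \<ge> 0"
  using sigma_pos[of "p $ 1"] by (simp add: modepot_radicand zero_le_divide_iff)

lemma modepot_eq: "modepot k s = ((r s)\<^sup>2 + 1 - (real k)\<^sup>2) / ((r s)\<^sup>2 * (sigma s)\<^sup>2)"
  using r_pos[of s] sigma_pos[of s] by (simp add: modepot_def field_simps)

lemma modepot_sign:
  "modepot k s \<ge> 0 \<longleftrightarrow> real k \<le> sqrt (1 + (r s)\<^sup>2)" "modepot k s > 0 \<longleftrightarrow> real k < sqrt (1 + (r s)\<^sup>2)"
proof -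
  have pos: "(r s)\<^sup>2 * (sigma s)\<^sup>2 > 0" using r_pos[of s] sigma_pos[of s] by simp
  have "real k \<le> sqrt (1 + (r s)\<^sup>2) \<longleftrightarrow> (real k)\<^sup>2 \<le> 1 + (r s)\<^sup>2"
    by (metis of_nat_0_le_iff real_le_rsqrt real_sqrt_le_iff real_sqrt_unique)
  then show "modepot k s \<ge> 0 \<longleftrightarrow> real k \<le> sqrt (1 + (r s)\<^sup>2)"
    unfolding modepot_eq using pos by (simp add: zero_le_divide_iff) linarith
  have "real k < sqrt (1 + (r s)\<^sup>2) \<longleftrightarrow> (real k)\<^sup>2 < 1 + (r s)\<^sup>2"
    by (metis of_nat_0_le_iff real_less_rsqrt real_sqrt_less_iff real_sqrt_unique)
  then show "modepot k s > 0 \<longleftrightarrow> real k < sqrt (1 + (r s)\<^sup>2)"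
    unfolding modepot_eq using pos by (simp add: zero_less_divide_iff) linarith
qed

lemma all_points: "(\<forall>x\<in>range X. Q x) \<longleftrightarrow> (\<forall>p. Q (X p))"
  by blast

lemma slice_nth: "\<exists>p::real^2. p $ 1 = s"
  by (metis vector_2(1))

lemma range_nth: "range (\<lambda>p::real^2. f (p $ 1)) = range f"
  using slice_nth by (auto simp: image_iff) metis

lemma axis_dist_range: "axis_dist ` range X = range r"
  unfolding image_image axis_dist_X by (rule range_nth)

lemma mode_fun_range: "mode_fun k ` range X = range (\<lambda>s. sqrt (modepot k s))"
  unfolding image_image mode_fun_X by (rule range_nth)

lemma r_max_attained: obtains s where "r s = max_on (range X) axis_dist" "\<And>x. r x \<le> r s"
proof -
  obtain s where s: "\<And>x. r x \<le> r s"
    using periodic_attains_sup[of r T, OF cont_profile(1) per_r T_pos] by metis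
  have "max_on (range X) axis_dist = r s"
    unfolding max_on_def axis_dist_range by (rule cSup_eq_maximum) (use s in auto)
  then show ?thesis using that[of s] s by simp
qed

lemma r_min_attained: obtains s where "r s = min_on (range X) axis_dist" "\<And>x. r s \<le> r x"
proof -
  obtain s where s: "\<And>x. r s \<le> r x"
    using periodic_attains_inf[of r T, OF cont_profile(1) per_r T_pos] by metis
  have "min_on (range X) axis_dist = r s"
    unfolding min_on_def axis_dist_range by (rule cInf_eq_minimum) (use s in auto)
  then show ?thesis using that[of s] s by simp
qed

lemma max_mode_bound:
  assumes "modepot k s0 > 0"
  shows "max_mode (range X) k > 0" and "modepot k s \<le> (max_mode (range X) k)\<^sup>2"
proof -
  let ?A = "{x \<in> range X. radicand k x \<ge> 0}"
  have cm: "continuous_on UNIV (modepot k)" by (rule smooth1_cont[OF smooth_modepot])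
  obtain C where C: "\<And>s. \<bar>modepot k s\<bar> \<le> C" using periodic_bounded[OF cm per_modepot T_pos] by metis
  have bdd: "bdd_above (mode_fun k ` ?A)"
    by (rule bdd_aboveI[of _ "sqrt C"]) (use abs_le_D1[OF C] in \<open>auto simp: mode_fun_X\<close>)
  have le: "sqrt (modepot k s) \<le> max_mode (range X) k" if nn: "modepot k s \<ge> 0" for s
  proof -
    obtain p :: "real^2" where p: "p $ 1 = s" using slice_nth by blast
    have "mode_fun k (X p) \<le> max_mode (range X) k"
      unfolding max_mode_def max_on_def by (rule cSUP_upper[OF _ bdd]) (use p nn in \<open>simp add: radicand_X_nonneg_iff\<close>)
    then show ?thesis by (simp add: mode_fun_X p)
  qed
  have "0 < sqrt (modepot k s0)" using assms by simp
  also have "\<dots> \<le> max_mode (range X) k" using le assms by simp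
  finally show pos: "max_mode (range X) k > 0" .
  show "modepot k s \<le> (max_mode (range X) k)\<^sup>2"
  proof (cases "modepot k s \<ge> 0")
    case True
    then have "(sqrt (modepot k s))\<^sup>2 \<le> (max_mode (range X) k)\<^sup>2" using le by (intro power_mono) auto
    then show ?thesis using True by simp
  qed (use zero_le_power2[of "max_mode (range X) k"] in linarith)
qed

lemma min_mode_attained:
  assumes nn: "\<And>s. modepot k s \<ge> 0"
  obtains s where "min_mode (range X) k = sqrt (modepot k s)" "\<And>x. modepot k s \<le> modepot k x"
proof -
  have cm: "continuous_on UNIV (modepot k)" by (rule smooth1_cont[OF smooth_modepot])
  obtain s where s: "\<And>x. modepot k s \<le> modepot k x"
    using periodic_attains_inf[OF cm per_modepot T_pos] by metis
  have "{x \<in> range X. radicand k x \<ge> 0} = range X" using nn by (auto simp: radicand_X_nonneg_iff)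
  then have "min_mode (range X) k = Inf (range (\<lambda>s. sqrt (modepot k s)))"
    unfolding min_mode_def min_on_def by (simp only: mode_fun_range)
  also have "\<dots> = sqrt (modepot k s)" by (rule cInf_eq_minimum) (use s in auto)
  finally show ?thesis using that[of s] s by blast
qed

lemma profile_length_pos: "profile_length > 0"
proof -
  obtain s0 where s0: "\<And>s. wgt s0 \<le> wgt s"
    using periodic_attains_inf[OF cont_wgt per_wgt T_pos] by metis
  have "integral {0..T} (\<lambda>_. wgt s0) \<le> profile_length"
    unfolding profile_length_def
    by (rule integral_le) (auto intro!: integrable_continuous_real cont_wgt s0)
  moreover have "integral {0..T} (\<lambda>_. wgt s0) = T * wgt s0" using T_pos by simp
  ultimately show ?thesis using mult_pos_pos[OF T_pos wgt_pos[of s0]] by linarith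
qed

lemma integer_constant_mode_iff:
  "integer_constant_mode (range X) F k \<longleftrightarrow>
    (\<forall>s. modepot k s \<ge> 0) \<and> (\<exists>m::int. \<forall>s. F / (2 * pi) * sqrt (modepot k s) = of_int m)"
  unfolding integer_constant_mode_def all_points radicand_X_nonneg_iff mode_fun_X
  by (metis vector_2(1))

text \<open>
  Two constant modes would make \<open>r * sigma\<close> and then \<open>r\<close> constant, but the profile is closed.
\<close>

lemma constant_mode_unique:
  assumes "integer_constant_mode (range X) F i" "integer_constant_mode (range X) F j" "F > 0"
  shows "i = j"
proof (rule ccontr)
  assume "i \<noteq> j"
  have const: "modepot k s = modepot k 0" if c: "integer_constant_mode (range X) F k" for k s
  proof -
    obtain m :: int where m: "\<And>s. F / (2 * pi) * sqrt (modepot k s) = of_int m"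
      using c unfolding integer_constant_mode_iff by blast
    have "F / (2 * pi) * sqrt (modepot k s) = F / (2 * pi) * sqrt (modepot k 0)" unfolding m ..
    then have "sqrt (modepot k s) = sqrt (modepot k 0)" using \<open>F > 0\<close> by simp
    then show ?thesis by simp
  qed
  define W where "W s = (r s)\<^sup>2 * (sigma s)\<^sup>2" for s
  have W: "W s > 0" for s using r_pos[of s] sigma_pos[of s] by (simp add: W_def)
  have mp: "modepot k s = ((r s)\<^sup>2 + 1 - (real k)\<^sup>2) / W s" for k s by (simp add: modepot_eq W_def)
  define d where "d = (real j)\<^sup>2 - (real i)\<^sup>2"
  have d: "d \<noteq> 0" using \<open>i \<noteq> j\<close> by (simp add: d_def power2_eq_iff)
  have diff: "modepot i s - modepot j s = d / W s" for s
    unfolding mp d_def by (simp add: diff_divide_distrib[symmetric])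
  have "d / W s = d / W 0" for s using const[OF assms(1), of s] const[OF assms(2), of s] diff by metis
  then have WW: "W s = W 0" for s using d W[of s] W[of 0] by (simp add: field_simps)
  have "(r s)\<^sup>2 = (r 0)\<^sup>2" for s
    using const[OF assms(1), of s] W[of 0] unfolding mp WW[of s] by simp
  then have "r s = r 0" for s using r_pos[of s] r_pos[of 0] by (simp add: power2_eq_iff) (smt (verit))
  then have "r = (\<lambda>_. r 0)" by auto
  then have "(r has_real_derivative 0) (at s)" for s using DERIV_const by metis
  then have "rd s = 0" for s using DERIV_unique[OF r_deriv] by blast
  then show False using radial_direction by metis
qed

lemma finite_modes: "finite {k::nat. real k \<le> c}" "finite {k::nat. 1 \<le> k \<and> real k \<le> c}" "finite {k::nat. 1 \<le> k \<and> real k < c}"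
proof -
  have "{k::nat. real k \<le> c} \<subseteq> {..nat \<lfloor>c\<rfloor>}" by (auto simp: le_nat_floor)
  then show f: "finite {k::nat. real k \<le> c}" using finite_subset by blast
  show "finite {k::nat. 1 \<le> k \<and> real k \<le> c}" "finite {k::nat. 1 \<le> k \<and> real k < c}"
    by (rule finite_subset[OF _ f]; auto)+
qed

text \<open>
  Frequencies whose potential is nowhere positive have no negative eigenvalues; for the others, the
  potential is bounded by the square of the maximum of the mode function.
\<close>

theorem index_le:
  assumes S: "self_shrinker X"
  shows "surface_index P X \<le> ereal (of_int (index_upper (range X) profile_length))"
proof -
  obtain sm where sm: "r sm = max_on (range X) axis_dist" "\<And>x. r x \<le> r sm" using r_max_attained by metis
  define K where "K = {k::nat. 1 \<le> k \<and> real k < sqrt (1 + (max_on (range X) axis_dist)\<^sup>2)}"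
  define a where "a k = profile_length / (2 * pi) * max_mode (range X) k" for k
  define N where "N k = nat \<lceil>a k\<rceil>" for k
  have K: "finite K" "0 \<notin> K" unfolding K_def using finite_modes(3) by auto
  have mono: "sqrt (1 + (r s)\<^sup>2) \<le> sqrt (1 + (r sm)\<^sup>2)" for s
    using sm(2)[of s] r_pos[of s] by (simp add: power_mono)
  have K0: "modepot k s \<le> 0" if "k \<notin> insert 0 K" for k s
  proof -
    have "\<not> real k < sqrt (1 + (r sm)\<^sup>2)" using that by (auto simp: K_def sm(1))
    then have "\<not> real k < sqrt (1 + (r s)\<^sup>2)" using mono[of s] by linarith
    then show ?thesis unfolding modepot_sign(2)[symmetric] by simp
  qed
  have pos: "modepot k sm > 0" if "k \<in> insert 0 K" for k
    unfolding modepot_sign(2) using that by (auto simp: K_def sm(1) add_pos_nonneg)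
  have a: "a k > 0" if "k \<in> insert 0 K" for k
    unfolding a_def using profile_length_pos max_mode_bound(1)[OF pos[OF that]] by simp
  have N: "N k \<ge> 1" "int (N k) = \<lceil>a k\<rceil>" if "k \<in> insert 0 K" for k
    using a[OF that] by (simp_all add: N_def Suc_le_eq)
  have U: "(\<Sum>\<mu>\<in>R. mode_dim k \<mu>) \<le> 2 * N k - 1" if k: "k \<in> insert 0 K" and R: "finite R" "R \<subseteq> {..<0}" for k R
  proof (rule mode_count_le[OF max_mode_bound(1)[OF pos[OF k]] max_mode_bound(2)[OF pos[OF k]] N(1)[OF k] _ R])
    have "max_mode (range X) k * profile_length = 2 * pi * a k" by (simp add: a_def)
    also have "\<dots> \<le> 2 * pi * real (N k)" unfolding N_def by (intro mult_left_mono) (auto intro: real_nat_ceiling_ge)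
    finally show "max_mode (range X) k * profile_length \<le> 2 * pi * real (N k)" .
  qed
  define m where "m = (2 * N 0 - 1) + 2 * (\<Sum>k\<in>K. 2 * N k - 1)"
  have "num_negative_eigenvalues P X \<le> enat m"
    unfolding m_def by (rule num_negative_le[OF S K K0 U])
  then have "ereal_of_enat (num_negative_eigenvalues P X) \<le> ereal_of_enat (enat m)"
    by (simp only: ereal_of_enat_le_iff)
  then have "surface_index P X \<le> ereal (real m) - 4"
    unfolding surface_index_eq[OF S] by (intro ereal_minus_mono) auto
  also have "\<dots> = ereal (of_int (int m - 4))" by simp
  also have "int m - 4 = index_upper (range X) profile_length"
  proof -
    have c: "int (2 * N k - 1) = 2 * \<lceil>a k\<rceil> - 1" if "k \<in> insert 0 K" for k
      using N[OF that] by linarith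
    have "int (\<Sum>k\<in>K. 2 * N k - 1) = (\<Sum>k\<in>K. 2 * \<lceil>a k\<rceil> - 1)"
      unfolding of_nat_sum using c by (intro sum.cong) auto
    then have "int m = 2 * \<lceil>a 0\<rceil> - 1 + 2 * (\<Sum>k\<in>K. 2 * \<lceil>a k\<rceil> - 1)"
      unfolding m_def using c[of 0] by simp
    also have "2 * (\<Sum>k\<in>K. 2 * \<lceil>a k\<rceil> - 1) = (\<Sum>k\<in>K. 4 * \<lceil>a k\<rceil> - 2)"
      unfolding sum_distrib_left by (intro sum.cong) auto
    finally show ?thesis unfolding index_upper_def K_def a_def by simp
  qed
  finally show ?thesis .
qed

text \<open>
  When \<open>profile_length / (2 * pi)\<close> times the minimum is an integer, the eigenvalue on the borderline is
  negative unless the mode function is constant; then the two outermost ones are zero and are lost.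
  Subtraction on natural numbers truncates, which is harmless: for \<open>n = 0\<close> the bound is trivial.
\<close>

lemma mode_lower_bound:
  assumes nn: "\<And>s. modepot k s \<ge> 0"
  defines "n \<equiv> nat \<lfloor>profile_length / (2 * pi) * min_mode (range X) k\<rfloor>"
  shows "\<exists>R. finite R \<and> R \<subseteq> {..<0} \<and>
    2 * n + 1 - (if integer_constant_mode (range X) profile_length k then 2 else 0) \<le> (\<Sum>\<mu>\<in>R. mode_dim k \<mu>)"
proof -
  define m where "m = min_mode (range X) k"
  obtain s0 where s0: "m = sqrt (modepot k s0)" "\<And>x. modepot k s0 \<le> modepot k x"
    unfolding m_def using min_mode_attained[OF nn] by metis
  have m0: "m \<ge> 0" using s0(1) nn[of s0] by simp
  have msq: "m\<^sup>2 = modepot k s0" using s0(1) nn[of s0] by simp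
  have le: "m\<^sup>2 \<le> modepot k s" for s unfolding msq by (rule s0(2))
  define b where "b = profile_length / (2 * pi) * m"
  have b0: "b \<ge> 0" unfolding b_def using profile_length_pos m0 by simp
  have bm: "m * profile_length = 2 * pi * b" by (simp add: b_def)
  have n: "real n \<le> b" unfolding n_def m_def[symmetric] b_def[symmetric] using b0 by (simp add: of_nat_floor)
  have nint: "n = nat \<lfloor>b\<rfloor>" by (simp add: n_def b_def m_def)
  have not_const: "\<exists>s. m\<^sup>2 < modepot k s"
    if "\<not> integer_constant_mode (range X) profile_length k" "b = real n"
  proof (rule ccontr)
    assume "\<nexists>s. m\<^sup>2 < modepot k s"
    then have "modepot k s = m\<^sup>2" for s using le[of s] by (meson leI order_antisym)
    then have "profile_length / (2 * pi) * sqrt (modepot k s) = of_int (int n)" for s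
      using m0 that(2) by (simp add: b_def)
    then show False using that(1) nn unfolding integer_constant_mode_iff by blast
  qed
  show ?thesis
  proof (cases "integer_constant_mode (range X) profile_length k")
    case False
    have "\<exists>R. finite R \<and> R \<subseteq> {..<0} \<and> 2 * n + 1 \<le> (\<Sum>\<mu>\<in>R. mode_dim k \<mu>)"
    proof (cases "m = 0")
      case True
      then have "b = 0" "n = 0" by (simp_all add: b_def nint)
      then obtain s where "modepot k s > 0" using not_const[OF False] True by auto
      then obtain R where "finite R" "R \<subseteq> {..<0}" "1 \<le> (\<Sum>\<mu>\<in>R. mode_dim k \<mu>)"
        using mode_count_ge_1[OF nn] by metis
      then show ?thesis using \<open>n = 0\<close> by auto
    next
      case m: False
      then have mp: "m > 0" using m0 by simp
      have "2 * pi * real n < m * profile_length \<or> 2 * pi * real n \<le> m * profile_length \<and> (\<exists>s. m\<^sup>2 < modepot k s)"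
      proof (cases "b = real n")
        case True
        then show ?thesis unfolding bm using not_const[OF False True] by simp
      next
        case False
        then have "real n < b" using n by simp
        then show ?thesis unfolding bm by simp
      qed
      from mode_count_ge[OF mp le this] show ?thesis by metis
    qed
    then show ?thesis using False by simp
  next
    case True
    show ?thesis
    proof (cases "n = 0")
      case True
      then show ?thesis using \<open>integer_constant_mode _ _ _\<close> by (intro exI[of _ "{}"]) simp
    next
      case nz: False
      have "real (n - 1) < b" using n nz by linarith
      then have lt: "2 * pi * real (n - 1) < m * profile_length" unfolding bm by simp
      have "b \<noteq> 0" using n nz by linarith
      then have mp: "m > 0" using m0 by (auto simp: b_def less_le)
      obtain R where "finite R" "R \<subseteq> {..<0}" "2 * (n - 1) + 1 \<le> (\<Sum>\<mu>\<in>R. mode_dim k \<mu>)"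
        using mode_count_ge[OF mp le, of "n - 1"] lt by metis
      then show ?thesis using True nz by (intro exI[of _ R]) auto
    qed
  qed
qed

text \<open>
  Frequencies whose potential changes sign along the profile lie outside \<open>K\<close>; they may
  contribute eigenvalues and enter with the trivial bound.
\<close>

theorem index_ge:
  assumes S: "self_shrinker X"
  defines "c \<equiv> \<lambda>k. integer_constant_mode (range X) profile_length k"
  defines "K \<equiv> {k::nat. 1 \<le> k \<and> real k \<le> sqrt (1 + (min_on (range X) axis_dist)\<^sup>2)}"
  shows "ereal (of_int (index_lower (3 + 2 * of_bool (c 0) + 4 * int (card {k \<in> K. c k})) (range X) profile_length)) \<le> surface_index P X"
proof -
  obtain sm where sm: "r sm = max_on (range X) axis_dist" "\<And>x. r x \<le> r sm" using r_max_attained by metis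
  obtain sn where sn: "r sn = min_on (range X) axis_dist" "\<And>x. r sn \<le> r x" using r_min_attained by metis
  define K1 where "K1 = {k::nat. 1 \<le> k \<and> real k \<le> sqrt (1 + (r sm)\<^sup>2)}"
  have K1: "finite K1" "0 \<notin> K1" unfolding K1_def using finite_modes(2) by auto
  have mono: "sqrt (1 + (r s)\<^sup>2) \<le> sqrt (1 + (r sm)\<^sup>2)" "sqrt (1 + (r sn)\<^sup>2) \<le> sqrt (1 + (r s)\<^sup>2)" for s
    using sm(2)[of s] sn(2)[of s] r_pos[of s] r_pos[of sn] by (simp_all add: power_mono)
  have KK1: "K \<subseteq> K1" unfolding K_def K1_def sn(1)[symmetric] using order_trans[OF _ mono(2)[of sm]] by blast
  have K: "finite K" using finite_subset[OF KK1 K1(1)] .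
  have K0: "modepot k s \<le> 0" if "k \<notin> insert 0 K1" for k s
  proof -
    have "\<not> real k \<le> sqrt (1 + (r sm)\<^sup>2)" using that by (auto simp: K1_def)
    then have "\<not> real k < sqrt (1 + (r s)\<^sup>2)" using mono(1)[of s] by linarith
    then show ?thesis unfolding modepot_sign(2)[symmetric] by simp
  qed
  have nn: "modepot k s \<ge> 0" if "k \<in> insert 0 K" for k s
  proof -
    have "real k \<le> sqrt (1 + (r sn)\<^sup>2)" using that by (auto simp: K_def sn(1))
    then show ?thesis unfolding modepot_sign(1) using mono(2)[of s] by linarith
  qed
  define b where "b k = profile_length / (2 * pi) * min_mode (range X) k" for k
  have b0: "b k \<ge> 0" if k: "k \<in> insert 0 K" for k
  proof -
    obtain s where "min_mode (range X) k = sqrt (modepot k s)" using min_mode_attained[OF nn[OF k]] by metis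
    then show ?thesis unfolding b_def using profile_length_pos nn[OF k, of s] by simp
  qed
  define L where "L k = (if k \<in> insert 0 K then 2 * nat \<lfloor>b k\<rfloor> + 1 - (if c k then 2 else 0) else 0)" for k
  have L: "\<exists>R. finite R \<and> R \<subseteq> {..<0} \<and> L k \<le> (\<Sum>\<mu>\<in>R. mode_dim k \<mu>)" for k
  proof (cases "k \<in> insert 0 K")
    case True
    then show ?thesis unfolding L_def b_def c_def using mode_lower_bound[OF nn[OF True]] by simp
  next
    case False
    then show ?thesis unfolding L_def by (intro exI[of _ "{}"]) simp
  qed
  define m where "m = L 0 + 2 * (\<Sum>k\<in>K1. L k)"
  have "enat m \<le> num_negative_eigenvalues P X"
    unfolding m_def by (rule num_negative_ge[OF S K1 K0 L])
  then have "ereal_of_enat (enat m) \<le> ereal_of_enat (num_negative_eigenvalues P X)"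
    by (simp only: ereal_of_enat_le_iff)
  then have ge: "ereal (real m) - 4 \<le> surface_index P X"
    unfolding surface_index_eq[OF S] by (intro ereal_minus_mono) auto
  have Lk: "2 * \<lfloor>b k\<rfloor> + 1 - 2 * of_bool (c k) \<le> int (L k)" if "k \<in> insert 0 K" for k
    using that b0[OF that] unfolding L_def by (auto simp: of_nat_diff split: if_splits)
  have "(\<Sum>k\<in>K. 2 * \<lfloor>b k\<rfloor> + 1 - 2 * of_bool (c k)) \<le> (\<Sum>k\<in>K. int (L k))"
    by (rule sum_mono) (use Lk in simp)
  also have "\<dots> \<le> (\<Sum>k\<in>K1. int (L k))" by (rule sum_mono2[OF K1(1) KK1]) simp
  finally have "2 * \<lfloor>b 0\<rfloor> + 1 - 2 * of_bool (c 0) + 2 * (\<Sum>k\<in>K. 2 * \<lfloor>b k\<rfloor> + 1 - 2 * of_bool (c k)) \<le> int m"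
    using Lk[of 0] by (simp add: m_def)
  moreover have "2 * (\<Sum>k\<in>K. 2 * \<lfloor>b k\<rfloor> + 1 - 2 * of_bool (c k)) = (\<Sum>k\<in>K. 4 * \<lfloor>b k\<rfloor> + 2) - 4 * int (card {k \<in> K. c k})"
  proof -
    have "2 * (\<Sum>k\<in>K. 2 * \<lfloor>b k\<rfloor> + 1 - 2 * of_bool (c k)) = (\<Sum>k\<in>K. (4 * \<lfloor>b k\<rfloor> + 2) - 4 * of_bool (c k))"
      unfolding sum_distrib_left by (intro sum.cong) auto
    also have "\<dots> = (\<Sum>k\<in>K. 4 * \<lfloor>b k\<rfloor> + 2) - 4 * (\<Sum>k\<in>K. of_bool (c k))"
      by (simp add: sum_subtractf sum_distrib_left)
    also have "(\<Sum>k\<in>K. of_bool (c k)) = int (card {k \<in> K. c k})"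
      using K by (simp add: sum_of_bool_eq Int_def)
    finally show ?thesis .
  qed
  ultimately have "index_lower (3 + 2 * of_bool (c 0) + 4 * int (card {k \<in> K. c k})) (range X) profile_length \<le> int m - 4"
    unfolding index_lower_def K_def[symmetric] b_def by simp
  then have "real_of_int (index_lower (3 + 2 * of_bool (c 0) + 4 * int (card {k \<in> K. c k})) (range X) profile_length) \<le> real m - 4"
    by linarith
  then have "ereal (of_int (index_lower (3 + 2 * of_bool (c 0) + 4 * int (card {k \<in> K. c k})) (range X) profile_length)) \<le> ereal (real m - 4)"
    by simp
  also have "\<dots> = ereal (real m) - 4" by simp
  finally show ?thesis using ge by (rule order_trans)
qed

end

theorem theorem4p5:
  fixes T F :: real and r z :: "real \<Rightarrow> real"
    and P :: "real^2" and X :: "real^2 \<Rightarrow> real^3" and S :: "(real^3) set"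
  assumes "closed_halfplane_curve T r z"
    and "X = revolve r z" and "P = torus_periods T" and "S = range X"
    and "self_shrinker X"
    and "F = surface_entropy P X"
  shows "surface_index P X \<le> ereal (of_int (index_upper S F)) \<and>
    ((\<nexists>k. integer_constant_mode S F k) \<longrightarrow>
      surface_index P X \<ge> ereal (of_int (index_lower 3 S F))) \<and>
    (integer_constant_mode S F 0 \<longrightarrow>
      surface_index P X \<ge> ereal (of_int (index_lower 5 S F))) \<and>
    (\<forall>k>0. integer_constant_mode S F k \<longrightarrow>
      surface_index P X \<ge> ereal (of_int (index_lower 7 S F)))"
proof -
  interpret profile T r z by unfold_locales (rule assms(1))
  have S: "self_shrinker (revolve r z)" using assms(2,5) by simp
  have F: "F = profile_length" using entropy_eq_length[OF S] assms by simp
  let ?c = "integer_constant_mode (range (revolve r z)) profile_length"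
  let ?K = "{k::nat. 1 \<le> k \<and> real k \<le> sqrt (1 + (min_on (range (revolve r z)) axis_dist)\<^sup>2)}"
  have unique: "i = j" if "?c i" "?c j" for i j
    by (rule constant_mode_unique[OF that profile_length_pos])
  have lower: "ereal (of_int (index_lower d (range (revolve r z)) profile_length)) \<le> surface_index (torus_periods T) (revolve r z)"
    if "3 + 2 * of_bool (?c 0) + 4 * int (card {k \<in> ?K. ?c k}) \<le> d" for d
  proof -
    have "index_lower d (range (revolve r z)) profile_length
        \<le> index_lower (3 + 2 * of_bool (?c 0) + 4 * int (card {k \<in> ?K. ?c k})) (range (revolve r z)) profile_length"
      using that by (simp add: index_lower_def)
    then show ?thesis using index_ge[OF S] by (meson ereal_less_eq(3) of_int_le_iff order_trans)
  qed
  show ?thesis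
    unfolding assms(2-4) F
  proof (intro conjI impI allI)
    show "surface_index (torus_periods T) (revolve r z) \<le> ereal (of_int (index_upper (range (revolve r z)) profile_length))"
      by (rule index_le[OF S])
    show "ereal (of_int (index_lower 3 (range (revolve r z)) profile_length)) \<le> surface_index (torus_periods T) (revolve r z)"
      if "\<nexists>k. ?c k"
      by (rule lower) (use that in simp)
    show "ereal (of_int (index_lower 5 (range (revolve r z)) profile_length)) \<le> surface_index (torus_periods T) (revolve r z)"
      if "?c 0"
    proof (rule lower)
      have "{k \<in> ?K. ?c k} = {}" using unique[OF that] by auto
      then show "3 + 2 * of_bool (?c 0) + 4 * int (card {k \<in> ?K. ?c k}) \<le> 5" using that by (simp only:) simp
    qed
    show "ereal (of_int (index_lower 7 (range (revolve r z)) profile_length)) \<le> surface_index (torus_periods T) (revolve r z)"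
      if "0 < k" "?c k" for k
    proof (rule lower)
      have "\<not> ?c 0" using unique[OF that(2), of 0] that(1) by blast
      moreover have "card {k \<in> ?K. ?c k} \<le> card {k}"
        by (rule card_mono) (use unique[OF that(2)] in auto)
      ultimately show "3 + 2 * of_bool (?c 0) + 4 * int (card {k \<in> ?K. ?c k}) \<le> 7" by simp
    qed
  qed
qed

end
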